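(* The stratification of $X_\mu(b)$ into the sets $\{j\Lambda_0\}$ and $j\{\Lambda_x\mid x\in\mathbb P^1(\overline k)\setminus\mathbb P^1(\mathbb F_{q^2})\}$, where $j$ runs through $J_b(F)$, coincides with the stratification by the functions $f_g$. That is, for $g,g'\in G(L)$ with $g\Lambda_0,g'\Lambda_0\in X_\mu(b)$, the lattices $g\Lambda_0$ and $g'\Lambda_0$ lie in the same one of these sets if and only if $f_g=f_{g'}$.
   Context: Let $k=\mathbb F_q$ be a finite field of characteristic $p$ with algebraic closure $\overline k$, and let either $F=W(k)[1/p]$, $\epsilon=p$, or $F=k((t))$, $\epsilon=t$. Let $L$ be the completion of the maximal unramified extension of $F$, with valuation ring $\mathcal O_L$ and Frobenius $\sigma$ over $F$. For $x\in\overline k$ let $[x]\in\mathcal O_L$ be its Teichmüller (resp. constant) representative. Let $N=L^4$ with basis $e_1,e_2,f_1,f_2$; put $e_{i+2}=\epsilon e_i$ and $f_{i+2}=\epsilon f_i$ for $i\in\mathbb Z$ (so $f_0=\epsilon^{-1}f_2$). Let $\langle\cdot,\cdot\rangle$ be the alternating form with $\langle e_1,f_2\rangle=\langle e_2,f_1\rangle=1$ and all other pairings of two of the basis vectors equal to $0$ (up to antisymmetry). Let $G=GSp_4=GSp(N,\langle\cdot,\cdot\rangle)$, let $\Lambda_0$ be the $\mathcal O_L$-lattice generated by $e_1,e_2,f_1,f_2$, and let $K=G(\mathcal O_L)$ be the stabilizer of $\Lambda_0$ in $G(L)$. Let $b\in G(L)$ be the element with $b\sigma(e_i)=e_{i+1}$,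 $b\sigma(f_i)=f_{i+1}$ (where $\sigma$ fixes $e_1,e_2,f_1,f_2$); it is basic of slope $\frac12$. Let $\mu=(1,1,0,0)$ be the minuscule coweight with $[b]\in B(G,\mu)$. Put $\Phi=b\sigma$ and $V=\epsilon\Phi^{-1}$. Via $g\mapsto g\Lambda_0$, the set $X_\mu(b)=\{g\in G(L)/K\mid g^{-1}b\sigma(g)\in K\mu(\epsilon)K\}$ is identified with the set of lattices $M\subset N$ stable under $\Phi$ and $V$ on which $\langle\cdot,\cdot\rangle$ is perfect up to a scalar factor. Let $J_b(F)=\{g\in G(L)\mid gb=b\sigma(g)\}$. For $x\in\mathbb P^1(\overline k)\setminus\mathbb P^1(\mathbb F_{q^2})=\overline k\setminus\mathbb F_{q^2}$ let $\Lambda_x=\langle e_1+[x]f_0,e_2,f_1,f_2\rangle_{\mathcal O_L}$. By a classification due to Kaiser, $X_\mu(b)$ is stratified by the sets $\{j\Lambda_0\}$ and $j\{\Lambda_x\mid x\in\mathbb P^1(\overline k)\setminus\mathbb P^1(\mathbb F_{q^2})\}$ for $j\in J_b(F)$. For $g\in G(L)$, $f_g:J_b(F)\to X_*(T)_{\mathrm{dom}}$ is defined by $f_g(j)=\mathrm{inv}(j,g)$, where $T$ is the standard maximal torus of $G$ and $\mathrm{inv}(j,g)$ is the unique dominant cocharacter $\xi$ with $j^{-1}g\in K\xi(\epsilon)K$. *)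

theory Defs
  imports "HOL-Analysis.Analysis" "HOL-Algebra.Algebraic_Closure_Type"
begin

no_notation fps_nth (infixl \<open>$\<close> 75)

section \<open>The fields\<close>

text \<open>
  A discrete valuation on a field is given by its values on nonzero elements; the value
  \<open>v 0\<close> is junk, and every use below treats \<open>0\<close> separately.
\<close>

definition frac_ideal :: "('l::field \<Rightarrow> int) \<Rightarrow> int \<Rightarrow> 'l set" where
  "frac_ideal v n = {x. x = 0 \<or> n \<le> v x}"

abbreviation val_ring :: "('l::field \<Rightarrow> int) \<Rightarrow> 'l set" where
  "val_ring v \<equiv> frac_ideal v 0"

locale discrete_valuation =
  fixes v :: "'l::field \<Rightarrow> int"
  assumes v_mult: "x \<noteq> 0 \<Longrightarrow> y \<noteq> 0 \<Longrightarrow> v (x * y) = v x + v y"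
    and v_add: "x \<noteq> 0 \<Longrightarrow> y \<noteq> 0 \<Longrightarrow> x + y \<noteq> 0 \<Longrightarrow> min (v x) (v y) \<le> v (x + y)"

definition complete_on :: "('l::field \<Rightarrow> int) \<Rightarrow> 'l set \<Rightarrow> bool" where
  "complete_on v S \<longleftrightarrow>
     (\<forall>s. (\<forall>i::nat. s i \<in> S) \<longrightarrow>
          (\<forall>n. \<exists>N. \<forall>i\<ge>N. \<forall>j\<ge>N. s i - s j \<in> frac_ideal v n) \<longrightarrow>
          (\<exists>l\<in>S. \<forall>n. \<exists>N. \<forall>i\<ge>N. s i - l \<in> frac_ideal v n))"

text \<open>
  The finite field \<open>k = \<F>\<^sub>q\<close> is the type \<open>'k\<close>, so that \<open>q = CARD('k)\<close>, \<open>p = CHAR('k)\<close>, and its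
  algebraic closure is the type \<open>'k alg_closure\<close>. The field \<open>L\<close> is the type \<open>'l\<close>, and \<open>F\<close> is a
  subset of it; \<open>res\<close> is the reduction map from the valuation ring of \<open>L\<close> onto its residue
  field (its values off the valuation ring are irrelevant), and \<open>teich x\<close> is \<open>[x]\<close>.

  The fields are given by the properties that determine them. \<open>F\<close> is complete for a discrete
  valuation with residue field \<open>k\<close> and uniformizer \<open>\<epsilon>\<close>; if its characteristic is \<open>0\<close> and
  \<open>\<epsilon> = p\<close> then its valuation ring is the ring of Witt vectors \<open>W(k)\<close> and \<open>F = W(k)[1/p]\<close>,
  and if its characteristic is \<open>p\<close> then \<open>F = k((\<epsilon>))\<close>. \<open>L\<close> is complete, unramified over \<open>F\<close> (the
  element \<open>\<epsilon>\<close> is still a uniformizer), and has the algebraic closure of \<open>k\<close> as residue field;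
  that is, \<open>L\<close> is the completion of the maximal unramified extension of \<open>F\<close>. \<open>\<sigma>\<close> is the
  automorphism of \<open>L\<close> over \<open>F\<close> lifting \<open>x \<mapsto> x\<^sup>q\<close>. The Teichmueller map is the
  multiplicative section of \<open>res\<close>, which in characteristic \<open>p\<close> is additive as well and embeds
  the residue field as the field of constants.
\<close>

locale completed_unramified_extension = discrete_valuation v
  for v :: "'l::field \<Rightarrow> int" +
  fixes res :: "'l \<Rightarrow> 'k::finite_field alg_closure"
    and F :: "'l set"
    and \<epsilon> :: 'l
    and \<sigma> :: "'l \<Rightarrow> 'l"
    and teich :: "'k alg_closure \<Rightarrow> 'l"
  assumes L_complete: "complete_on v UNIV"
    and res_add: "x \<in> val_ring v \<Longrightarrow> y \<in> val_ring v \<Longrightarrow> res (x + y) = res x + res y"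
    and res_mult: "x \<in> val_ring v \<Longrightarrow> y \<in> val_ring v \<Longrightarrow> res (x * y) = res x * res y"
    and res_one: "res 1 = 1"
    and res_surj: "res ` val_ring v = UNIV"
    and res_kernel: "x \<in> val_ring v \<Longrightarrow> res x = 0 \<longleftrightarrow> x \<in> frac_ideal v 1"
    and F_one: "1 \<in> F"
    and F_diff: "x \<in> F \<Longrightarrow> y \<in> F \<Longrightarrow> x - y \<in> F"
    and F_mult: "x \<in> F \<Longrightarrow> y \<in> F \<Longrightarrow> x * y \<in> F"
    and F_inverse: "x \<in> F \<Longrightarrow> inverse x \<in> F"
    and F_complete: "complete_on v F"
    and F_residue_field: "res ` (F \<inter> val_ring v) = range to_ac"
    and uniformizer: "\<epsilon> \<in> F" "\<epsilon> \<noteq> 0" "v \<epsilon> = 1"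
    and teich_integral: "teich a \<in> val_ring v"
    and teich_mult: "teich (a * b) = teich a * teich b"
    and res_teich: "res (teich a) = a"
    and mixed_or_equal_characteristic:
      "(CHAR('l) = 0 \<and> \<epsilon> = of_nat CHAR('k)) \<or>
       (CHAR('l) = CHAR('k) \<and> (\<forall>a b. teich (a + b) = teich a + teich b))"
    and \<sigma>_bij: "bij \<sigma>"
    and \<sigma>_add: "\<sigma> (x + y) = \<sigma> x + \<sigma> y"
    and \<sigma>_mult: "\<sigma> (x * y) = \<sigma> x * \<sigma> y"
    and \<sigma>_fixes_F: "x \<in> F \<Longrightarrow> \<sigma> x = x"
    and \<sigma>_valuation: "x \<noteq> 0 \<Longrightarrow> v (\<sigma> x) = v x"
    and \<sigma>_residue: "x \<in> val_ring v \<Longrightarrow> res (\<sigma> x) = res x ^ CARD('k)"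


section \<open>The symplectic space and its group of similitudes\<close>

text \<open>
  \<open>N = L\<^sup>4\<close> with coordinates with respect to the ordered basis \<open>e\<^sub>1, e\<^sub>2, f\<^sub>1, f\<^sub>2\<close>.
  The families are extended to all integer indices by \<open>e\<^sub>i\<^sub>+\<^sub>2 = \<epsilon> e\<^sub>i\<close> and \<open>f\<^sub>i\<^sub>+\<^sub>2 = \<epsilon> f\<^sub>i\<close>.
\<close>

definition e_vec :: "'l::field \<Rightarrow> int \<Rightarrow> 'l ^ 4" where
  "e_vec \<epsilon> i = \<epsilon> powi ((i - 1) div 2) *s axis (if odd i then 1 else 2) 1"

definition f_vec :: "'l::field \<Rightarrow> int \<Rightarrow> 'l ^ 4" where
  "f_vec \<epsilon> i = \<epsilon> powi ((i - 1) div 2) *s axis (if odd i then 3 else 4) 1"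

definition sympl_form :: "'l::field ^ 4 \<Rightarrow> 'l ^ 4 \<Rightarrow> 'l" where
  "sympl_form x y = x $ 1 * y $ 4 + x $ 2 * y $ 3 - x $ 3 * y $ 2 - x $ 4 * y $ 1"

definition GSp4 :: "('l::field ^ 4 ^ 4) set" where
  "GSp4 = {g. invertible g \<and>
     (\<exists>c. c \<noteq> 0 \<and> (\<forall>x y. sympl_form (g *v x) (g *v y) = c * sympl_form x y))}"

definition lattice_span :: "('l::field \<Rightarrow> int) \<Rightarrow> ('l ^ 4) set \<Rightarrow> ('l ^ 4) set" where
  "lattice_span v B = {(\<Sum>x\<in>B. c x *s x) |c. \<forall>x\<in>B. c x \<in> val_ring v}"

definition Lambda0 :: "('l::field \<Rightarrow> int) \<Rightarrow> 'l \<Rightarrow> ('l ^ 4) set" where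
  "Lambda0 v \<epsilon> = lattice_span v {e_vec \<epsilon> 1, e_vec \<epsilon> 2, f_vec \<epsilon> 1, f_vec \<epsilon> 2}"

definition Lambda :: "('l::field \<Rightarrow> int) \<Rightarrow> 'l \<Rightarrow> ('a \<Rightarrow> 'l) \<Rightarrow> 'a \<Rightarrow> ('l ^ 4) set" where
  "Lambda v \<epsilon> teich x =
     lattice_span v {e_vec \<epsilon> 1 + teich x *s f_vec \<epsilon> 0, e_vec \<epsilon> 2, f_vec \<epsilon> 1, f_vec \<epsilon> 2}"

definition translate :: "'l::field ^ 4 ^ 4 \<Rightarrow> ('l ^ 4) set \<Rightarrow> ('l ^ 4) set" where
  "translate g M = (\<lambda>x. g *v x) ` M"

definition K_stab :: "('l::field \<Rightarrow> int) \<Rightarrow> 'l \<Rightarrow> ('l ^ 4 ^ 4) set" where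
  "K_stab v \<epsilon> = {g \<in> GSp4. translate g (Lambda0 v \<epsilon>) = Lambda0 v \<epsilon>}"

text \<open>
  \<open>T\<close> is the diagonal torus of \<open>GSp\<^sub>4\<close>; its cocharacters are the \<open>\<xi>\<close> with
  \<open>\<xi>\<^sub>1 + \<xi>\<^sub>4 = \<xi>\<^sub>2 + \<xi>\<^sub>3\<close>, and dominance is taken for the upper triangular Borel subgroup.
\<close>

definition dominant_cochars :: "(int ^ 4) set" where
  "dominant_cochars =
     {\<xi>. \<xi> $ 1 + \<xi> $ 4 = \<xi> $ 2 + \<xi> $ 3 \<and> \<xi> $ 1 \<ge> \<xi> $ 2 \<and> \<xi> $ 2 \<ge> \<xi> $ 3 \<and> \<xi> $ 3 \<ge> \<xi> $ 4}"

definition cochar_at :: "int ^ 4 \<Rightarrow> 'l::field \<Rightarrow> 'l ^ 4 ^ 4" where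
  "cochar_at \<xi> \<epsilon> = (\<chi> i j. if i = j then \<epsilon> powi (\<xi> $ i) else 0)"

definition double_coset :: "('l::field \<Rightarrow> int) \<Rightarrow> 'l \<Rightarrow> int ^ 4 \<Rightarrow> ('l ^ 4 ^ 4) set" where
  "double_coset v \<epsilon> \<xi> =
     {h ** cochar_at \<xi> \<epsilon> ** h' |h h'. h \<in> K_stab v \<epsilon> \<and> h' \<in> K_stab v \<epsilon>}"

definition rel_inv ::
    "('l::field \<Rightarrow> int) \<Rightarrow> 'l \<Rightarrow> 'l ^ 4 ^ 4 \<Rightarrow> 'l ^ 4 ^ 4 \<Rightarrow> int ^ 4" where
  "rel_inv v \<epsilon> j g =
     (THE \<xi>. \<xi> \<in> dominant_cochars \<and> matrix_inv j ** g \<in> double_coset v \<epsilon> \<xi>)"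


section \<open>The affine Deligne-Lusztig set and its two stratifications\<close>

text \<open>The columns of \<open>b\<close> are the images \<open>e\<^sub>2, e\<^sub>3, f\<^sub>2, f\<^sub>3\<close> of \<open>e\<^sub>1, e\<^sub>2, f\<^sub>1, f\<^sub>2\<close>.\<close>

definition b_elt :: "'l::field \<Rightarrow> 'l ^ 4 ^ 4" where
  "b_elt \<epsilon> = transpose (vector [e_vec \<epsilon> 2, e_vec \<epsilon> 3, f_vec \<epsilon> 2, f_vec \<epsilon> 3])"

definition J_b :: "'l::field \<Rightarrow> ('l \<Rightarrow> 'l) \<Rightarrow> ('l ^ 4 ^ 4) set" where
  "J_b \<epsilon> \<sigma> = {g \<in> GSp4. g ** b_elt \<epsilon> = b_elt \<epsilon> ** map_matrix \<sigma> g}"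

definition mu :: "int ^ 4" where
  "mu = vector [1, 1, 0, 0]"

text \<open>The preimage of \<open>X\<^sub>\<mu>(b)\<close> in \<open>G(L)\<close>.\<close>

definition X_mu_b :: "('l::field \<Rightarrow> int) \<Rightarrow> 'l \<Rightarrow> ('l \<Rightarrow> 'l) \<Rightarrow> ('l ^ 4 ^ 4) set" where
  "X_mu_b v \<epsilon> \<sigma> =
     {g \<in> GSp4. matrix_inv g ** b_elt \<epsilon> ** map_matrix \<sigma> g \<in> double_coset v \<epsilon> mu}"

definition kaiser_strata ::
    "('l::field \<Rightarrow> int) \<Rightarrow> 'l \<Rightarrow> ('l \<Rightarrow> 'l) \<Rightarrow> ('k::finite_field alg_closure \<Rightarrow> 'l)
       \<Rightarrow> ('l ^ 4) set set set" where
  "kaiser_strata v \<epsilon> \<sigma> teich =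
     {{translate j (Lambda0 v \<epsilon>)} |j. j \<in> J_b \<epsilon> \<sigma>} \<union>
     {{translate j (Lambda v \<epsilon> teich x) |x. x ^ (CARD('k) ^ 2) \<noteq> x} |j. j \<in> J_b \<epsilon> \<sigma>}"

definition f_inv ::
    "('l::field \<Rightarrow> int) \<Rightarrow> 'l \<Rightarrow> ('l \<Rightarrow> 'l) \<Rightarrow> 'l ^ 4 ^ 4 \<Rightarrow> ('l ^ 4 ^ 4 \<Rightarrow> int ^ 4)" where
  "f_inv v \<epsilon> \<sigma> g = (\<lambda>j\<in>J_b \<epsilon> \<sigma>. rel_inv v \<epsilon> j g)"

end

theory Submission
  imports Defs
begin

text \<open>
  Every lattice \<open>M\<close> in \<open>X\<^sub>\<mu>(b)\<close> meets the Lagrangian \<open>\<langle>e\<^sub>1, e\<^sub>2\<rangle>\<close> and projects to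
  \<open>\<langle>f\<^sub>1, f\<^sub>2\<rangle>\<close> in members of the unique chains of \<open>\<Phi>\<close>-stable lattices. After translation by
  \<open>J\<^sub>b(F)\<close> this leaves \<open>M = \<langle>e\<^sub>1, e\<^sub>2, z, \<Phi> z\<rangle>\<close> with \<open>z = f\<^sub>1 + \<alpha> e\<^sub>1 + \<beta> e\<^sub>2\<close>; isotropy
  and \<open>V\<close>-stability make \<open>\<alpha>\<close> and \<open>\<epsilon> \<beta>\<close> congruent to \<open>\<sigma>\<close>- and \<open>\<sigma>\<^sup>2\<close>-fixed elements up to one
  digit of \<open>\<epsilon> \<beta>\<close>, and this digit is the parameter of a \<open>\<Lambda>\<^sub>x\<close>. This proves Kaiser's
  classification.

  Let \<open>P\<close> be spanned by \<open>\<epsilon> e\<^sub>1, e\<^sub>2, f\<^sub>1, f\<^sub>2\<close>, so that the \<open>\<Lambda>\<^sub>x\<close> are lines in the plane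
  \<open>P\<^sup>\<or>/P\<close>. For every \<open>j\<close> in \<open>J\<^sub>b(F)\<close> some symplectic transvections along a vector that is
  rational modulo \<open>P\<close> fix \<open>j\<Lambda>\<^sub>0\<close>; they permute the \<open>\<Lambda>\<^sub>x\<close> with irrational \<open>x\<close> transitively, so
  \<open>f\<^sub>g\<close> is constant on the strata. Conversely \<open>\<Phi>\<Lambda>\<^sub>x + V\<Lambda>\<^sub>x = P\<close> is contained in every
  \<open>j\<Lambda>\<^sub>0\<close> of relative position \<open>(1, 0, 0, -1)\<close> to \<open>\<Lambda>\<^sub>x\<close>, and \<open>P\<close> is the intersection of two
  such lattices, so \<open>f\<^sub>g\<close> determines \<open>P\<close> and thereby the stratum.
\<close>

text \<open>The transvections need not lie in J_b(F), and they depend on j. This is harmless,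
  because a relative position depends only on a pair of lattices up to a common element of G(L): for
  each j it is enough that some similitude fixes j Lambda_0 and moves Lambda_x to Lambda_y. On the
  plane P^\<or>/P a transvection along u fixes the line of u, and by varying its coefficient it
  carries any other line to every line but that of u. Rationality of u is what keeps the line of u
  away from the irrational x. Integrality on j Lambda_0 and a nontrivial action on P^\<or>/P compete
  with each other; this dictates the scale of u and the factor \<epsilon> in the coefficient. The
  position (1, 0, 0, -1) is that of two lattices given by distinct lines in P^\<or>/P, whereas
  position 0 means equality and so isolates the one-point strata. Lattice indices never enter: every
  g Lambda_0 is self-dual up to its multiplier, and this turns inclusions into equalities.\<close>

lemma vector_4 [simp]:
  "(vector [a, b, c, d] :: 'a::zero ^ 4) $ 1 = a"
  "(vector [a, b, c, d] :: 'a ^ 4) $ 2 = b"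
  "(vector [a, b, c, d] :: 'a ^ 4) $ 3 = c"
  "(vector [a, b, c, d] :: 'a ^ 4) $ 4 = d"
  unfolding vector_def by auto

lemma vec4_eq_iff: "x = y \<longleftrightarrow> x $ 1 = y $ 1 \<and> x $ 2 = y $ 2 \<and> x $ 3 = y $ 3 \<and> x $ 4 = y $ 4"
  for x y :: "'a ^ 4"
  by (simp add: vec_eq_iff forall_4)

definition cols :: "'l::field ^ 4 \<Rightarrow> 'l ^ 4 \<Rightarrow> 'l ^ 4 \<Rightarrow> 'l ^ 4 \<Rightarrow> 'l ^ 4 ^ 4" where
  "cols a b c d = transpose (vector [a, b, c, d])"

lemma cols_mult: "cols a b c d *v z = z $ 1 *s a + z $ 2 *s b + z $ 3 *s c + z $ 4 *s d"
  by (simp add: cols_def vec_eq_iff matrix_vector_mult_def transpose_def sum_4 mult.commute)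

lemma matrix_eq_on_vectors:
  fixes A B :: "'l::field ^ 'n ^ 'm"
  assumes "\<And>x. A *v x = B *v x"
  shows "A = B"
  using assms by (simp add: matrix_eq)

lemma cols_unique: "g = cols (g *v axis 1 1) (g *v axis 2 1) (g *v axis 3 1) (g *v axis 4 1)"
  by (simp add: vec_eq_iff cols_def transpose_def matrix_vector_mult_def sum_4 forall_4 axis_def)

lemma matrix_inv_mult:
  fixes g :: "'l::field ^ 'n ^ 'n"
  assumes "invertible g"
  shows "matrix_inv g ** g = mat 1" "g ** matrix_inv g = mat 1"
proof -
  have "g ** matrix_inv g = mat 1 \<and> matrix_inv g ** g = mat 1"
    using assms unfolding invertible_def matrix_inv_def by (rule someI_ex)
  then show "matrix_inv g ** g = mat 1" "g ** matrix_inv g = mat 1" by auto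
qed

lemma matrix_inv_apply:
  fixes g :: "'l::field ^ 'n ^ 'n"
  assumes "invertible g"
  shows "matrix_inv g *v (g *v x) = x" "g *v (matrix_inv g *v x) = x"
  by (simp_all add: assms matrix_vector_mul_assoc matrix_inv_mult)


subsection \<open>The symplectic form and similitudes\<close>

lemma sympl_form_add_left: "sympl_form (x + y) z = sympl_form x z + sympl_form y z"
  and sympl_form_add_right: "sympl_form z (x + y) = sympl_form z x + sympl_form z y"
  and sympl_form_scale_left: "sympl_form (a *s x) z = a * sympl_form x z"
  and sympl_form_scale_right: "sympl_form z (a *s x) = a * sympl_form z x"
  by (simp_all add: sympl_form_def algebra_simps)

lemma sympl_form_self [simp]: "sympl_form x x = 0"
  by (simp add: sympl_form_def)

lemma sympl_form_commute: "sympl_form y x = - sympl_form x y"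
  by (simp add: sympl_form_def)

lemmas sympl_form_linear =
  sympl_form_add_left sympl_form_add_right sympl_form_scale_left sympl_form_scale_right

lemma sympl_form_nondegenerate:
  assumes "\<And>y. sympl_form x y = 0"
  shows "x = 0"
  using assms[of "axis 1 1"] assms[of "axis 2 1"] assms[of "axis 3 1"] assms[of "axis 4 1"]
  by (simp add: sympl_form_def axis_def vec4_eq_iff)

text \<open>The multiplier is an explicit argument because its valuation is the scale at which the
  lattice g Lambda_0 is its own dual.\<close>

definition simil :: "'l::field ^ 4 ^ 4 \<Rightarrow> 'l \<Rightarrow> bool" where
  "simil g c \<longleftrightarrow> c \<noteq> 0 \<and> (\<forall>x y. sympl_form (g *v x) (g *v y) = c * sympl_form x y)"

lemma simil_nonzero: "simil g c \<Longrightarrow> c \<noteq> 0"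
  and simil_form: "simil g c \<Longrightarrow> sympl_form (g *v x) (g *v y) = c * sympl_form x y"
  by (simp_all add: simil_def)

text \<open>A vector in the kernel pairs to zero with everything, since the multiplier is nonzero;
  nondegeneracy of the form then kills it.\<close>

lemma simil_invertible:
  assumes "simil g c"
  shows "invertible g"
proof -
  have "x = 0" if "g *v x = 0" for x
  proof (rule sympl_form_nondegenerate)
    fix y
    have "c * sympl_form x y = sympl_form 0 (g *v y)" using simil_form[OF assms, of x y] that by simp
    also have "\<dots> = 0" by (simp add: sympl_form_def)
    finally show "sympl_form x y = 0" using simil_nonzero[OF assms] by simp
  qed
  then show ?thesis by (metis invertible_left_inverse matrix_left_invertible_ker)
qed

lemma GSp4_iff_simil: "g \<in> GSp4 \<longleftrightarrow> (\<exists>c. simil g c)"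
  using simil_invertible by (auto simp: GSp4_def simil_def)

lemma GSp4_similE:
  assumes "g \<in> GSp4"
  obtains c where "simil g c"
  using assms GSp4_iff_simil by blast

lemma simil_GSp4: "simil g c \<Longrightarrow> g \<in> GSp4"
  using GSp4_iff_simil by blast

lemma GSp4_invertible: "g \<in> GSp4 \<Longrightarrow> invertible g"
  by (simp add: GSp4_def)

lemma simil_mat_1: "simil (mat 1) 1"
  by (simp add: simil_def)

lemma simil_mult: "simil g c \<Longrightarrow> simil h d \<Longrightarrow> simil (g ** h) (c * d)"
  by (simp add: simil_def flip: matrix_vector_mul_assoc)

lemma simil_inv:
  assumes "simil g c"
  shows "simil (matrix_inv g) (inverse c)"
proof -
  note inv = matrix_inv_apply[OF simil_invertible[OF assms]]
  have "sympl_form (matrix_inv g *v x) (matrix_inv g *v y) = inverse c * sympl_form x y" for x y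
    using simil_form[OF assms, of "matrix_inv g *v x" "matrix_inv g *v y"] simil_nonzero[OF assms]
    by (simp add: inv)
  then show ?thesis using simil_nonzero[OF assms] by (simp add: simil_def)
qed

lemma GSp4_mult: "g \<in> GSp4 \<Longrightarrow> h \<in> GSp4 \<Longrightarrow> g ** h \<in> GSp4"
  and GSp4_inv: "g \<in> GSp4 \<Longrightarrow> matrix_inv g \<in> GSp4"
  and GSp4_mat_1: "mat 1 \<in> GSp4"
  using simil_mult simil_inv simil_mat_1 by (metis GSp4_iff_simil)+

text \<open>The hypotheses say that the columns have m times the Gram matrix of the standard basis.
  All similitudes below, except the diagonal ones and the transvections, are built in this
  way.\<close>

lemma simil_cols:
  assumes "m \<noteq> 0" "sympl_form a d = m" "sympl_form b c = m" "sympl_form a b = 0"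
    "sympl_form a c = 0" "sympl_form b d = 0" "sympl_form c d = 0"
  shows "simil (cols a b c d) m"
proof -
  have *: "sympl_form d a = - m" "sympl_form c b = - m" "sympl_form b a = 0"
    "sympl_form c a = 0" "sympl_form d b = 0" "sympl_form d c = 0"
    using assms sympl_form_commute by (metis neg_equal_0_iff_equal)+
  have "sympl_form (cols a b c d *v x) (cols a b c d *v y) = m * sympl_form x y" for x y
  proof -
    have "sympl_form (cols a b c d *v x) (cols a b c d *v y)
      = m * (x $ 1 * y $ 4 + x $ 2 * y $ 3 - x $ 3 * y $ 2 - x $ 4 * y $ 1)"
      by (simp add: cols_mult sympl_form_linear assms(2-) * algebra_simps)
    then show ?thesis by (simp add: sympl_form_def)
  qed
  then show ?thesis using assms(1) by (simp add: simil_def)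
qed

lemma translate_mult: "translate (g ** h) M = translate g (translate h M)"
  by (simp add: translate_def image_image matrix_vector_mul_assoc)

lemma translate_mat_1 [simp]: "translate (mat 1) M = M"
  by (simp add: translate_def)

lemma translate_inv:
  assumes "g \<in> GSp4"
  shows "translate (matrix_inv g) (translate g M) = M" "translate g (translate (matrix_inv g) M) = M"
  using matrix_inv_mult[OF GSp4_invertible[OF assms]] by (simp_all flip: translate_mult)

lemma translate_mono: "M \<subseteq> M' \<Longrightarrow> translate g M \<subseteq> translate g M'"
  unfolding translate_def by blast

lemma translate_inter:
  assumes "g \<in> GSp4"
  shows "translate g (M \<inter> M') = translate g M \<inter> translate g M'"
proof -
  have "inj ((*v) g)" by (metis GSp4_invertible assms injI matrix_inv_apply(1))
  then show ?thesis unfolding translate_def by (rule image_Int)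
qed

lemma mem_translate_iff:
  assumes "g \<in> GSp4"
  shows "x \<in> translate g M \<longleftrightarrow> matrix_inv g *v x \<in> M"
proof -
  note inv = matrix_inv_apply[OF GSp4_invertible[OF assms]]
  show ?thesis unfolding translate_def image_iff by (metis inv)
qed

lemma matrix_inv_mat_mult:
  assumes "g \<in> GSp4" "h \<in> GSp4"
  shows "matrix_inv g ** (g ** h) = h" "g ** (matrix_inv g ** h) = h"
  using matrix_inv_mult[OF GSp4_invertible[OF assms(1)]] by (simp_all add: matrix_mul_assoc)

subsection \<open>Lattices over a discretely valued field\<close>

locale uniformized_field = discrete_valuation v
  for v :: "'l::field \<Rightarrow> int" +
  fixes \<epsilon> :: 'l
  assumes eps_nonzero [simp]: "\<epsilon> \<noteq> 0" and v_eps: "v \<epsilon> = 1"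
begin

abbreviation I :: "int \<Rightarrow> 'l set" where "I \<equiv> frac_ideal v"

lemma v_one: "v 1 = 0"
  using v_mult[of 1 1] by simp

lemma v_minus: "v (- x) = v x"
proof (cases "x = 0")
  case False
  have "v (-1) = 0" using v_mult[of "-1" "-1"] v_one by simp
  then show ?thesis using v_mult[of "-1" x] False by simp
qed simp

lemma v_inverse: "x \<noteq> 0 \<Longrightarrow> v (inverse x) = - v x"
  using v_mult[of x "inverse x"] v_one by simp

lemma v_divide: "x \<noteq> 0 \<Longrightarrow> y \<noteq> 0 \<Longrightarrow> v (x / y) = v x - v y"
  by (simp add: divide_inverse v_mult v_inverse)

lemma v_power: "x \<noteq> 0 \<Longrightarrow> v (x ^ n) = int n * v x"
  by (induction n) (simp_all add: v_one v_mult algebra_simps)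

lemma v_eps_powi: "v (\<epsilon> powi n) = n"
  by (simp add: power_int_def v_power v_inverse v_eps eps_nonzero flip: power_inverse)

lemma eps_powi_nonzero [simp]: "\<epsilon> powi n \<noteq> 0"
  by (simp add: eps_nonzero)

lemma I_0 [simp]: "0 \<in> I n"
  by (simp add: frac_ideal_def)

lemma I_nonzero: "x \<noteq> 0 \<Longrightarrow> x \<in> I n \<longleftrightarrow> n \<le> v x"
  by (simp add: frac_ideal_def)

lemma I_add: "x \<in> I n \<Longrightarrow> y \<in> I n \<Longrightarrow> x + y \<in> I n"
  using v_add[of x y] by (force simp: frac_ideal_def)

lemma I_minus_iff [simp]: "- x \<in> I n \<longleftrightarrow> x \<in> I n"
  by (simp add: frac_ideal_def v_minus)

lemma I_diff: "x \<in> I n \<Longrightarrow> y \<in> I n \<Longrightarrow> x - y \<in> I n"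
  using I_add[of x n "- y"] by simp

lemma I_diff_commute: "x - y \<in> I n \<longleftrightarrow> y - x \<in> I n"
  using I_minus_iff[of "x - y" n] by simp

lemma I_mult: "x \<in> I m \<Longrightarrow> y \<in> I n \<Longrightarrow> m + n = k \<Longrightarrow> x * y \<in> I k"
  using v_mult[of x y] by (cases "x = 0 \<or> y = 0") (auto simp: frac_ideal_def)

lemma I_mult_left: "x \<in> I 0 \<Longrightarrow> y \<in> I n \<Longrightarrow> x * y \<in> I n"
  and I_mult_right: "y \<in> I n \<Longrightarrow> x \<in> I 0 \<Longrightarrow> y * x \<in> I n"
  using I_mult by force+

lemma I_mono: "x \<in> I m \<Longrightarrow> n \<le> m \<Longrightarrow> x \<in> I n"
  by (auto simp: frac_ideal_def)

lemma I_1 [simp]: "1 \<in> I 0"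
  by (simp add: frac_ideal_def v_one)

lemma eps_powi_I: "\<epsilon> powi n \<in> I m \<longleftrightarrow> m \<le> n"
  by (simp add: I_nonzero v_eps_powi)

lemma eps_I [simp]: "\<epsilon> \<in> I 1"
  by (simp add: frac_ideal_def v_eps)

lemma I_mult_iff: "c \<noteq> 0 \<Longrightarrow> c * x \<in> I n \<longleftrightarrow> x \<in> I (n - v c)"
  by (cases "x = 0") (auto simp: frac_ideal_def v_mult)

lemma I_divide_iff: "c \<noteq> 0 \<Longrightarrow> x / c \<in> I n \<longleftrightarrow> x \<in> I (n + v c)"
  using I_mult_iff[of "inverse c" x n] by (simp add: divide_inverse v_inverse mult.commute)

lemma I_powi_mult_iff: "\<epsilon> powi k * x \<in> I n \<longleftrightarrow> x \<in> I (n - k)"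
  by (simp add: I_mult_iff v_eps_powi)

lemma I_eps_mult_iff: "\<epsilon> * x \<in> I n \<longleftrightarrow> x \<in> I (n - 1)"
  by (simp add: I_mult_iff v_eps eps_nonzero)

lemma I_subset_iff: "I m \<subseteq> I n \<longleftrightarrow> n \<le> m"
  using eps_powi_I[of m m] eps_powi_I[of m n] I_mono by blast

lemma ex_I: "\<exists>n. x \<in> I n"
  by (auto simp: frac_ideal_def)

lemma unit_v: "x \<in> I n \<Longrightarrow> x \<notin> I (n + 1) \<Longrightarrow> x \<noteq> 0 \<and> v x = n"
  by (auto simp: frac_ideal_def)


section \<open>The lattices \<epsilon>^n Lambda_0 (\<open>cube n\<close>) and g Lambda_0
  (\<open>lat g\<close>), and their duality\<close>

definition cube :: "int \<Rightarrow> ('l ^ 4) set" where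
  "cube n = {z. \<forall>i. z $ i \<in> I n}"

lemma mem_cube: "z \<in> cube n \<longleftrightarrow> (\<forall>i. z $ i \<in> I n)"
  by (simp add: cube_def)

lemma cube_iff: "z \<in> cube n \<longleftrightarrow> z $ 1 \<in> I n \<and> z $ 2 \<in> I n \<and> z $ 3 \<in> I n \<and> z $ 4 \<in> I n"
  by (simp add: cube_def forall_4)

definition submod :: "('l ^ 4) set \<Rightarrow> bool" where
  "submod M \<longleftrightarrow> 0 \<in> M \<and> (\<forall>x\<in>M. \<forall>y\<in>M. x + y \<in> M) \<and> (\<forall>a\<in>I 0. \<forall>x\<in>M. a *s x \<in> M)"

lemma submod_add: "submod M \<Longrightarrow> x \<in> M \<Longrightarrow> y \<in> M \<Longrightarrow> x + y \<in> M"
  and submod_scale: "submod M \<Longrightarrow> a \<in> I 0 \<Longrightarrow> x \<in> M \<Longrightarrow> a *s x \<in> M"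
  by (simp_all add: submod_def)

lemma submod_diff: "submod M \<Longrightarrow> x \<in> M \<Longrightarrow> y \<in> M \<Longrightarrow> x - y \<in> M"
  using submod_add[of M x "(-1) *s y"] submod_scale[of M "-1" y] by simp

lemma submod_cube: "submod (cube n)"
  by (auto simp: submod_def cube_iff intro: I_add I_mult_left)

lemma submod_translate: "submod M \<Longrightarrow> submod (translate g M)"
  unfolding submod_def translate_def
  by (auto simp flip: matrix_vector_right_distrib vector_scalar_commute)
    (metis imageI matrix_vector_mult_0_right)

lemma submod_inter: "submod M \<Longrightarrow> submod M' \<Longrightarrow> submod (M \<inter> M')"
  by (auto simp: submod_def)

abbreviation lat :: "'l ^ 4 ^ 4 \<Rightarrow> ('l ^ 4) set" where
  "lat g \<equiv> translate g (cube 0)"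

lemma submod_lat: "submod (lat g)"
  by (rule submod_translate[OF submod_cube])

lemma lat_mult: "lat (g ** h) = translate g (lat h)"
  by (rule translate_mult)

lemma lat_cols_subset:
  assumes "submod M" "a \<in> M" "b \<in> M" "c \<in> M" "d \<in> M"
  shows "lat (cols a b c d) \<subseteq> M"
  unfolding translate_def cols_mult using assms
  by (auto simp: cube_iff intro!: submod_add submod_scale)

lemma mem_lat_cols:
  "x \<in> lat (cols a b c d) \<longleftrightarrow>
    (\<exists>s t u w. s \<in> I 0 \<and> t \<in> I 0 \<and> u \<in> I 0 \<and> w \<in> I 0 \<and> x = s *s a + t *s b + u *s c + w *s d)"
proof safe
  fix s t u w assume "s \<in> I 0" "t \<in> I 0" "u \<in> I 0" "w \<in> I 0"
  then have "vector [s, t, u, w] \<in> cube 0" by (simp add: cube_iff)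
  then have "cols a b c d *v vector [s, t, u, w] \<in> lat (cols a b c d)" by (simp add: translate_def)
  then show "s *s a + t *s b + u *s c + w *s d \<in> lat (cols a b c d)" by (simp add: cols_mult)
next
  assume "x \<in> lat (cols a b c d)"
  then obtain z where "z \<in> cube 0" "x = z $ 1 *s a + z $ 2 *s b + z $ 3 *s c + z $ 4 *s d"
    by (auto simp: translate_def cols_mult)
  then show "\<exists>s t u w. s \<in> I 0 \<and> t \<in> I 0 \<and> u \<in> I 0 \<and> w \<in> I 0 \<and>
      x = s *s a + t *s b + u *s c + w *s d"
    unfolding cube_iff by blast
qed

lemma sympl_form_cube:
  assumes "x \<in> cube m" "y \<in> cube n" "m + n = k"
  shows "sympl_form x y \<in> I k"
proof -
  have "x $ i * y $ j \<in> I k" for i j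
    using I_mult[of "x $ i" m "y $ j" n k] assms by (simp add: cube_def)
  then show ?thesis unfolding sympl_form_def by (intro I_diff I_add)
qed

text \<open>Pairing with the multiples of the unit vectors by \<epsilon>^n reads off the coordinates
  one at a time, up to sign.\<close>

lemma cube_dual: "x \<in> cube m \<longleftrightarrow> (\<forall>y \<in> cube n. sympl_form x y \<in> I (m + n))"
proof
  assume *: "\<forall>y \<in> cube n. sympl_form x y \<in> I (m + n)"
  have "axis i (\<epsilon> powi n) \<in> cube n" for i :: 4
    by (auto simp: cube_def axis_def eps_powi_I)
  with * have "sympl_form x (axis i (\<epsilon> powi n)) \<in> I (m + n)" for i :: 4 by blast
  from this[of 1] this[of 2] this[of 3] this[of 4] show "x \<in> cube m"
    by (simp add: sympl_form_def axis_def cube_iff I_powi_mult_iff mult.commute[of _ "\<epsilon> powi _"])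
qed (auto intro: sympl_form_cube)

text \<open>Transport of \<open>cube_dual\<close> along g, which rescales the form by its
  multiplier.\<close>

lemma lat_dual:
  assumes "simil g c"
  shows "x \<in> lat g \<longleftrightarrow> (\<forall>y \<in> lat g. sympl_form x y \<in> I (v c))"
proof -
  note inv = matrix_inv_apply[OF simil_invertible[OF assms]]
  have "x \<in> lat g \<longleftrightarrow> matrix_inv g *v x \<in> cube 0"
    by (rule mem_translate_iff[OF simil_GSp4[OF assms]])
  also have "\<dots> \<longleftrightarrow> (\<forall>y \<in> cube 0. c * sympl_form (matrix_inv g *v x) y \<in> I (v c))"
    by (subst cube_dual[of _ 0 0]) (simp add: I_mult_iff simil_nonzero[OF assms])
  also have "\<dots> \<longleftrightarrow> (\<forall>y \<in> cube 0. sympl_form x (g *v y) \<in> I (v c))"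
    by (simp add: inv flip: simil_form[OF assms])
  finally show ?thesis by (simp add: translate_def)
qed

lemma lat_form: "simil g c \<Longrightarrow> x \<in> lat g \<Longrightarrow> y \<in> lat g \<Longrightarrow> sympl_form x y \<in> I (v c)"
  using lat_dual by blast

lemma lat_dualI:
  assumes "simil g c" "\<And>y. y \<in> lat g \<Longrightarrow> sympl_form x y \<in> I (v c)"
  shows "x \<in> lat g"
  using lat_dual[OF assms(1), THEN iffD2] assms(2) by blast

lemma cube_mono: "n \<le> m \<Longrightarrow> cube m \<subseteq> cube n"
  using I_mono by (fastforce simp: mem_cube)

text \<open>Self-duality replaces an index computation here.\<close>
lemma lat_eqI:
  assumes "lat g \<subseteq> lat h" "simil g c" "simil h d" "v c = v d"
  shows "lat g = lat h"
proof
  show "lat h \<subseteq> lat g"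
  proof
    fix x assume "x \<in> lat h"
    then have "\<forall>y\<in>lat g. sympl_form x y \<in> I (v c)"
      using assms(1,4) lat_form[OF assms(3)] by auto
    then show "x \<in> lat g" by (rule lat_dual[OF assms(2), THEN iffD2])
  qed
qed (fact assms(1))

lemma ex_I_finite: "finite A \<Longrightarrow> \<exists>n. \<forall>x\<in>A. x \<in> I n"
proof (induction rule: finite_induct)
  case (insert x A)
  then obtain m n where "\<forall>y\<in>A. y \<in> I m" "x \<in> I n" using ex_I by blast
  then have "\<forall>y\<in>insert x A. y \<in> I (min m n)" using I_mono by fastforce
  then show ?case ..
qed simp

lemma lat_bounded: "\<exists>n. lat g \<subseteq> cube n"
proof -
  have "finite (\<Union>i. range (\<lambda>j. g $ i $ j))" by simp
  from ex_I_finite[OF this] obtain n where n: "\<And>i j. g $ i $ j \<in> I n" by blast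
  have "g *v z \<in> cube n" if "z \<in> cube 0" for z
    using that n unfolding cube_iff matrix_vector_mult_def sum_4
    by (simp add: I_add I_mult_right)
  then show ?thesis unfolding translate_def by blast
qed

text \<open>Duality reverses inclusions, so the upper bound from \<open>lat_bounded\<close> becomes
  a lower bound.\<close>

lemma lat_contains_cube:
  assumes "simil g c"
  shows "\<exists>n. cube n \<subseteq> lat g"
proof -
  obtain n where "lat g \<subseteq> cube n" using lat_bounded by blast
  then have "\<forall>y\<in>lat g. sympl_form x y \<in> I (v c)" if "x \<in> cube (v c - n)" for x
    using that sympl_form_cube[of x "v c - n" _ n] by auto
  then have "cube (v c - n) \<subseteq> lat g" using lat_dual[OF assms, THEN iffD2] by blast
  then show ?thesis ..
qed

lemma lattice_span_eq_lat:
  assumes "distinct [a, b, c, d]"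
  shows "lattice_span v {a, b, c, d} = lat (cols a b c d)"
proof safe
  fix x assume "x \<in> lattice_span v {a, b, c, d}"
  then obtain f where f: "x = (\<Sum>y\<in>{a, b, c, d}. f y *s y)" "\<forall>y\<in>{a, b, c, d}. f y \<in> I 0"
    unfolding lattice_span_def by blast
  then have "x = f a *s a + f b *s b + f c *s c + f d *s d" using assms by (simp add: add.assoc)
  with f(2) show "x \<in> lat (cols a b c d)" unfolding mem_lat_cols by blast
next
  fix x assume "x \<in> lat (cols a b c d)"
  then obtain s t u w where *: "s \<in> I 0" "t \<in> I 0" "u \<in> I 0" "w \<in> I 0"
    "x = s *s a + t *s b + u *s c + w *s d" unfolding mem_lat_cols by blast
  define f where "f y = (if y = a then s else if y = b then t else if y = c then u else w)" for y
  have "b \<noteq> a" "c \<noteq> a" "d \<noteq> a" "c \<noteq> b" "d \<noteq> b" "a \<noteq> b" "a \<noteq> c" "b \<noteq> c" "a \<noteq> d" "b \<noteq> d" "c \<noteq> d"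
    using assms by auto
  then have "x = (\<Sum>y\<in>{a, b, c, d}. f y *s y)" using *(5) by (simp add: f_def add.assoc)
  moreover have "\<forall>y\<in>{a, b, c, d}. f y \<in> I 0" using *(1-4) by (simp add: f_def)
  ultimately show "x \<in> lattice_span v {a, b, c, d}" unfolding lattice_span_def by blast
qed

lemma Lambda0_eq: "Lambda0 v \<epsilon> = cube 0"
proof -
  have "Lambda0 v \<epsilon> = lat (cols (axis 1 1) (axis 2 1) (axis 3 1) (axis 4 1))"
    unfolding Lambda0_def e_vec_def f_vec_def
    by (subst lattice_span_eq_lat) (simp_all add: axis_eq_axis)
  also have "cols (axis 1 1) (axis 2 1) (axis 3 1) (axis 4 1) = mat (1 :: 'l)"
    using cols_unique[of "mat (1 :: 'l)"] by simp
  finally show ?thesis by simp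
qed

end

subsection \<open>The Cartan decomposition\<close>

context uniformized_field
begin

lemma K_stab_iff: "k \<in> K_stab v \<epsilon> \<longleftrightarrow> k \<in> GSp4 \<and> lat k = cube 0"
  by (simp add: K_stab_def Lambda0_eq)

lemma K_GSp4: "k \<in> K_stab v \<epsilon> \<Longrightarrow> k \<in> GSp4"
  by (simp add: K_stab_iff)

lemma K_mult: "k \<in> K_stab v \<epsilon> \<Longrightarrow> k' \<in> K_stab v \<epsilon> \<Longrightarrow> k ** k' \<in> K_stab v \<epsilon>"
  by (simp add: K_stab_iff GSp4_mult lat_mult)

lemma K_inv: "k \<in> K_stab v \<epsilon> \<Longrightarrow> matrix_inv k \<in> K_stab v \<epsilon>"
  using translate_inv(1)[of k "cube 0"] by (simp add: K_stab_iff GSp4_inv)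

text \<open>With a unit multiplier, self-duality upgrades the inclusion into the standard lattice to
  an equality.\<close>

lemma K_I:
  assumes "simil k c" "v c = 0" "lat k \<subseteq> cube 0"
  shows "k \<in> K_stab v \<epsilon>"
  using lat_eqI[of k "mat 1" c 1] assms simil_mat_1 simil_GSp4[OF assms(1)]
  by (simp add: K_stab_iff v_one)

lemma scale_powi_cancel: "\<epsilon> powi k *s (\<epsilon> powi (- k) *s x) = x"
  by (simp add: power_int_minus)

lemma cube_eq_scaled: "x \<in> cube n \<longleftrightarrow> (\<exists>y \<in> cube 0. x = \<epsilon> powi n *s y)"
proof
  assume "x \<in> cube n"
  then have "\<epsilon> powi (- n) *s x \<in> cube 0" by (simp add: mem_cube I_powi_mult_iff)
  moreover have "x = \<epsilon> powi n *s (\<epsilon> powi (- n) *s x)"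
    by (rule scale_powi_cancel[symmetric])
  ultimately show "\<exists>y \<in> cube 0. x = \<epsilon> powi n *s y" by blast
qed (auto simp: mem_cube I_powi_mult_iff)

lemma K_preserves_cube:
  assumes "k \<in> K_stab v \<epsilon>" "x \<in> cube n"
  shows "k *v x \<in> cube n"
proof -
  obtain y where y: "y \<in> cube 0" "x = \<epsilon> powi n *s y" using cube_eq_scaled assms(2) by blast
  then have "k *v y \<in> cube 0" using assms(1) by (auto simp: K_stab_iff translate_def)
  moreover have "k *v x = \<epsilon> powi n *s (k *v y)" by (simp add: y(2) vector_scalar_commute)
  ultimately show ?thesis using cube_eq_scaled by blast
qed

lemma K_cube:
  assumes "k \<in> K_stab v \<epsilon>"
  shows "translate k (cube n) = cube n"
proof
  show "translate k (cube n) \<subseteq> cube n" using K_preserves_cube[OF assms] by (auto simp: translate_def)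
  show "cube n \<subseteq> translate k (cube n)"
    using K_preserves_cube[OF K_inv[OF assms]] by (auto simp: mem_translate_iff[OF K_GSp4[OF assms]])
qed

section \<open>Cocharacters and double cosets in terms of lattices\<close>

lemma cochar_at_apply: "cochar_at \<xi> \<epsilon> *v x = (\<chi> i. \<epsilon> powi (\<xi> $ i) * x $ i)"
  by (simp add: cochar_at_def matrix_vector_mult_def vec_eq_iff if_distrib[where f="\<lambda>x. x * _"] cong: if_cong)

lemma simil_cochar:
  assumes "\<xi> \<in> dominant_cochars"
  shows "simil (cochar_at \<xi> \<epsilon>) (\<epsilon> powi (\<xi> $ 1 + \<xi> $ 4))"
proof -
  have "\<epsilon> powi (\<xi> $ 1) * \<epsilon> powi (\<xi> $ 4) = \<epsilon> powi (\<xi> $ 1 + \<xi> $ 4)"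
    "\<epsilon> powi (\<xi> $ 2) * \<epsilon> powi (\<xi> $ 3) = \<epsilon> powi (\<xi> $ 1 + \<xi> $ 4)"
    using assms by (simp_all add: dominant_cochars_def flip: power_int_add)
  then have *: "\<epsilon> powi (\<xi> $ 1) * x * (\<epsilon> powi (\<xi> $ 4) * y) = \<epsilon> powi (\<xi> $ 1 + \<xi> $ 4) * (x * y)"
    "\<epsilon> powi (\<xi> $ 2) * x * (\<epsilon> powi (\<xi> $ 3) * y) = \<epsilon> powi (\<xi> $ 1 + \<xi> $ 4) * (x * y)"
    "\<epsilon> powi (\<xi> $ 4) * x * (\<epsilon> powi (\<xi> $ 1) * y) = \<epsilon> powi (\<xi> $ 1 + \<xi> $ 4) * (x * y)"
    "\<epsilon> powi (\<xi> $ 3) * x * (\<epsilon> powi (\<xi> $ 2) * y) = \<epsilon> powi (\<xi> $ 1 + \<xi> $ 4) * (x * y)" for x y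
    by (simp_all add: mult.left_commute mult.commute flip: mult.assoc)
  then show ?thesis by (simp add: simil_def sympl_form_def cochar_at_apply * distrib_left right_diff_distrib)
qed

lemma mem_lat_cochar: "x \<in> lat (cochar_at \<xi> \<epsilon>) \<longleftrightarrow> (\<forall>i. x $ i \<in> I (\<xi> $ i))"
proof
  assume *: "\<forall>i. x $ i \<in> I (\<xi> $ i)"
  have "(\<chi> i. \<epsilon> powi (- (\<xi> $ i)) * x $ i) \<in> cube 0" using * by (simp add: mem_cube I_powi_mult_iff)
  moreover have "x = cochar_at \<xi> \<epsilon> *v (\<chi> i. \<epsilon> powi (- (\<xi> $ i)) * x $ i)"
    by (simp add: cochar_at_apply vec_eq_iff flip: power_int_add mult.assoc)
  ultimately show "x \<in> lat (cochar_at \<xi> \<epsilon>)" by (auto simp: translate_def)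
qed (auto simp: translate_def cochar_at_apply mem_cube I_powi_mult_iff)

text \<open>The right factor from K is absorbed by the stabilizer of Lambda_0. Membership in a
  double coset thus concerns only the lattice g Lambda_0 up to K.\<close>

lemma double_coset_iff:
  assumes "\<xi> \<in> dominant_cochars"
  shows "g \<in> double_coset v \<epsilon> \<xi> \<longleftrightarrow>
    g \<in> GSp4 \<and> (\<exists>k \<in> K_stab v \<epsilon>. lat g = lat (k ** cochar_at \<xi> \<epsilon>))"
proof
  note cG = simil_GSp4[OF simil_cochar[OF assms]]
  show "g \<in> GSp4 \<and> (\<exists>k \<in> K_stab v \<epsilon>. lat g = lat (k ** cochar_at \<xi> \<epsilon>))"
    if g: "g \<in> double_coset v \<epsilon> \<xi>"
  proof -
    obtain h h' where h: "g = h ** cochar_at \<xi> \<epsilon> ** h'" "h \<in> K_stab v \<epsilon>" "h' \<in> K_stab v \<epsilon>"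
      using g unfolding double_coset_def by blast
    then have "lat g = lat (h ** cochar_at \<xi> \<epsilon>)" by (simp add: lat_mult K_stab_iff)
    then show ?thesis using h cG by (auto intro: GSp4_mult K_GSp4)
  qed
  assume "g \<in> GSp4 \<and> (\<exists>k \<in> K_stab v \<epsilon>. lat g = lat (k ** cochar_at \<xi> \<epsilon>))"
  then obtain k where g: "g \<in> GSp4" and k: "k \<in> K_stab v \<epsilon>" "lat g = lat (k ** cochar_at \<xi> \<epsilon>)"
    by blast
  define h where "h = k ** cochar_at \<xi> \<epsilon>"
  have h: "h \<in> GSp4" using GSp4_mult[OF K_GSp4[OF k(1)] cG] by (simp add: h_def)
  have "lat (matrix_inv h ** g) = cube 0"
    using k(2) translate_inv(1)[OF h] by (simp add: lat_mult flip: h_def)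
  then have "matrix_inv h ** g \<in> K_stab v \<epsilon>" by (simp add: K_stab_iff GSp4_mult GSp4_inv g h)
  moreover have "g = h ** (matrix_inv h ** g)" by (simp add: matrix_inv_mat_mult g h)
  ultimately show "g \<in> double_coset v \<epsilon> \<xi>" using k(1) unfolding double_coset_def h_def by blast
qed

text \<open>A primitive vector has a unit coordinate and can therefore be completed to a symplectic
  basis of Lambda_0. It is placed last because the fourth entry of a dominant cocharacter is the
  smallest.\<close>

lemma primitive_extends:
  assumes "a \<in> cube 0" "a \<notin> cube 1"
  shows "\<exists>k \<in> K_stab v \<epsilon>. k *v axis 4 1 = a"
proof -
  have K: "\<exists>k \<in> K_stab v \<epsilon>. k *v axis 4 1 = a"
    if "sympl_form y a = 1" "sympl_form p q = 1" "sympl_form y p = 0" "sympl_form y q = 0"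
      "sympl_form p a = 0" "sympl_form q a = 0" "y \<in> cube 0" "p \<in> cube 0" "q \<in> cube 0" for y p q
  proof
    have "simil (cols y p q a) 1" using that by (intro simil_cols) auto
    then show "cols y p q a \<in> K_stab v \<epsilon>"
      by (rule K_I) (use that assms(1) in \<open>auto simp: v_one intro: lat_cols_subset[THEN subsetD] submod_cube\<close>)
    show "cols y p q a *v axis 4 1 = a" by (simp add: cols_mult axis_def)
  qed
  have a: "a $ i \<in> I 0" for i using assms(1) by (simp add: mem_cube)
  obtain i where i: "a $ i \<notin> I 1" using assms(2) by (auto simp: mem_cube)
  have u: "a $ i \<noteq> 0" "v (a $ i) = 0" using unit_v[of "a $ i" 0] a[of i] i by auto
  then have inv: "inverse (a $ i) \<in> I 0" by (simp add: I_nonzero v_inverse)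
  consider "i = 4" | "i = 1" | "i = 2" | "i = 3" using exhaust_4[of i] by blast
  then show ?thesis
  proof cases
    case 1
    \<comment> \<open>In each case y sits on the coordinate paired with the unit coordinate of a,
      and p, q are the unit vectors of the other hyperbolic plane, corrected along y to become
      orthogonal to a.\<close>
    show ?thesis
      by (rule K[of "vector [inverse (a $ 4), 0, 0, 0]"
            "vector [- a $ 3 * inverse (a $ 4), 1, 0, 0]" "vector [a $ 2 * inverse (a $ 4), 0, 1, 0]"])
        (use u inv a in \<open>auto simp: 1 cube_iff sympl_form_def intro: I_mult_left\<close>)
  next
    case 2
    show ?thesis
      by (rule K[of "vector [0, 0, 0, - inverse (a $ 1)]"
            "vector [0, 1, 0, a $ 3 * inverse (a $ 1)]" "vector [0, 0, 1, - a $ 2 * inverse (a $ 1)]"])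
        (use u inv a in \<open>auto simp: 2 cube_iff sympl_form_def intro: I_mult_left\<close>)
  next
    case 3
    show ?thesis
      by (rule K[of "vector [0, 0, - inverse (a $ 2), 0]"
            "vector [1, 0, a $ 4 * inverse (a $ 2), 0]" "vector [0, 0, - a $ 1 * inverse (a $ 2), 1]"])
        (use u inv a in \<open>auto simp: 3 cube_iff sympl_form_def intro: I_mult_left\<close>)
  next
    case 4
    show ?thesis
      by (rule K[of "vector [0, inverse (a $ 3), 0, 0]"
            "vector [1, - a $ 4 * inverse (a $ 3), 0, 0]" "vector [0, a $ 1 * inverse (a $ 3), 0, 1]"])
        (use u inv a in \<open>auto simp: 4 cube_iff sympl_form_def intro: I_mult_left\<close>)
  qed
qed

text \<open>A nonzero coordinate of x bounds the admissible exponents. At the largest one, some y in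
  S is \<epsilon>^m times a primitive vector.\<close>

lemma ex_max_cube:
  assumes "S \<subseteq> cube n" "x \<in> S" "x \<noteq> 0"
  shows "\<exists>m\<ge>n. S \<subseteq> cube m \<and> (\<exists>y\<in>S. y \<notin> cube (m + 1))"
proof -
  obtain i where i: "x $ i \<noteq> 0" using assms(3) by (auto simp: vec_eq_iff)
  define B where "B = {k. n \<le> k \<and> S \<subseteq> cube k}"
  have B: "k \<in> B \<longleftrightarrow> n \<le> k \<and> S \<subseteq> cube k" for k by (simp add: B_def)
  have "k \<le> v (x $ i)" if "S \<subseteq> cube k" for k
  proof -
    have "x \<in> cube k" using that assms(2) by blast
    then have "x $ i \<in> I k" by (simp add: mem_cube)
    then show ?thesis by (simp add: I_nonzero i)
  qed
  then have "B \<subseteq> {n..v (x $ i)}" by (auto simp: B_def)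
  then have fin: "finite B" using finite_subset by blast
  have "B \<noteq> {}" using assms(1) by (auto simp: B_def)
  then have "Max B \<in> B" using fin by simp
  then have "n \<le> Max B" "S \<subseteq> cube (Max B)" using B by blast+
  moreover have "Max B + 1 \<notin> B"
    using Max_ge[OF fin, of "Max B + 1"] by auto
  then have "\<not> S \<subseteq> cube (Max B + 1)" using \<open>n \<le> Max B\<close> B[of "Max B + 1"] by simp
  ultimately show ?thesis by blast
qed

lemma cube_rescale_iff: "\<epsilon> powi k *s x \<in> cube m \<longleftrightarrow> x \<in> cube (m - k)"
  by (auto simp: mem_cube I_powi_mult_iff)

text \<open>Elementary divisors adapted to the form: a vector of smallest valuation in the lattice,
  moved by K onto the last axis, splits off a hyperbolic plane; the same choice is then made in the
  orthogonal complement, which has rank two.\<close>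

theorem cartan_exists:
  assumes g: "g \<in> GSp4"
  shows "\<exists>\<xi> \<in> dominant_cochars. g \<in> double_coset v \<epsilon> \<xi>"
proof -
  obtain c where c: "simil g c" using g by (rule GSp4_similE)
  have sub_ne: "\<exists>x\<in>lat g. x \<noteq> 0"
  proof -
    have "axis 1 1 \<in> cube 0" by (auto simp: mem_cube axis_def)
    moreover have "g *v axis 1 1 \<noteq> 0"
      using matrix_inv_apply(1)[OF simil_invertible[OF c], of "axis 1 1"] by auto
    ultimately show ?thesis by (auto simp: translate_def)
  qed
  obtain n0 where "lat g \<subseteq> cube n0" using lat_bounded by blast
  with sub_ne obtain n m where n: "lat g \<subseteq> cube n" and m: "m \<in> lat g" "m \<notin> cube (n + 1)"
    using ex_max_cube by metis
  have "\<epsilon> powi (- n) *s m \<in> cube 0" "\<epsilon> powi (- n) *s m \<notin> cube 1"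
    using n m by (auto simp: cube_rescale_iff add.commute)
  then obtain k where k: "k \<in> K_stab v \<epsilon>" "k *v axis 4 1 = \<epsilon> powi (- n) *s m"
    using primitive_extends by blast
  define h where "h = matrix_inv k ** g"
  have hG: "h \<in> GSp4" using g k(1) by (simp add: h_def GSp4_mult GSp4_inv K_GSp4)
  obtain d where d: "simil h d" using hG by (rule GSp4_similE)
  note lat_h = submod_lat[of h] 
  have hn: "lat h \<subseteq> cube n"
    using translate_mono[OF n, of "matrix_inv k"] K_cube[OF K_inv[OF k(1)]]
    by (simp add: h_def lat_mult)
  have e4: "\<epsilon> powi n *s axis 4 1 \<in> lat h"
  proof -
    have "matrix_inv k *v m = matrix_inv k *v (\<epsilon> powi n *s (k *v axis 4 1))"
      by (simp only: k(2) scale_powi_cancel)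
    also have "\<dots> = \<epsilon> powi n *s axis 4 1"
      by (simp add: vector_scalar_commute matrix_inv_apply GSp4_invertible K_GSp4[OF k(1)])
    finally show ?thesis using m(1) by (metis h_def lat_mult imageI translate_def)
  qed
  \<comment> \<open>All of the lattice lies in \<epsilon>^n Lambda_0, so its fourth coordinates lie
    in \<open>I n\<close>; duality then puts these multiples of the first unit vector into the
    lattice.\<close>
  have e1: "a *s axis 1 1 \<in> lat h" if "a \<in> I (v d - n)" for a
  proof -
    have "sympl_form (a *s axis 1 1) y \<in> I (v d)" if "y \<in> lat h" for y
      using hn that \<open>a \<in> I (v d - n)\<close> I_mult[of a "v d - n" "y $ 4" n]
      by (auto simp: sympl_form_def axis_def mem_cube)
    then show ?thesis by (rule lat_dualI[OF d])
  qed
  have e4': "a *s axis 4 1 \<in> lat h" if "a \<in> I n" for a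
  proof -
    have "\<epsilon> powi (- n) * a \<in> I 0" using that by (simp add: I_powi_mult_iff)
    from submod_scale[OF lat_h this e4] show ?thesis
      by (simp add: mult.commute mult.left_commute power_int_minus)
  qed
  \<comment> \<open>The orthogonal complement of the hyperbolic plane just found;
    \<open>proj\<close> shows that the lattice is the direct sum of both.\<close>
  define S where "S = {z \<in> lat h. z $ 1 = 0 \<and> z $ 4 = 0}"
  have proj: "vector [0, z $ 2, z $ 3, 0] \<in> S" "z $ 1 \<in> I (v d - n)" if z: "z \<in> lat h" for z
  proof -
    have "z $ 4 \<in> I n" using hn z by (auto simp: mem_cube)
    have "sympl_form z (\<epsilon> powi n *s axis 4 1) \<in> I (v d)" using lat_form[OF d z e4] .
    then show z1: "z $ 1 \<in> I (v d - n)"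
      by (simp add: sympl_form_def axis_def I_powi_mult_iff mult.commute[of "z $ 1"])
    have "vector [0, z $ 2, z $ 3, 0] = z - z $ 1 *s axis 1 1 - z $ 4 *s axis 4 1"
      by (simp add: vec4_eq_iff axis_def)
    also have "\<dots> \<in> lat h" using z e1[OF z1] e4'[OF \<open>z $ 4 \<in> I n\<close>] lat_h by (intro submod_diff)
    finally show "vector [0, z $ 2, z $ 3, 0] \<in> S" by (simp add: S_def)
  qed
  have S_ne: "\<exists>x\<in>S. x \<noteq> 0"
  proof -
    obtain r where "cube r \<subseteq> lat h" using lat_contains_cube[OF d] by blast
    moreover have "vector [0, \<epsilon> powi r, 0, 0] \<in> cube r" by (simp add: cube_iff eps_powi_I)
    ultimately have "vector [0, \<epsilon> powi r, 0, 0] \<in> S" by (auto simp: S_def)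
    moreover have "vector [0, \<epsilon> powi r, 0, 0] \<noteq> (0 :: 'l ^ 4)" by (simp add: vec4_eq_iff)
    ultimately show ?thesis by blast
  qed
  have "S \<subseteq> cube n" using hn by (auto simp: S_def)
  with S_ne obtain n' s where n': "n \<le> n'" "S \<subseteq> cube n'" and s: "s \<in> S" "s \<notin> cube (n' + 1)"
    using ex_max_cube by metis
  define a where "a = \<epsilon> powi (- n') *s s"
  have a0: "a \<in> cube 0" and a1: "a \<notin> cube 1"
    using n'(2) s by (auto simp: a_def cube_rescale_iff add.commute)
  have a14: "a $ 1 = 0" "a $ 4 = 0" using s(1) by (auto simp: a_def S_def)
  \<comment> \<open>The partner of a inside the second hyperbolic plane, supported on the coordinate
    opposite to a unit coordinate of a.\<close>
  obtain y where y: "y \<in> cube 0" "y \<notin> cube 1" "sympl_form y a = 1" "y $ 1 = 0" "y $ 4 = 0"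
  proof (cases "a $ 3 \<in> I 1")
    case False
    then have "a $ 3 \<noteq> 0" "v (a $ 3) = 0" using unit_v[of "a $ 3" 0] a0 by (auto simp: mem_cube)
    then show ?thesis
      by (intro that[of "vector [0, inverse (a $ 3), 0, 0]"])
        (auto simp: cube_iff I_nonzero v_inverse sympl_form_def)
  next
    case True
    then have "a $ 2 \<notin> I 1" using a1 a14 by (simp add: cube_iff)
    then have "a $ 2 \<noteq> 0" "v (a $ 2) = 0" using unit_v[of "a $ 2" 0] a0 by (auto simp: mem_cube)
    then show ?thesis
      by (intro that[of "vector [0, 0, - inverse (a $ 2), 0]"])
        (auto simp: cube_iff I_nonzero v_inverse sympl_form_def)
  qed
  have yS: "\<epsilon> powi (v d - n') *s y \<in> S"
  proof -
    have "sympl_form (\<epsilon> powi (v d - n') *s y) z \<in> I (v d)" if z: "z \<in> lat h" for z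
    proof -
      have "vector [0, z $ 2, z $ 3, 0] \<in> cube n'" using proj(1)[OF z] n'(2) by blast
      then have "sympl_form y (vector [0, z $ 2, z $ 3, 0]) \<in> I n'"
        using sympl_form_cube[OF y(1)] by simp
      moreover have "sympl_form y (vector [0, z $ 2, z $ 3, 0]) = sympl_form y z"
        using y(4,5) by (simp add: sympl_form_def)
      ultimately show ?thesis by (simp add: sympl_form_scale_right sympl_form_scale_left I_powi_mult_iff)
    qed
    then have "\<epsilon> powi (v d - n') *s y \<in> lat h" by (rule lat_dualI[OF d])
    then show ?thesis using y(4,5) by (simp add: S_def)
  qed
  define \<xi> :: "int ^ 4" where "\<xi> = vector [v d - n, v d - n', n', n]"
  \<comment> \<open>This yields the middle dominance inequality: if it failed, y would be divisible
    by \<epsilon>, although it is primitive.\<close>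
  have "y \<in> cube (n' - (v d - n'))" using yS n'(2) cube_rescale_iff by blast
  moreover have "cube (n' - (v d - n')) \<subseteq> cube 1" if "\<not> n' \<le> v d - n'"
    using that by (intro cube_mono) simp
  ultimately have le: "n' \<le> v d - n'" using y(2) by blast
  have dom: "\<xi> \<in> dominant_cochars" using n'(1) le by (simp add: \<xi>_def dominant_cochars_def)
  define k' where "k' = cols (axis 1 1) y a (axis 4 1)"
  have k'1: "simil k' 1" unfolding k'_def using y a14
    by (intro simil_cols) (auto simp: sympl_form_def axis_def)
  have k'K: "k' \<in> K_stab v \<epsilon>"
    by (rule K_I[OF k'1 v_one])  (unfold k'_def, rule lat_cols_subset[OF submod_cube], simp_all add: cube_iff[of "axis _ _"] y(1) a0,
        simp_all add: axis_def)
  have "lat (k' ** cochar_at \<xi> \<epsilon>) \<subseteq> lat h"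
  proof -
    have "k' ** cochar_at \<xi> \<epsilon> = cols (\<epsilon> powi (v d - n) *s axis 1 1) (\<epsilon> powi (v d - n') *s y) s
        (\<epsilon> powi n *s axis 4 1)"
    proof (rule matrix_eq_on_vectors)
      fix x
      have s: "s = \<epsilon> powi n' *s a" unfolding a_def by (rule scale_powi_cancel[symmetric])
      show "(k' ** cochar_at \<xi> \<epsilon>) *v x = cols (\<epsilon> powi (v d - n) *s axis 1 1) (\<epsilon> powi (v d - n') *s y) s
          (\<epsilon> powi n *s axis 4 1) *v x"
        unfolding s by (simp add: k'_def cols_mult cochar_at_apply \<xi>_def mult.commute flip: matrix_vector_mul_assoc)
    qed
    moreover have "\<epsilon> powi (v d - n') *s y \<in> lat h" "s \<in> lat h" using yS s(1) by (simp_all add: S_def)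
    ultimately show ?thesis
      using lat_cols_subset[OF lat_h e1[of "\<epsilon> powi (v d - n)"] _ _ e4] by (simp only: eps_powi_I)
  qed
  moreover have "simil (k' ** cochar_at \<xi> \<epsilon>) (1 * \<epsilon> powi (\<xi> $ 1 + \<xi> $ 4))"
    by (rule simil_mult[OF k'1 simil_cochar[OF dom]])
  ultimately have "lat (k' ** cochar_at \<xi> \<epsilon>) = lat h"
    using d by (rule lat_eqI) (simp add: v_eps_powi \<xi>_def del: power_int_add)
  then have "lat (k ** k' ** cochar_at \<xi> \<epsilon>) = translate k (lat h)"
    by (simp add: lat_mult flip: matrix_mul_assoc)
  also have "\<dots> = lat g" using translate_inv(2)[OF K_GSp4[OF k(1)]] by (simp add: h_def lat_mult)
  finally have "g \<in> double_coset v \<epsilon> \<xi>"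
    using g K_mult[OF k(1) k'K] double_coset_iff[OF dom] by metis
  then show ?thesis using dom by blast
qed

section \<open>Uniqueness of the relative position\<close>

lemma lat_cochar_cube:
  assumes "\<xi> \<in> dominant_cochars"
  shows "lat (cochar_at \<xi> \<epsilon>) \<subseteq> cube n \<longleftrightarrow> n \<le> \<xi> $ 4" "cube n \<subseteq> lat (cochar_at \<xi> \<epsilon>) \<longleftrightarrow> \<xi> $ 1 \<le> n"
proof -
  have ge: "\<xi> $ 4 \<le> \<xi> $ i" "\<xi> $ i \<le> \<xi> $ 1" for i
    using assms exhaust_4[of i] by (auto simp: dominant_cochars_def)
  show "lat (cochar_at \<xi> \<epsilon>) \<subseteq> cube n \<longleftrightarrow> n \<le> \<xi> $ 4"
  proof
    assume "lat (cochar_at \<xi> \<epsilon>) \<subseteq> cube n"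
    moreover have "axis 4 (\<epsilon> powi (\<xi> $ 4)) \<in> lat (cochar_at \<xi> \<epsilon>)"
      by (auto simp: mem_lat_cochar axis_def eps_powi_I)
    ultimately have "axis 4 (\<epsilon> powi (\<xi> $ 4)) \<in> cube n" by blast
    then show "n \<le> \<xi> $ 4" by (simp add: cube_iff axis_def eps_powi_I)
  next
    assume "n \<le> \<xi> $ 4"
    then have "n \<le> \<xi> $ i" for i using ge(1) order_trans by blast
    then show "lat (cochar_at \<xi> \<epsilon>) \<subseteq> cube n" using I_mono by (force simp: mem_lat_cochar mem_cube)
  qed
  show "cube n \<subseteq> lat (cochar_at \<xi> \<epsilon>) \<longleftrightarrow> \<xi> $ 1 \<le> n"
  proof
    assume "cube n \<subseteq> lat (cochar_at \<xi> \<epsilon>)"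
    moreover have "axis 1 (\<epsilon> powi n) \<in> cube n" by (auto simp: mem_cube axis_def eps_powi_I)
    ultimately have "axis 1 (\<epsilon> powi n) \<in> lat (cochar_at \<xi> \<epsilon>)" by blast
    then have "(axis 1 (\<epsilon> powi n) :: 'l ^ 4) $ 1 \<in> I (\<xi> $ 1)" unfolding mem_lat_cochar by blast
    then show "\<xi> $ 1 \<le> n" by (simp add: axis_def eps_powi_I)
  next
    assume "\<xi> $ 1 \<le> n"
    then have "\<xi> $ i \<le> n" for i using ge(2) order_trans by blast
    then show "cube n \<subseteq> lat (cochar_at \<xi> \<epsilon>)" using I_mono by (force simp: mem_lat_cochar mem_cube)
  qed
qed

text \<open>This invariant of a lattice recovers the third entry of the relative position.\<close>
definition has_small_combinations :: "('l ^ 4) set \<Rightarrow> int \<Rightarrow> bool" where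
  "has_small_combinations M n \<longleftrightarrow> (\<forall>x\<in>M. \<forall>y\<in>M. \<exists>a b. a \<in> I 0 \<and> b \<in> I 0 \<and> (a \<notin> I 1 \<or> b \<notin> I 1) \<and>
     a *s x + b *s y \<in> cube n)"

lemma has_small_combinations_translate:
  assumes "k \<in> K_stab v \<epsilon>"
  shows "has_small_combinations (translate k M) n \<longleftrightarrow> has_small_combinations M n"
proof -
  have "k *v z \<in> cube n \<longleftrightarrow> z \<in> cube n" for z
    using K_preserves_cube[OF assms, of z n] K_preserves_cube[OF K_inv[OF assms], of "k *v z" n]
    by (auto simp: matrix_inv_apply GSp4_invertible K_GSp4[OF assms])
  then show ?thesis unfolding has_small_combinations_def translate_def
    by (simp flip: matrix_vector_right_distrib vector_scalar_commute)
qed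

text \<open>A primitive combination of two vectors can cancel their fourth coordinates, the only
  place where the exponent may drop below the third entry. The scaled unit vectors on the last two
  axes show that no better bound holds.\<close>

lemma has_small_combinations_cochar:
  assumes "\<xi> \<in> dominant_cochars"
  shows "has_small_combinations (lat (cochar_at \<xi> \<epsilon>)) n \<longleftrightarrow> n \<le> \<xi> $ 3"
proof
  have dom: "\<xi> $ 4 \<le> \<xi> $ 3" "\<xi> $ 3 \<le> \<xi> $ 2" "\<xi> $ 2 \<le> \<xi> $ 1"
    using assms by (auto simp: dominant_cochars_def)
  {
    assume *: "has_small_combinations (lat (cochar_at \<xi> \<epsilon>)) n"
    define x :: "'l ^ 4" where "x = axis 4 (\<epsilon> powi (\<xi> $ 4))"
    define y :: "'l ^ 4" where "y = axis 3 (\<epsilon> powi (\<xi> $ 3))"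
    have "x \<in> lat (cochar_at \<xi> \<epsilon>)" "y \<in> lat (cochar_at \<xi> \<epsilon>)"
      by (auto simp: x_def y_def mem_lat_cochar axis_def eps_powi_I)
    then obtain a b where ab: "a \<in> I 0" "b \<in> I 0" "a \<notin> I 1 \<or> b \<notin> I 1" "a *s x + b *s y \<in> cube n"
      using * unfolding has_small_combinations_def by blast
    from ab(4) have "a \<in> I (n - \<xi> $ 4)" "b \<in> I (n - \<xi> $ 3)"
      by (auto simp: x_def y_def cube_iff axis_def mult.commute[of _ "\<epsilon> powi _"] I_powi_mult_iff)
    then show "n \<le> \<xi> $ 3"
      using ab(3) dom I_mono[of a "n - \<xi> $ 4" 1] I_mono[of b "n - \<xi> $ 3" 1] by linarith
  next
    assume n: "n \<le> \<xi> $ 3"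
    show "has_small_combinations (lat (cochar_at \<xi> \<epsilon>)) n"
      unfolding has_small_combinations_def
    proof (intro ballI)
      fix x y assume xy: "x \<in> lat (cochar_at \<xi> \<epsilon>)" "y \<in> lat (cochar_at \<xi> \<epsilon>)"
      obtain a b where ab: "a \<in> I 0" "b \<in> I 0" "a \<notin> I 1 \<or> b \<notin> I 1" "a * x $ 4 + b * y $ 4 = 0"
      proof -
        have one: "1 \<notin> I 1" by (simp add: I_nonzero v_one)
        consider "x $ 4 = 0" | "y $ 4 = 0" | "x $ 4 \<noteq> 0" "y $ 4 \<noteq> 0" "v (y $ 4) \<le> v (x $ 4)"
          | "x $ 4 \<noteq> 0" "y $ 4 \<noteq> 0" "v (x $ 4) \<le> v (y $ 4)" by linarith
        then show thesis
        proof cases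
          case 1 then show ?thesis using that[of 1 0] one by simp
        next
          case 2 then show ?thesis using that[of 0 1] one by simp
        next
          case 3 then show ?thesis using that[of 1 "- (x $ 4 / y $ 4)"] one
            by (simp add: I_divide_iff I_nonzero v_divide)
        next
          case 4 then show ?thesis using that[of "- (y $ 4 / x $ 4)" 1] one
            by (simp add: I_divide_iff I_nonzero v_divide)
        qed
      qed
      have "a *s x + b *s y \<in> lat (cochar_at \<xi> \<epsilon>)"
        using xy ab by (intro submod_add[OF submod_lat] submod_scale[OF submod_lat])
      then have "a *s x + b *s y \<in> cube n"
        using ab(4) n dom I_mono[of _ "\<xi> $ 1" n] I_mono[of _ "\<xi> $ 2" n] I_mono[of _ "\<xi> $ 3" n]
        by (simp add: mem_lat_cochar cube_iff forall_4)
      then show "\<exists>a b. a \<in> I 0 \<and> b \<in> I 0 \<and> (a \<notin> I 1 \<or> b \<notin> I 1) \<and> a *s x + b *s y \<in> cube n"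
        using ab by blast
    qed
  }
qed

text \<open>The entries 1, 3 and 4 are invariants of the lattice under K. The second follows from
  the relation between the entries of a cocharacter of the torus.\<close>

theorem cartan_unique:
  assumes "\<xi> \<in> dominant_cochars" "\<xi>' \<in> dominant_cochars"
    and "g \<in> double_coset v \<epsilon> \<xi>" "g \<in> double_coset v \<epsilon> \<xi>'"
  shows "\<xi> = \<xi>'"
proof -
  have inv: "lat g \<subseteq> cube n \<longleftrightarrow> n \<le> \<xi> $ 4" "cube n \<subseteq> lat g \<longleftrightarrow> \<xi> $ 1 \<le> n"
    "has_small_combinations (lat g) n \<longleftrightarrow> n \<le> \<xi> $ 3"
    if \<xi>: "\<xi> \<in> dominant_cochars" "g \<in> double_coset v \<epsilon> \<xi>" for \<xi> n
  proof -
    obtain k where k: "k \<in> K_stab v \<epsilon>" "lat g = translate k (lat (cochar_at \<xi> \<epsilon>))"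
      using \<xi> double_coset_iff lat_mult by metis
    have "translate k M \<subseteq> translate k M' \<longleftrightarrow> M \<subseteq> M'" for M M'
      using translate_mono[of M M' k] translate_mono[of "translate k M" "translate k M'" "matrix_inv k"]
      by (auto simp: translate_inv K_GSp4[OF k(1)])
    from this[of "lat (cochar_at \<xi> \<epsilon>)" "cube n"] this[of "cube n" "lat (cochar_at \<xi> \<epsilon>)"]
    show "lat g \<subseteq> cube n \<longleftrightarrow> n \<le> \<xi> $ 4" "cube n \<subseteq> lat g \<longleftrightarrow> \<xi> $ 1 \<le> n"
      using lat_cochar_cube[OF \<xi>(1)] by (simp_all add: k K_cube)
    show "has_small_combinations (lat g) n \<longleftrightarrow> n \<le> \<xi> $ 3"
      by (simp add: k(2) has_small_combinations_translate[OF k(1)] has_small_combinations_cochar \<xi>(1))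
  qed
  have "\<xi> $ 4 = \<xi>' $ 4" "\<xi> $ 1 = \<xi>' $ 1" "\<xi> $ 3 = \<xi>' $ 3"
    using inv[OF assms(1,3)] inv[OF assms(2,4)] by (meson order_antisym order_refl)+
  moreover have "\<xi> $ 2 = \<xi>' $ 2"
    using calculation assms(1,2) by (auto simp: dominant_cochars_def)
  ultimately show ?thesis by (simp add: vec4_eq_iff)
qed

theorem rel_inv_eq_iff:
  assumes "j \<in> GSp4" "g \<in> GSp4"
  shows "rel_inv v \<epsilon> j g = \<xi> \<longleftrightarrow> \<xi> \<in> dominant_cochars \<and> matrix_inv j ** g \<in> double_coset v \<epsilon> \<xi>"
proof -
  have "\<exists>!\<xi>. \<xi> \<in> dominant_cochars \<and> matrix_inv j ** g \<in> double_coset v \<epsilon> \<xi>"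
    using cartan_exists[OF GSp4_mult[OF GSp4_inv[OF assms(1)] assms(2)]] cartan_unique by blast
  from theI'[OF this] this show ?thesis unfolding rel_inv_def by blast
qed

end

subsection \<open>Residues and Frobenius\<close>

text \<open>Translation by 1 permutes the ring, so the sum of all elements does not change when the
  cardinality is added to it.\<close>

lemma of_nat_card_finite_ring:
  "of_nat CARD('a) = (0 :: 'a :: {finite, comm_ring_1})"
proof -
  have "(\<Sum>x\<in>UNIV. x) = (\<Sum>x\<in>UNIV. x + 1 :: 'a)"
    by (rule sum.reindex_bij_witness[of _ "\<lambda>x. x + 1" "\<lambda>x. x - 1"]) auto
  then show ?thesis by (simp add: sum.distrib)
qed

text \<open>The polynomial X^q - X has at most q roots, and the q elements of the base field are
  roots already.\<close>

lemma frobenius_fixed_in_base_field: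
  fixes a :: "'k::finite_field alg_closure"
  assumes "a ^ CARD('k) = a"
  shows "a \<in> range to_ac"
proof -
  let ?q = "CARD('k)"
  define p :: "'k alg_closure poly" where "p = Polynomial.monom 1 ?q - Polynomial.monom 1 1"
  have "2 \<le> ?q"
  proof -
    have "card {0, 1 :: 'k} \<le> ?q" by (rule card_mono) auto
    then show ?thesis by simp
  qed
  then have p: "Polynomial.coeff p ?q = 1" "Polynomial.degree p \<le> ?q"
    by (auto simp: p_def intro!: degree_diff_le degree_monom_le[THEN order_trans])
  then have p0: "p \<noteq> 0" by auto
  have root: "poly p x = 0 \<longleftrightarrow> x ^ ?q = x" for x by (simp add: p_def poly_monom)
  have "range to_ac \<subseteq> {x. poly p x = 0}"
    using finite_field_power_card_eq_same[where ?'a = 'k] by (auto simp: root simp flip: to_ac_power)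
  moreover have "finite {x. poly p x = 0}" using p0 by (rule poly_roots_finite)
  moreover have "card {x. poly p x = 0} \<le> card (range (to_ac :: 'k \<Rightarrow> _))"
    using card_poly_roots_bound[OF p0] p(2) by (simp add: card_image inj_to_ac)
  ultimately have "range to_ac = {x. poly p x = 0}" by (intro card_seteq) auto
  then show ?thesis using assms root by blast
qed

context completed_unramified_extension
begin

sublocale uniformized_field v \<epsilon>
  by unfold_locales (use uniformizer in auto)

lemma res_0 [simp]: "res 0 = 0"
  using res_add[of 0 0] by (metis I_0 add_cancel_right_right)

lemma res_minus: "x \<in> I 0 \<Longrightarrow> res (- x) = - res x"
  using res_add[of x "- x"] by (simp add: eq_neg_iff_add_eq_0 add.commute)

lemma res_diff: "x \<in> I 0 \<Longrightarrow> y \<in> I 0 \<Longrightarrow> res (x - y) = res x - res y"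
  using res_add[of x "- y"] res_minus[of y] by simp

lemma res_eq_iff: "x \<in> I 0 \<Longrightarrow> y \<in> I 0 \<Longrightarrow> res x = res y \<longleftrightarrow> x - y \<in> I 1"
  using res_kernel[of "x - y"] by (simp add: I_diff res_diff)

lemma res_0_iff: "x \<in> I 0 \<Longrightarrow> res x = 0 \<longleftrightarrow> x \<in> I 1"
  by (rule res_kernel)

lemma I_power: "x \<in> I 0 \<Longrightarrow> x ^ n \<in> I 0"
  by (induction n) (simp_all add: I_mult_left)

lemma res_power: "x \<in> I 0 \<Longrightarrow> res (x ^ n) = res x ^ n"
  by (induction n) (simp_all add: res_one res_mult I_power)

lemma res_sum: "(\<And>i. i \<in> A \<Longrightarrow> f i \<in> I 0) \<Longrightarrow> sum f A \<in> I 0 \<and> res (sum f A) = (\<Sum>i\<in>A. res (f i))"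
  by (induction A rule: infinite_finite_induct) (simp_all add: I_add res_add)

lemma res_nonzero_inverse:
  assumes "x \<in> I 0" "res x \<noteq> 0"
  shows "x \<noteq> 0" "v x = 0" "inverse x \<in> I 0" "res (inverse x) = inverse (res x)"
proof -
  have "x \<notin> I 1" using assms res_0_iff by blast
  then show x: "x \<noteq> 0" "v x = 0" using unit_v[of x 0] assms(1) by auto
  then show i: "inverse x \<in> I 0" by (simp add: I_nonzero v_inverse)
  have "res x * res (inverse x) = 1" using res_mult[OF assms(1) i] x by (simp add: res_one)
  then show "res (inverse x) = inverse (res x)" by (rule inverse_unique[symmetric])
qed

lemma \<sigma>_0 [simp]: "\<sigma> 0 = 0"
  using \<sigma>_add[of 0 0] by (metis add_cancel_right_right)

lemma \<sigma>_1 [simp]: "\<sigma> 1 = 1"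
  using \<sigma>_fixes_F F_one by blast

lemma \<sigma>_eps [simp]: "\<sigma> \<epsilon> = \<epsilon>"
  using \<sigma>_fixes_F uniformizer by blast

lemma \<sigma>_minus [simp]: "\<sigma> (- x) = - \<sigma> x"
  using \<sigma>_add[of x "- x"] by (simp add: eq_neg_iff_add_eq_0 add.commute)

lemma \<sigma>_diff: "\<sigma> (x - y) = \<sigma> x - \<sigma> y"
  using \<sigma>_add[of x "- y"] by simp

lemma \<sigma>_eq_iff [simp]: "\<sigma> x = \<sigma> y \<longleftrightarrow> x = y"
  using bij_is_inj[OF \<sigma>_bij] by (simp add: inj_eq)

lemma \<sigma>_eq_0_iff [simp]: "\<sigma> x = 0 \<longleftrightarrow> x = 0"
  using \<sigma>_eq_iff[of x 0] by simp

lemma \<sigma>_inverse: "\<sigma> (inverse x) = inverse (\<sigma> x)"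
proof (cases "x = 0")
  case False
  then have "\<sigma> x * \<sigma> (inverse x) = 1" by (simp flip: \<sigma>_mult)
  then show ?thesis by (rule inverse_unique[symmetric])
qed simp

lemma \<sigma>_power: "\<sigma> (x ^ n) = \<sigma> x ^ n"
  by (induction n) (simp_all add: \<sigma>_mult)

lemma \<sigma>_eps_powi [simp]: "\<sigma> (\<epsilon> powi n) = \<epsilon> powi n"
  by (simp add: power_int_def \<sigma>_power \<sigma>_inverse)

lemma \<sigma>_I_iff [simp]: "\<sigma> x \<in> I n \<longleftrightarrow> x \<in> I n"
  using \<sigma>_valuation[of x] by (cases "x = 0") (auto simp: frac_ideal_def)

lemma \<sigma>_preimage: "\<exists>y. \<sigma> y = x"
  using bij_is_surj[OF \<sigma>_bij] by (metis surjD)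

lemma res_\<sigma>_\<sigma>: "x \<in> I 0 \<Longrightarrow> res (\<sigma> (\<sigma> x)) = res x ^ CARD('k) ^ 2"
  by (simp add: \<sigma>_residue power2_eq_square power_mult)

lemma of_nat_q: "of_nat CARD('k) = (0 :: 'k alg_closure)"
  using of_nat_card_finite_ring[where ?'a = 'k] by (metis to_ac_0 to_ac_of_nat)

section \<open>Teichmueller representatives and approximation by fixed elements\<close>

lemma teich_0 [simp]: "teich 0 = 0"
proof -
  have "teich 0 * teich 0 = teich 0" using teich_mult[of 0 0] by simp
  moreover have "teich 0 \<noteq> 1" using res_teich[of 0] res_one by auto
  ultimately show ?thesis by simp
qed

lemma teich_1 [simp]: "teich 1 = 1"
proof -
  have "teich 1 * teich 1 = teich 1" using teich_mult[of 1 1] by simp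
  moreover have "teich 1 \<noteq> 0" using res_teich[of 1] res_0 by auto
  ultimately show ?thesis by simp
qed

lemma teich_power: "teich (a ^ n) = teich a ^ n"
  by (induction n) (simp_all add: teich_mult)

text \<open>The quotient r of \<sigma>^2[a] by [a] is a root of unity of order dividing q^2 - 1 with
  residue 1. Such a root of unity is trivial, in either characteristic.\<close>

lemma \<sigma>_\<sigma>_teich:
  assumes "a ^ CARD('k) ^ 2 = a"
  shows "\<sigma> (\<sigma> (teich a)) = teich a"
proof (cases "a = 0")
  case False
  let ?Q = "CARD('k) ^ 2"
  have Q: "?Q = Suc (?Q - 1)" by (simp add: finite_UNIV_card_ge_0)
  have "a ^ (?Q - 1) = 1" using assms False Q by (metis mult_cancel_right1 power_Suc2)
  then have n: "teich a ^ (?Q - 1) = 1" by (simp flip: teich_power)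
  have t0: "teich a \<noteq> 0" using False res_teich[of a] res_0 by auto
  define r where "r = \<sigma> (\<sigma> (teich a)) / teich a"
  have r: "r ^ (?Q - 1) = 1" using n by (simp add: r_def power_divide flip: \<sigma>_power)
  have ti: "teich a \<in> I 0" "res (teich a) \<noteq> 0" using teich_integral res_teich False by auto
  note inv = res_nonzero_inverse[OF ti]
  have rI: "r \<in> I 0" using inv ti by (simp add: r_def divide_inverse I_mult_left)
  have "res r = 1"
    using inv ti res_\<sigma>_\<sigma>[of "teich a"] assms False
    by (simp add: r_def divide_inverse res_mult res_teich)
  \<comment> \<open>The cofactor of r - 1 in r^(q^2 - 1) - 1. Its residue is q^2 - 1 = -1, so it is
    nonzero and r - 1 must vanish.\<close>
  define s where "s = (\<Sum>i<?Q - 1. r ^ i)"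
  have "res s = (\<Sum>i<?Q - 1. res (r ^ i))"
    unfolding s_def using res_sum[of "{..<?Q - 1}" "\<lambda>i. r ^ i"] rI by (simp add: I_power)
  also have "\<dots> = of_nat (?Q - 1)" using \<open>res r = 1\<close> by (simp add: res_power rI)
  also have "\<dots> = of_nat ?Q - 1" using Q by (metis add_diff_cancel_left' of_nat_Suc)
  also have "\<dots> = - 1" by (simp add: of_nat_q)
  finally have "s \<noteq> 0" using res_0 by auto
  moreover have "(r - 1) * s = 0" unfolding s_def using r by (simp flip: power_diff_1_eq)
  ultimately have "r = 1" by simp
  then show ?thesis using t0 by (simp add: r_def)
qed simp

text \<open>Each \<open>\<epsilon>\<close>-adic digit of \<open>y\<close> below the precision is fixed by \<open>\<tau>\<close>, hence has a fixed lift.\<close>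
lemma fixed_approximation:
  assumes add: "\<And>x y. \<tau> (x + y) = \<tau> x + \<tau> y"
    and mult: "\<And>x y. \<tau> (x * y) = \<tau> x * \<tau> y"
    and eps: "\<And>n. \<tau> (\<epsilon> powi n) = \<epsilon> powi n"
    and I: "\<And>x n. \<tau> x \<in> I n \<longleftrightarrow> x \<in> I n"
    and lift: "\<And>x. x \<in> I 0 \<Longrightarrow> res (\<tau> x) = res x \<Longrightarrow> \<exists>t \<in> I 0. \<tau> t = t \<and> res t = res x"
    and y: "y - \<tau> y \<in> I n"
  shows "\<exists>y'. \<tau> y' = y' \<and> y - y' \<in> I n"
proof -
  have t0: "\<tau> 0 = 0" using add[of 0 0] by (metis add_cancel_right_right)
  obtain m where "y \<in> I m" using ex_I by blast
  then show ?thesis using y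
  proof (induction "nat (n - m)" arbitrary: m y rule: less_induct)
    case less
    show ?case
    proof (cases "n \<le> m")
      case True
      then show ?thesis using less.prems(1) t0 I_mono by (intro exI[of _ 0]) auto
    next
      case False
      define u where "u = \<epsilon> powi (- m) * y"
      have u: "u \<in> I 0" using less.prems(1) by (simp add: u_def I_powi_mult_iff)
      have "u - \<tau> u = \<epsilon> powi (- m) * (y - \<tau> y)" by (simp add: u_def mult eps algebra_simps del: power_int_minus)
      then have "u - \<tau> u \<in> I (n - m)" using less.prems(2) by (simp add: I_powi_mult_iff del: power_int_minus)
      then have "u - \<tau> u \<in> I 1" using False I_mono by fastforce
      then have "res (\<tau> u) = res u" using u by (simp add: I res_eq_iff[symmetric])
      with lift u obtain t where t: "t \<in> I 0" "\<tau> t = t" "res t = res u" by blast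
      \<comment> \<open>Removing the fixed lift of the leading digit raises the valuation and leaves
        the defect y - \<tau> y unchanged.\<close>
      define z where "z = y - \<epsilon> powi m * t"
      have "y = \<epsilon> powi m * u" by (simp add: u_def power_int_minus)
      then have "z = \<epsilon> powi m * (u - t)" by (simp add: z_def algebra_simps)
      moreover have "u - t \<in> I 1" using t u by (simp add: res_eq_iff[symmetric])
      ultimately have z: "z \<in> I (m + 1)" by (simp add: I_powi_mult_iff)
      have "\<tau> y = \<tau> z + \<epsilon> powi m * t" using add[of z "\<epsilon> powi m * t"] by (simp add: z_def mult eps t)
      then have "z - \<tau> z = y - \<tau> y" by (simp add: z_def)
      then obtain y' where y': "\<tau> y' = y'" "z - y' \<in> I n"
        using less.hyps[of "m + 1" z] z less.prems(2) False by auto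
      have "\<tau> (\<epsilon> powi m * t + y') = \<epsilon> powi m * t + y'" by (simp add: add mult eps t y')
      moreover have "y - (\<epsilon> powi m * t + y') \<in> I n" using y'(2) by (simp add: z_def algebra_simps)
      ultimately show ?thesis by blast
    qed
  qed
qed

text \<open>A digit fixed by the q-power map lies in k and lifts to F, where \<sigma> is the
  identity.\<close>

lemma \<sigma>_fixed_approximation:
  assumes "y - \<sigma> y \<in> I n"
  shows "\<exists>y'. \<sigma> y' = y' \<and> y - y' \<in> I n"
proof (rule fixed_approximation[of \<sigma>])
  fix x assume x: "x \<in> I 0" "res (\<sigma> x) = res x"
  then have "res x \<in> res ` (F \<inter> I 0)"
    using frobenius_fixed_in_base_field[of "res x"] F_residue_field by (simp add: \<sigma>_residue)
  then show "\<exists>t \<in> I 0. \<sigma> t = t \<and> res t = res x" using \<sigma>_fixes_F by force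
qed (use assms in \<open>simp_all add: \<sigma>_add \<sigma>_mult\<close>)

text \<open>The digits now lie in the field with q^2 elements, beyond the residue field of F; their
  Teichmueller representatives serve as fixed lifts.\<close>

lemma \<sigma>_\<sigma>_fixed_approximation:
  assumes "y - \<sigma> (\<sigma> y) \<in> I n"
  shows "\<exists>y'. \<sigma> (\<sigma> y') = y' \<and> y - y' \<in> I n"
proof (rule fixed_approximation[of "\<lambda>x. \<sigma> (\<sigma> x)"])
  fix x assume x: "x \<in> I 0" "res (\<sigma> (\<sigma> x)) = res x"
  then have "\<sigma> (\<sigma> (teich (res x))) = teich (res x)" by (simp add: \<sigma>_\<sigma>_teich res_\<sigma>_\<sigma>)
  then show "\<exists>t \<in> I 0. \<sigma> (\<sigma> t) = t \<and> res t = res x" using teich_integral res_teich by blast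
qed (use assms in \<open>simp_all add: \<sigma>_add \<sigma>_mult\<close>)


subsection \<open>The operator \<open>\<Phi>\<close> and its centralizer\<close>

definition \<Phi> :: "'l ^ 4 \<Rightarrow> 'l ^ 4" where
  "\<Phi> z = vector [\<epsilon> * \<sigma> (z $ 2), \<sigma> (z $ 1), \<epsilon> * \<sigma> (z $ 4), \<sigma> (z $ 3)]"

lemma \<Phi>_nth [simp]:
  "\<Phi> z $ 1 = \<epsilon> * \<sigma> (z $ 2)" "\<Phi> z $ 2 = \<sigma> (z $ 1)" "\<Phi> z $ 3 = \<epsilon> * \<sigma> (z $ 4)" "\<Phi> z $ 4 = \<sigma> (z $ 3)"
  by (simp_all add: \<Phi>_def)

lemma \<Phi>_add: "\<Phi> (x + y) = \<Phi> x + \<Phi> y"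
  and \<Phi>_diff: "\<Phi> (x - y) = \<Phi> x - \<Phi> y"
  and \<Phi>_scale: "\<Phi> (a *s x) = \<sigma> a *s \<Phi> x"
  by (simp_all add: vec4_eq_iff \<sigma>_add \<sigma>_diff \<sigma>_mult algebra_simps)

lemma \<Phi>_eq_iff [simp]: "\<Phi> x = \<Phi> y \<longleftrightarrow> x = y"
  by (auto simp: vec4_eq_iff)

lemma \<Phi>_form: "sympl_form (\<Phi> x) (\<Phi> y) = \<epsilon> * \<sigma> (sympl_form x y)"
  by (simp add: sympl_form_def \<sigma>_add \<sigma>_diff \<sigma>_mult algebra_simps)

text \<open>Slope 1/2 in concrete form. A linear map that commutes with \<Phi> consequently commutes
  with the coordinatewise \<sigma>^2.\<close>

lemma \<Phi>_\<Phi>: "\<Phi> (\<Phi> z) = \<epsilon> *s (\<chi> i. \<sigma> (\<sigma> (z $ i)))"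
  by (simp add: vec4_eq_iff \<sigma>_mult)

lemma b_elt_apply: "b_elt \<epsilon> *v z = vector [\<epsilon> * z $ 2, z $ 1, \<epsilon> * z $ 4, z $ 3]"
  by (simp add: b_elt_def flip: cols_def) (simp add: cols_mult vec4_eq_iff e_vec_def f_vec_def axis_def)

lemma \<Phi>_eq: "\<Phi> z = b_elt \<epsilon> *v (\<chi> i. \<sigma> (z $ i))"
  by (simp add: b_elt_apply vec4_eq_iff)

lemma map_matrix_\<sigma>_apply: "map_matrix \<sigma> g *v (\<chi> i. \<sigma> (z $ i)) = (\<chi> i. \<sigma> ((g *v z) $ i))"
  for g :: "'l ^ 4 ^ 4"
  by (simp add: vec_eq_iff matrix_vector_mult_def map_matrix_def sum_4 \<sigma>_add \<sigma>_mult)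

lemma \<sigma>_vec_preimage: "\<exists>y. (\<chi> i. \<sigma> (y $ i)) = x" for x :: "'l ^ 4"
proof -
  obtain s where "\<And>x. \<sigma> (s x) = x" using \<sigma>_preimage by metis
  then show ?thesis by (intro exI[of _ "\<chi> i. s (x $ i)"]) simp
qed

text \<open>Every vector is the \<sigma>-image of a vector, so the twisted matrix equation may be
  tested on such images, where it reads as commutation with \<Phi>.\<close>

lemma J_b_iff: "g \<in> J_b \<epsilon> \<sigma> \<longleftrightarrow> g \<in> GSp4 \<and> (\<forall>z. g *v \<Phi> z = \<Phi> (g *v z))"
proof -
  have *: "\<Phi> (g *v z) = (b_elt \<epsilon> ** map_matrix \<sigma> g) *v (\<chi> i. \<sigma> (z $ i))"
    "g *v \<Phi> z = (g ** b_elt \<epsilon>) *v (\<chi> i. \<sigma> (z $ i))" for z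
    by (simp_all add: \<Phi>_eq map_matrix_\<sigma>_apply flip: matrix_vector_mul_assoc)
  have "g ** b_elt \<epsilon> = b_elt \<epsilon> ** map_matrix \<sigma> g \<longleftrightarrow> (\<forall>z. g *v \<Phi> z = \<Phi> (g *v z))"
  proof
    assume "\<forall>z. g *v \<Phi> z = \<Phi> (g *v z)"
    then show "g ** b_elt \<epsilon> = b_elt \<epsilon> ** map_matrix \<sigma> g"
      unfolding * by (intro matrix_eq_on_vectors) (metis \<sigma>_vec_preimage)
  qed (simp add: *)
  then show ?thesis by (simp add: J_b_def)
qed

lemma J_GSp4: "j \<in> J_b \<epsilon> \<sigma> \<Longrightarrow> j \<in> GSp4"
  and J_\<Phi>: "j \<in> J_b \<epsilon> \<sigma> \<Longrightarrow> \<Phi> (j *v z) = j *v \<Phi> z"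
  by (simp_all add: J_b_iff)

lemma J_mat_1: "mat 1 \<in> J_b \<epsilon> \<sigma>"
  by (simp add: J_b_iff GSp4_mat_1)

lemma J_mult: "j \<in> J_b \<epsilon> \<sigma> \<Longrightarrow> j' \<in> J_b \<epsilon> \<sigma> \<Longrightarrow> j ** j' \<in> J_b \<epsilon> \<sigma>"
  by (simp add: J_b_iff GSp4_mult flip: matrix_vector_mul_assoc)

lemma J_inv:
  assumes "j \<in> J_b \<epsilon> \<sigma>"
  shows "matrix_inv j \<in> J_b \<epsilon> \<sigma>"
proof -
  note inv = matrix_inv_apply[OF GSp4_invertible[OF J_GSp4[OF assms]]]
  have "matrix_inv j *v \<Phi> z = \<Phi> (matrix_inv j *v z)" for z
    using J_\<Phi>[OF assms, of "matrix_inv j *v z"] by (simp add: inv)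
  then show ?thesis using GSp4_inv[OF J_GSp4[OF assms]] by (simp add: J_b_iff)
qed

text \<open>If the coordinates of a and c are fixed by \<sigma>^2, then \<Phi>^2 multiplies a and c
  by \<epsilon>. The columns are then permuted by \<Phi> exactly as e_1, e_2, f_1, f_2 are. This is
  the source of all explicit elements of J_b(F).\<close>

lemma J_cols:
  assumes "\<And>i. \<sigma> (\<sigma> (a $ i)) = a $ i" "\<And>i. \<sigma> (\<sigma> (c $ i)) = c $ i"
    and "m \<noteq> 0" "sympl_form a (\<Phi> c) = m" "sympl_form (\<Phi> a) c = m"
    and "sympl_form a c = 0" "sympl_form a (\<Phi> a) = 0" "sympl_form c (\<Phi> c) = 0"
  shows "cols a (\<Phi> a) c (\<Phi> c) \<in> J_b \<epsilon> \<sigma>" "simil (cols a (\<Phi> a) c (\<Phi> c)) m"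
proof -
  show s: "simil (cols a (\<Phi> a) c (\<Phi> c)) m"
    by (rule simil_cols) (use assms in \<open>auto simp: \<Phi>_form\<close>)
  have "\<Phi> (\<Phi> a) = \<epsilon> *s a" "\<Phi> (\<Phi> c) = \<epsilon> *s c" by (simp_all add: \<Phi>_\<Phi> assms)
  then have "cols a (\<Phi> a) c (\<Phi> c) *v \<Phi> z = \<Phi> (cols a (\<Phi> a) c (\<Phi> c) *v z)" for z
    by (simp add: cols_mult \<Phi>_add \<Phi>_scale \<sigma>_mult algebra_simps)
  with s show "cols a (\<Phi> a) c (\<Phi> c) \<in> J_b \<epsilon> \<sigma>" by (simp add: J_b_iff simil_GSp4)
qed

text \<open>j commutes with \<Phi>^2, which is \<epsilon> times \<sigma>^2. This stability under
  \<sigma>^2 distinguishes the lattices j Lambda_0 from the Lambda_x with irrational x.\<close>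

lemma J_lat_\<sigma>_\<sigma>:
  assumes "j \<in> J_b \<epsilon> \<sigma>" "z \<in> lat j"
  shows "(\<chi> i. \<sigma> (\<sigma> (z $ i))) \<in> lat j"
proof -
  obtain w where w: "w \<in> cube 0" "z = j *v w" using assms(2) by (auto simp: translate_def)
  have "\<epsilon> *s (\<chi> i. \<sigma> (\<sigma> (z $ i))) = \<epsilon> *s (j *v (\<chi> i. \<sigma> (\<sigma> (w $ i))))"
    unfolding \<Phi>_\<Phi>[symmetric] vector_scalar_commute[symmetric] using w(2) by (simp add: J_\<Phi>[OF assms(1)])
  then have "(\<chi> i. \<sigma> (\<sigma> (z $ i))) = j *v (\<chi> i. \<sigma> (\<sigma> (w $ i)))" by simp
  moreover have "(\<chi> i. \<sigma> (\<sigma> (w $ i))) \<in> cube 0" using w(1) by (simp add: mem_cube)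
  ultimately show ?thesis by (auto simp: translate_def)
qed

text \<open>Stability of \<open>M\<close> under \<open>V = \<epsilon>\<Phi>\<^sup>-\<^sup>1\<close> is expressed as \<open>\<epsilon>M \<subseteq> \<Phi>M\<close>.\<close>
definition dieudonne :: "('l ^ 4) set \<Rightarrow> bool" where
  "dieudonne M \<longleftrightarrow> (\<forall>x\<in>M. \<Phi> x \<in> M) \<and> (\<forall>x\<in>M. \<exists>y\<in>M. \<Phi> y = \<epsilon> *s x)"

lemma dieudonne_translate:
  assumes "j \<in> J_b \<epsilon> \<sigma>" "dieudonne M"
  shows "dieudonne (translate j M)"
proof -
  have "\<Phi> (j *v x) \<in> translate j M" if "x \<in> M" for x
    using assms(2) that by (auto simp: dieudonne_def translate_def J_\<Phi>[OF assms(1)])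
  moreover have "\<exists>y\<in>translate j M. \<Phi> y = \<epsilon> *s (j *v x)" if x: "x \<in> M" for x
  proof -
    obtain y where "y \<in> M" "\<Phi> y = \<epsilon> *s x" using assms(2) x unfolding dieudonne_def by blast
    then have "j *v y \<in> translate j M" "\<Phi> (j *v y) = \<epsilon> *s (j *v x)"
      by (simp_all add: translate_def J_\<Phi>[OF assms(1)] vector_scalar_commute)
    then show ?thesis by blast
  qed
  ultimately show ?thesis by (auto simp: dieudonne_def translate_def)
qed

lemma dieudonne_cube: "dieudonne (cube 0)"
proof -
  have "\<exists>y\<in>cube 0. \<Phi> y = \<epsilon> *s x" if "x \<in> cube 0" for x
  proof -
    obtain s where s: "\<And>x. \<sigma> (s x) = x" using \<sigma>_preimage by metis
    have "s x \<in> I n \<longleftrightarrow> x \<in> I n" for x n using \<sigma>_I_iff[of "s x" n] s by simp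
    then have "vector [\<epsilon> * s (x $ 2), s (x $ 1), \<epsilon> * s (x $ 4), s (x $ 3)] \<in> cube 0"
      using that by (simp add: cube_iff I_eps_mult_iff) (use I_mono[of _ 0 "-1"] in auto)
    moreover have "\<Phi> (vector [\<epsilon> * s (x $ 2), s (x $ 1), \<epsilon> * s (x $ 4), s (x $ 3)]) = \<epsilon> *s x"
      by (simp add: vec4_eq_iff \<sigma>_mult s)
    ultimately show ?thesis by blast
  qed
  moreover have "\<Phi> x \<in> cube 0" if "x \<in> cube 0" for x
    using that I_mono[of _ 0 "-1"] by (auto simp: cube_iff I_eps_mult_iff)
  ultimately show ?thesis by (simp add: dieudonne_def)
qed

text \<open>As \<mu>(\<epsilon>) is diagonal with entries \<epsilon>, \<epsilon>, 1, 1, membership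
  in its double coset places \<Phi>M between \<epsilon>M and M.\<close>

lemma X_mu_b_dieudonne:
  assumes "g \<in> X_mu_b v \<epsilon> \<sigma>"
  shows "g \<in> GSp4" "dieudonne (lat g)"
proof -
  show g: "g \<in> GSp4" using assms by (simp add: X_mu_b_def)
  obtain h h' where h: "h \<in> K_stab v \<epsilon>" "h' \<in> K_stab v \<epsilon>"
    "matrix_inv g ** b_elt \<epsilon> ** map_matrix \<sigma> g = h ** cochar_at mu \<epsilon> ** h'"
    using assms by (auto simp: X_mu_b_def double_coset_def)
  note hG = h(1,2)[THEN K_GSp4]
  have key: "\<Phi> (g *v z) = g *v (h *v (cochar_at mu \<epsilon> *v (h' *v (\<chi> i. \<sigma> (z $ i)))))" for z
  proof -
    have "\<Phi> (g *v z) = b_elt \<epsilon> *v (map_matrix \<sigma> g *v (\<chi> i. \<sigma> (z $ i)))"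
      by (simp add: \<Phi>_eq map_matrix_\<sigma>_apply)
    also have "\<dots> = g *v ((matrix_inv g ** b_elt \<epsilon> ** map_matrix \<sigma> g) *v (\<chi> i. \<sigma> (z $ i)))"
      by (simp add: matrix_inv_apply GSp4_invertible[OF g] flip: matrix_vector_mul_assoc)
    finally show ?thesis by (simp add: h(3) flip: matrix_vector_mul_assoc)
  qed
  have mu: "cochar_at mu \<epsilon> *v x = vector [\<epsilon> * x $ 1, \<epsilon> * x $ 2, x $ 3, x $ 4]" for x
    by (simp add: cochar_at_apply mu_def vec4_eq_iff)
  have "\<Phi> (g *v z) \<in> lat g" if z: "z \<in> cube 0" for z
  proof -
    have "(\<chi> i. \<sigma> (z $ i)) \<in> cube 0" using z by (simp add: mem_cube)
    then have "h' *v (\<chi> i. \<sigma> (z $ i)) \<in> cube 0" by (rule K_preserves_cube[OF h(2)])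
    then have "cochar_at mu \<epsilon> *v (h' *v (\<chi> i. \<sigma> (z $ i))) \<in> cube 0"
      unfolding mu using I_mono[of _ 0 "-1"] by (auto simp: cube_iff I_eps_mult_iff)
    then have "h *v (cochar_at mu \<epsilon> *v (h' *v (\<chi> i. \<sigma> (z $ i)))) \<in> cube 0"
      by (rule K_preserves_cube[OF h(1)])
    then show ?thesis unfolding key by (simp add: translate_def)
  qed
  moreover have "\<exists>y\<in>lat g. \<Phi> y = \<epsilon> *s (g *v x)" if x: "x \<in> cube 0" for x
  proof -
    define w where "w = matrix_inv h *v x"
    \<comment> \<open>This is \<epsilon> times the inverse of \<mu>(\<epsilon>) applied to w, which
      is still integral.\<close>
    define u :: "'l ^ 4" where "u = vector [w $ 1, w $ 2, \<epsilon> * w $ 3, \<epsilon> * w $ 4]"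
    have "w \<in> cube 0" unfolding w_def by (rule K_preserves_cube[OF K_inv[OF h(1)] x])
    then have "u \<in> cube 0" unfolding u_def using I_mono[of _ 0 "-1"] by (auto simp: cube_iff I_eps_mult_iff)
    then have u: "matrix_inv h' *v u \<in> cube 0" by (rule K_preserves_cube[OF K_inv[OF h(2)]])
    obtain z where z: "(\<chi> i. \<sigma> (z $ i)) = matrix_inv h' *v u" using \<sigma>_vec_preimage by metis
    have "\<sigma> (z $ i) \<in> I 0" for i using u unfolding z[symmetric] mem_cube by simp
    then have "g *v z \<in> lat g" by (simp add: translate_def mem_cube)
    moreover have "\<Phi> (g *v z) = \<epsilon> *s (g *v x)"
    proof -
      have "cochar_at mu \<epsilon> *v u = \<epsilon> *s w" by (simp add: mu u_def vec4_eq_iff)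
      then have "\<Phi> (g *v z) = g *v (h *v (\<epsilon> *s w))"
        unfolding key z by (simp add: matrix_inv_apply GSp4_invertible[OF hG(2)])
      then show ?thesis
        by (simp add: w_def vector_scalar_commute matrix_inv_apply GSp4_invertible[OF hG(1)])
    qed
    ultimately show ?thesis by blast
  qed
  ultimately show "dieudonne (lat g)" unfolding dieudonne_def by (auto simp: translate_def)
qed

end

subsection \<open>Kaiser's classification\<close>

context completed_unramified_extension
begin

lemma \<sigma>_divide: "\<sigma> (x / y) = \<sigma> x / \<sigma> y"
  by (simp add: divide_inverse \<sigma>_mult \<sigma>_inverse)

text \<open>The lattice Lambda_x in coordinates. The residues of the first coordinate and of
  \<epsilon> times the fourth are coordinates on P^\<or>/P, and x is the slope of the line cut out
  there.\<close>

definition lam :: "'k alg_closure \<Rightarrow> ('l ^ 4) set" where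
  "lam x = {z. z $ 1 \<in> I 0 \<and> z $ 2 \<in> I 0 \<and> z $ 3 \<in> I 0 \<and> \<epsilon> * z $ 4 \<in> I 0 \<and>
     res (\<epsilon> * z $ 4) = x * res (z $ 1)}"

definition lam_mat :: "'k alg_closure \<Rightarrow> 'l ^ 4 ^ 4" where
  "lam_mat x = cols (vector [1, 0, 0, teich x / \<epsilon>]) (axis 2 1) (axis 3 1) (axis 4 1)"

lemma simil_lam_mat: "simil (lam_mat x) 1"
  unfolding lam_mat_def by (rule simil_cols) (simp_all add: sympl_form_def axis_def)

lemma lat_lam_mat: "lat (lam_mat x) = lam x"
proof (intro equalityI subsetI)
  fix z assume "z \<in> lat (lam_mat x)"
  then obtain s t u w where *: "s \<in> I 0" "t \<in> I 0" "u \<in> I 0" "w \<in> I 0" and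
    z: "z = s *s vector [1, 0, 0, teich x / \<epsilon>] + t *s axis 2 1 + u *s axis 3 1 + w *s axis 4 1"
    unfolding lam_mat_def mem_lat_cols by blast
  have nth: "z $ 1 = s" "z $ 2 = t" "z $ 3 = u" "\<epsilon> * z $ 4 = s * teich x + \<epsilon> * w"
    by (simp_all add: z axis_def algebra_simps)
  have w: "\<epsilon> * w \<in> I 1" using *(4) by (simp add: I_eps_mult_iff)
  then have w0: "\<epsilon> * w \<in> I 0" "res (\<epsilon> * w) = 0" using I_mono res_0_iff by auto
  have "s * teich x \<in> I 0" using *(1) teich_integral by (rule I_mult_left)
  then show "z \<in> lam x"
    using * w0 by (simp add: lam_def nth I_add res_add res_mult teich_integral res_teich mult.commute)
next
  fix z assume z: "z \<in> lam x"
  define w where "w = z $ 4 - z $ 1 * teich x / \<epsilon>"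
  have i: "z $ 1 * teich x \<in> I 0" using z teich_integral by (auto simp: lam_def intro: I_mult_left)
  have "\<epsilon> * z $ 4 - z $ 1 * teich x \<in> I 1"
    using z i by (subst res_eq_iff[symmetric]) (auto simp: lam_def res_mult teich_integral res_teich)
  moreover have "\<epsilon> * w = \<epsilon> * z $ 4 - z $ 1 * teich x" by (simp add: w_def algebra_simps)
  ultimately have "w \<in> I 0" using I_eps_mult_iff[of w 1] by simp
  moreover have "z = z $ 1 *s vector [1, 0, 0, teich x / \<epsilon>] + z $ 2 *s axis 2 1 + z $ 3 *s axis 3 1 + w *s axis 4 1"
    by (simp add: vec4_eq_iff axis_def w_def)
  ultimately show "z \<in> lat (lam_mat x)"
    using z unfolding lam_mat_def mem_lat_cols lam_def by blast
qed

lemma Lambda_eq: "Lambda v \<epsilon> teich x = lam x"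
proof -
  have "e_vec \<epsilon> 1 + teich x *s f_vec \<epsilon> 0 = vector [1, 0, 0, teich x / \<epsilon>]"
    "e_vec \<epsilon> 2 = axis 2 1" "f_vec \<epsilon> 1 = axis 3 1" "f_vec \<epsilon> 2 = axis 4 1"
    by (simp_all add: e_vec_def f_vec_def axis_def vec4_eq_iff power_int_minus divide_inverse)
  moreover have "distinct [vector [1, 0, 0, teich x / \<epsilon>], axis 2 1, axis 3 1, axis 4 1 :: 'l ^ 4]"
    by (simp add: vec4_eq_iff axis_def)
  ultimately show ?thesis
    by (simp add: Lambda_def lattice_span_eq_lat lat_lam_mat flip: lam_mat_def)
qed

lemma submod_lam: "submod (lam x)"
  using submod_lat[of "lam_mat x"] by (simp add: lat_lam_mat)

text \<open>For x in the field with q^2 elements, [x] is fixed by \<sigma>^2, so e_1 + [x] f_0 and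
  f_1 are admissible in \<open>J_cols\<close>. The resulting lattice lies in Lambda_x and has the
  same multiplier.\<close>

lemma lam_superspecial:
  assumes "x ^ CARD('k) ^ 2 = x"
  shows "\<exists>i \<in> J_b \<epsilon> \<sigma>. lam x = lat i"
proof -
  define a :: "'l ^ 4" where "a = vector [1, 0, 0, teich x / \<epsilon>]"
  define c :: "'l ^ 4" where "c = axis 3 1"
  have fixed: "\<sigma> (\<sigma> (a $ i)) = a $ i" "\<sigma> (\<sigma> (c $ i)) = c $ i" for i
    using exhaust_4[of i] \<sigma>_\<sigma>_teich[OF assms]
    by (auto simp: a_def c_def axis_def \<sigma>_divide)
  have "cols a (\<Phi> a) c (\<Phi> c) \<in> J_b \<epsilon> \<sigma>" "simil (cols a (\<Phi> a) c (\<Phi> c)) 1"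
    by (rule J_cols[OF fixed]; simp add: a_def c_def sympl_form_def axis_def)+
  moreover have "lat (cols a (\<Phi> a) c (\<Phi> c)) \<subseteq> lam x"
  proof (rule lat_cols_subset[OF submod_lam])
    show "a \<in> lam x" by (simp add: a_def lam_def teich_integral res_teich res_one)
    have "\<Phi> a = vector [0, 1, \<sigma> (teich x), 0]"
      by (simp add: a_def vec4_eq_iff \<sigma>_divide)
    then show "\<Phi> a \<in> lam x" by (simp add: lam_def teich_integral)
    show "c \<in> lam x" by (simp add: c_def lam_def axis_def)
    have "\<epsilon> \<in> I 0" "res \<epsilon> = 0" using I_mono[OF eps_I] res_0_iff[of \<epsilon>] by simp_all
    then show "\<Phi> c \<in> lam x" by (simp add: c_def lam_def axis_def)
  qed
  ultimately show ?thesis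
    using lat_eqI[of "cols a (\<Phi> a) c (\<Phi> c)" "lam_mat x" 1 1] simil_lam_mat lat_lam_mat by metis
qed

text \<open>\<open>fil n\<close> consists of the coefficient pairs of the vectors in the lattice spanned by
  \<open>e\<^sub>n\<^sub>+\<^sub>1, e\<^sub>n\<^sub>+\<^sub>2\<close>.\<close>
definition fil :: "int \<Rightarrow> ('l \<times> 'l) set" where
  "fil n = {(x, y). x \<in> I ((n + 1) div 2) \<and> y \<in> I (n div 2)}"

lemma fil_iff: "(x, y) \<in> fil n \<longleftrightarrow> x \<in> I ((n + 1) div 2) \<and> y \<in> I (n div 2)"
  by (simp add: fil_def)

lemma fil_even: "(x, y) \<in> fil (2 * k) \<longleftrightarrow> x \<in> I k \<and> y \<in> I k"
  by (simp add: fil_iff)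

lemma fil_odd: "(x, y) \<in> fil (2 * k + 1) \<longleftrightarrow> x \<in> I (k + 1) \<and> y \<in> I k"
  by (simp add: fil_iff add.commute)

lemma fst_fil: "fst ` fil n = I ((n + 1) div 2)"
proof -
  have "x \<in> fst ` fil n" if "x \<in> I ((n + 1) div 2)" for x
    using that by (intro image_eqI[of _ _ "(x, 0)"]) (simp_all add: fil_iff)
  then show ?thesis by (auto simp: fil_def)
qed

lemma snd_fil: "snd ` fil n = I (n div 2)"
proof -
  have "y \<in> snd ` fil n" if "y \<in> I (n div 2)" for y
    using that by (intro image_eqI[of _ _ "(0, y)"]) (simp_all add: fil_iff)
  then show ?thesis by (auto simp: fil_def)
qed

lemma fil_subset_iff: "fil m \<subseteq> fil n \<longleftrightarrow> n \<le> m"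
proof
  assume *: "fil m \<subseteq> fil n"
  have "(\<epsilon> powi ((m + 1) div 2), 0) \<in> fil m" "(0, \<epsilon> powi (m div 2)) \<in> fil m"
    by (simp_all add: fil_iff eps_powi_I)
  then have "(\<epsilon> powi ((m + 1) div 2), 0) \<in> fil n" "(0, \<epsilon> powi (m div 2)) \<in> fil n"
    using * by blast+
  then have "(n + 1) div 2 \<le> (m + 1) div 2" "n div 2 \<le> m div 2"
    by (simp_all add: fil_iff eps_powi_I)
  then show "n \<le> m" by presburger
next
  assume "n \<le> m"
  then have "(n + 1) div 2 \<le> (m + 1) div 2" "n div 2 \<le> m div 2" by presburger+
  then show "fil m \<subseteq> fil n" using I_mono by (auto simp: fil_def)
qed

text \<open>Consecutive members of the chain differ by one dimension over the residue field, so any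
  element outside the next member spans the quotient. Which coordinate carries it depends on the
  parity of m.\<close>

lemma fil_step:
  assumes c: "(c, c') \<in> fil m" "(c, c') \<notin> fil (m + 1)" and b: "(b, b') \<in> fil m"
  shows "\<exists>s \<in> I 0. (b - s * c, b' - s * c') \<in> fil (m + 1)"
proof -
  have sc: "s * x \<in> I n" if "s \<in> I 0" "x \<in> I n" for s x n using that by (rule I_mult_left)
  obtain k where "m = 2 * k \<or> m = 2 * k + 1" by (metis evenE oddE)
  then show ?thesis
  proof
    assume m: "m = 2 * k"
    then have "c \<in> I k" "c \<notin> I (k + 1)" "c' \<in> I k" "b \<in> I k" "b' \<in> I k"
      using c b by (auto simp: fil_even fil_odd)
    then have "c \<noteq> 0" "b / c \<in> I 0" using unit_v[of c k] by (auto simp: I_divide_iff)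
    moreover have "b' - b / c * c' \<in> I k" using I_diff sc[OF calculation(2)] \<open>b' \<in> I k\<close> \<open>c' \<in> I k\<close> by blast
    ultimately show ?thesis by (intro bexI[of _ "b / c"]) (simp_all add: m fil_odd)
  next
    assume m: "m = 2 * k + 1"
    have m1: "m + 1 = 2 * (k + 1)" using m by simp
    have "c' \<in> I k" "c' \<notin> I (k + 1)" "c \<in> I (k + 1)" "b' \<in> I k" "b \<in> I (k + 1)"
      using c b unfolding m1 fil_even by (auto simp: m fil_odd)
    then have "c' \<noteq> 0" "b' / c' \<in> I 0" using unit_v[of c' k] by (auto simp: I_divide_iff)
    moreover have "b - b' / c' * c \<in> I (k + 1)"
      using I_diff sc[OF calculation(2)] \<open>c \<in> I (k + 1)\<close> \<open>b \<in> I (k + 1)\<close> by blast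
    ultimately have "(b - b' / c' * c, b' - b' / c' * c') \<in> fil (m + 1)"
      unfolding m1 fil_even by simp
    then show ?thesis using \<open>b' / c' \<in> I 0\<close> by blast
  qed
qed

lemma fil_\<Phi>: "(\<epsilon> * \<sigma> y, \<sigma> x) \<in> fil (n + 1) \<longleftrightarrow> (x, y) \<in> fil n"
proof -
  have "(n + 1 + 1) div 2 - 1 = n div 2" by presburger
  then show ?thesis by (auto simp: fil_iff I_eps_mult_iff)
qed

text \<open>Let \<open>fil n\<close> be the smallest member of the chain containing A. Since \<Phi>
  moves the chain by exactly one step, A has elements of every exact level from n on, and these fill
  up \<open>fil n\<close>.\<close>

lemma fil_classification:
  assumes add: "\<And>x y x' y'. (x, y) \<in> A \<Longrightarrow> (x', y') \<in> A \<Longrightarrow> (x + x', y + y') \<in> A"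
    and scale: "\<And>s x y. s \<in> I 0 \<Longrightarrow> (x, y) \<in> A \<Longrightarrow> (s * x, s * y) \<in> A"
    and \<Phi>: "\<And>x y. (x, y) \<in> A \<Longrightarrow> (\<epsilon> * \<sigma> y, \<sigma> x) \<in> A"
    and lower: "fil N \<subseteq> A" and upper: "A \<subseteq> fil N'"
  shows "\<exists>n. A = fil n"
proof -
  define B where "B = {k. N' \<le> k \<and> A \<subseteq> fil k}"
  have B: "k \<in> B \<longleftrightarrow> N' \<le> k \<and> A \<subseteq> fil k" for k by (simp add: B_def)
  have "k \<le> N" if "A \<subseteq> fil k" for k using fil_subset_iff lower that by blast
  then have "B \<subseteq> {N'..N}" by (auto simp: B_def)
  then have fin: "finite B" using finite_subset by blast
  define n where "n = Max B"
  have "B \<noteq> {}" using upper B by blast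
  then have "n \<in> B" using fin by (simp add: n_def)
  then have n: "N' \<le> n" "A \<subseteq> fil n" using B by blast+
  have "n + 1 \<notin> B" using Max_ge[OF fin, of "n + 1"] by (auto simp: n_def)
  then have "\<not> A \<subseteq> fil (n + 1)" using n B[of "n + 1"] by simp
  have exact: "\<exists>c c'. (c, c') \<in> A \<and> (c, c') \<in> fil (n + int i) \<and> (c, c') \<notin> fil (n + int i + 1)" for i
  proof (induction i)
    case 0
    show ?case using \<open>\<not> A \<subseteq> fil (n + 1)\<close> n(2) by (auto simp: subset_iff)
  next
    case (Suc i)
    then obtain c c' where c: "(c, c') \<in> A" "(c, c') \<in> fil (n + int i)" "(c, c') \<notin> fil (n + int i + 1)"
      by blast
    have s: "n + int (Suc i) = n + int i + 1" by simp
    show ?case unfolding s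
      using \<Phi>[OF c(1)] c(2,3) fil_\<Phi>[of c' c "n + int i"] fil_\<Phi>[of c' c "n + int i + 1"] by blast
  qed
  \<comment> \<open>Downward induction from the member known to lie in A: one element of exact level
    m together with \<open>fil (m + 1)\<close> generates \<open>fil m\<close>.\<close>
  have "n \<le> N - int i \<Longrightarrow> fil (N - int i) \<subseteq> A" for i
  proof (induction i)
    case 0
    show ?case using lower by simp
  next
    case (Suc i)
    define m where "m = N - int (Suc i)"
    have IH: "fil (m + 1) \<subseteq> A" using Suc by (simp add: m_def)
    have "n \<le> m" using Suc.prems by (simp add: m_def)
    then obtain c c' where c: "(c, c') \<in> A" "(c, c') \<in> fil m" "(c, c') \<notin> fil (m + 1)"
      using exact[of "nat (m - n)"] by auto
    have "(b, b') \<in> A" if b: "(b, b') \<in> fil m" for b b'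
    proof -
      obtain s where s: "s \<in> I 0" "(b - s * c, b' - s * c') \<in> fil (m + 1)"
        using fil_step[OF c(2,3) b] by blast
      then have "(b - s * c, b' - s * c') \<in> A" using IH by blast
      from add[OF this scale[OF s(1) c(1)]] show ?thesis by simp
    qed
    then show ?case by (auto simp: m_def)
  qed
  from this[of "nat (N - n)"] have "fil n \<subseteq> A"
    using \<open>\<And>k. A \<subseteq> fil k \<Longrightarrow> k \<le> N\<close>[OF n(2)] by simp
  then show ?thesis using n(2) by blast
qed

text \<open>A vector of the Lagrangian spanned by e_1, e_2 pairs with a lattice vector only through
  the projection of the latter to f_1, f_2. Self-duality therefore makes the two chain members dual
  to each other, which gives n + m; in particular n and m have the same parity.\<close>

lemma iwasawa:
  assumes c: "simil g c" and D: "dieudonne (lat g)"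
  obtains n m where "n + m = 2 * v c"
    "\<And>x y. vector [x, y, 0, 0] \<in> lat g \<longleftrightarrow> (x, y) \<in> fil n"
    "\<And>x y. (\<exists>z\<in>lat g. z $ 3 = x \<and> z $ 4 = y) \<longleftrightarrow> (x, y) \<in> fil m"
proof -
  let ?M = "lat g"
  note M = submod_lat[of g]
  have \<Phi>M: "\<Phi> z \<in> ?M" if "z \<in> ?M" for z using D that by (simp add: dieudonne_def)
  obtain r where r: "?M \<subseteq> cube r" using lat_bounded by blast
  obtain r' where r': "cube r' \<subseteq> ?M" using lat_contains_cube[OF c] by blast
  define A where "A = {(x, y). vector [x, y, 0, 0] \<in> ?M}"
  define B where "B = {(x, y). \<exists>z\<in>?M. z $ 3 = x \<and> z $ 4 = y}"
  have "\<exists>n. A = fil n"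
  proof (rule fil_classification)
    fix x y x' y' s
    have "vector [x + x', y + y', 0, 0] = vector [x, y, 0, 0] + (vector [x', y', 0, 0] :: 'l ^ 4)"
      "vector [s * x, s * y, 0, 0] = s *s (vector [x, y, 0, 0] :: 'l ^ 4)"
      "vector [\<epsilon> * \<sigma> y, \<sigma> x, 0, 0] = \<Phi> (vector [x, y, 0, 0])" by (simp_all add: vec4_eq_iff)
    then show "(x, y) \<in> A \<Longrightarrow> (x', y') \<in> A \<Longrightarrow> (x + x', y + y') \<in> A"
      "s \<in> I 0 \<Longrightarrow> (x, y) \<in> A \<Longrightarrow> (s * x, s * y) \<in> A" "(x, y) \<in> A \<Longrightarrow> (\<epsilon> * \<sigma> y, \<sigma> x) \<in> A"
      using submod_add[OF M] submod_scale[OF M] \<Phi>M by (auto simp: A_def)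
  next
    show "fil (2 * r') \<subseteq> A" using r' by (auto simp: A_def fil_even subset_iff cube_iff)
    have "x \<in> I r \<and> y \<in> I r" if "vector [x, y, 0, 0] \<in> ?M" for x y
    proof -
      have "vector [x, y, 0, 0] \<in> cube r" using that r by blast
      then show ?thesis by (simp add: cube_iff)
    qed
    then show "A \<subseteq> fil (2 * r)" by (auto simp: A_def fil_even)
  qed
  then obtain n where n: "A = fil n" by blast
  have "\<exists>n. B = fil n"
  proof (rule fil_classification)
    fix x y x' y' s
    show "(x + x', y + y') \<in> B" if "(x, y) \<in> B" "(x', y') \<in> B"
      using that submod_add[OF M] by (force simp: B_def)
    show "(s * x, s * y) \<in> B" if "s \<in> I 0" "(x, y) \<in> B"
      using that submod_scale[OF M] by (force simp: B_def)
    show "(\<epsilon> * \<sigma> y, \<sigma> x) \<in> B" if "(x, y) \<in> B"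
      using that \<Phi>M by (force simp: B_def)
  next
    show "fil (2 * r') \<subseteq> B"
    proof clarify
      fix x y assume "(x, y) \<in> fil (2 * r')"
      then have "vector [0, 0, x, y] \<in> ?M" using r' by (auto simp: fil_even cube_iff subset_iff)
      then show "(x, y) \<in> B" by (force simp: B_def)
    qed
    show "B \<subseteq> fil (2 * r)" using r by (auto simp: B_def fil_even mem_cube subset_iff)
  qed
  then obtain m where m: "B = fil m" by blast
  have dual: "vector [x, y, 0, 0] \<in> ?M \<longleftrightarrow> (\<forall>(s, t)\<in>fil m. x * t + y * s \<in> I (v c))" for x y
  proof -
    have "vector [x, y, 0, 0] \<in> ?M \<longleftrightarrow> (\<forall>z\<in>?M. sympl_form (vector [x, y, 0, 0]) z \<in> I (v c))"
      by (rule lat_dual[OF c])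
    also have "\<dots> \<longleftrightarrow> (\<forall>z\<in>?M. x * z $ 4 + y * z $ 3 \<in> I (v c))" by (simp add: sympl_form_def)
    also have "\<dots> \<longleftrightarrow> (\<forall>(s, t)\<in>B. x * t + y * s \<in> I (v c))" by (auto simp: B_def)
    finally show ?thesis by (simp add: m)
  qed
  \<comment> \<open>Testing duality on multiples of a single basis vector compares the two
    filtrations one coordinate at a time.\<close>
  have "(n + 1) div 2 \<le> a \<longleftrightarrow> v c - m div 2 \<le> a" for a
  proof -
    have "(n + 1) div 2 \<le> a \<longleftrightarrow> vector [\<epsilon> powi a, 0, 0, 0] \<in> ?M"
    proof -
      have "(n + 1) div 2 \<le> a \<longleftrightarrow> (\<epsilon> powi a, 0) \<in> A" by (simp add: n fil_iff eps_powi_I)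
      then show ?thesis by (simp add: A_def)
    qed
    also have "\<dots> \<longleftrightarrow> (\<forall>(s, t)\<in>fil m. t \<in> I (v c - a))" by (simp add: dual I_powi_mult_iff)
    also have "\<dots> \<longleftrightarrow> (\<forall>t\<in>I (m div 2). t \<in> I (v c - a))" unfolding snd_fil[symmetric] by force
    also have "\<dots> \<longleftrightarrow> v c - m div 2 \<le> a" using I_subset_iff[of "m div 2" "v c - a"] by auto
    finally show ?thesis .
  qed
  moreover have "n div 2 \<le> a \<longleftrightarrow> v c - (m + 1) div 2 \<le> a" for a
  proof -
    have "n div 2 \<le> a \<longleftrightarrow> vector [0, \<epsilon> powi a, 0, 0] \<in> ?M"
    proof -
      have "n div 2 \<le> a \<longleftrightarrow> (0, \<epsilon> powi a) \<in> A" by (simp add: n fil_iff eps_powi_I)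
      then show ?thesis by (simp add: A_def)
    qed
    also have "\<dots> \<longleftrightarrow> (\<forall>(s, t)\<in>fil m. s \<in> I (v c - a))" by (simp add: dual I_powi_mult_iff)
    also have "\<dots> \<longleftrightarrow> (\<forall>s\<in>I ((m + 1) div 2). s \<in> I (v c - a))" unfolding fst_fil[symmetric] by force
    also have "\<dots> \<longleftrightarrow> v c - (m + 1) div 2 \<le> a" using I_subset_iff[of "(m + 1) div 2" "v c - a"] by auto
    finally show ?thesis .
  qed
  ultimately have "(n + 1) div 2 = v c - m div 2" "n div 2 = v c - (m + 1) div 2"
    by (metis order_antisym order_refl)+
  then have "n + m = 2 * v c" by presburger
  moreover have "vector [x, y, 0, 0] \<in> ?M \<longleftrightarrow> (x, y) \<in> fil n" for x y by (simp add: A_def flip: n)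
  moreover have "(\<exists>z\<in>?M. z $ 3 = x \<and> z $ 4 = y) \<longleftrightarrow> (x, y) \<in> fil m" for x y by (simp add: B_def flip: m)
  ultimately show ?thesis by (rule that)
qed

text \<open>The pairing of z with \<Phi>z is z_1 - \<sigma>(z_1), and comparison of \<Phi>w with Vw
  controls \<epsilon> z_2 in the same way. Both coordinates may thus be replaced by fixed elements,
  except for one digit.\<close>

lemma classification_normalized:
  assumes c: "simil g c" "v c = 0" and D: "dieudonne (lat g)"
    and e: "\<And>x y. vector [x, y, 0, 0] \<in> lat g \<longleftrightarrow> x \<in> I 0 \<and> y \<in> I 0"
    and z: "z \<in> lat g" "z $ 3 = 1" "z $ 4 = 0"
  shows "\<exists>j \<in> J_b \<epsilon> \<sigma>. \<exists>x. lat g = translate j (lam x)"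
proof -
  note M = submod_lat[of g]
  have \<Phi>M: "\<Phi> z \<in> lat g" if "z \<in> lat g" for z using D that by (simp add: dieudonne_def)
  have "sympl_form z (\<Phi> z) \<in> I 0" using lat_form[OF c(1) z(1) \<Phi>M[OF z(1)]] c(2) by simp
  then have "z $ 1 - \<sigma> (z $ 1) \<in> I 0" by (simp add: sympl_form_def z)
  then obtain \<alpha> where \<alpha>: "\<sigma> \<alpha> = \<alpha>" "z $ 1 - \<alpha> \<in> I 0" using \<sigma>_fixed_approximation by blast
  define \<beta> where "\<beta> = z $ 2"
  define w where "w = z - vector [z $ 1 - \<alpha>, 0, 0, 0]"
  have w_nth: "w $ 1 = \<alpha>" "w $ 2 = \<beta>" "w $ 3 = 1" "w $ 4 = 0" by (simp_all add: w_def z \<beta>_def)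
  have w: "w \<in> lat g" unfolding w_def using z(1) e \<alpha>(2) by (intro submod_diff[OF M]) auto
  obtain u where u: "u \<in> lat g" "\<Phi> u = \<epsilon> *s w" using D w unfolding dieudonne_def by blast
  have "\<Phi> u $ i = \<epsilon> * w $ i" for i by (simp add: u(2))
  from this[of 1] this[of 2] this[of 3] this[of 4]
  have u_nth: "\<sigma> (u $ 2) = \<alpha>" "\<sigma> (u $ 1) = \<epsilon> * \<beta>" "\<sigma> (u $ 4) = 1" "u $ 3 = 0"
    by (simp_all add: w_nth)
  then have "u $ 2 = \<alpha>" "u $ 4 = 1" using \<alpha>(1) \<sigma>_eq_iff \<sigma>_1 by metis+
  \<comment> \<open>Here u is Vw; it agrees with \<Phi>w in the last three coordinates, so the
    difference is a multiple of e_1 in the lattice. Applying \<sigma> then gives the condition on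
    \<epsilon>\<beta>.\<close>
  then have "\<Phi> w - u = vector [\<epsilon> * \<sigma> \<beta> - u $ 1, 0, 0, 0]"
    by (simp add: vec4_eq_iff w_nth u_nth \<alpha>(1))
  then have "\<epsilon> * \<sigma> \<beta> - u $ 1 \<in> I 0" using submod_diff[OF M \<Phi>M[OF w] u(1)] e by simp
  then have "\<sigma> (\<epsilon> * \<sigma> \<beta> - u $ 1) \<in> I 0" by simp
  then have "\<epsilon> * \<beta> - \<sigma> (\<sigma> (\<epsilon> * \<beta>)) \<in> I 0"
    unfolding I_diff_commute[of "\<epsilon> * \<beta>"] by (simp add: \<sigma>_diff \<sigma>_mult u_nth)
  then obtain y where y: "\<sigma> (\<sigma> y) = y" "\<epsilon> * \<beta> - y \<in> I 0" using \<sigma>_\<sigma>_fixed_approximation by blast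
  \<comment> \<open>The digit of \<epsilon>\<beta> that the fixed element y leaves
    undetermined.\<close>
  define x where "x = res (\<epsilon> * \<beta> - y)"
  define G :: "'l ^ 4" where "G = vector [\<alpha>, y / \<epsilon>, 1, 0]"
  define E :: "'l ^ 4" where "E = axis 1 1"
  \<comment> \<open>The roles of e and f are exchanged: j must send f_0 to a multiple of e_2, the
    direction of the undetermined digit. This is why its multiplier is -1.\<close>
  define j where "j = cols G (\<Phi> G) E (\<Phi> E)"
  have fixed: "\<sigma> (\<sigma> (G $ i)) = G $ i" "\<sigma> (\<sigma> (E $ i)) = E $ i" for i
    using exhaust_4[of i]
    by (auto simp: G_def E_def axis_def \<sigma>_divide \<alpha>(1) y(1))
  have "j \<in> J_b \<epsilon> \<sigma>" "simil j (- 1)" unfolding j_def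
    by (rule J_cols[OF fixed]; simp add: G_def E_def sympl_form_def axis_def \<alpha>(1))+
  moreover have "translate j (lam x) = lat g"
  proof -
    have j1: "j ** lam_mat x = cols (G + (teich x / \<epsilon>) *s \<Phi> E) (\<Phi> G) E (\<Phi> E)"
      unfolding j_def lam_mat_def
      by (rule matrix_eq_on_vectors)
        (simp add: cols_mult axis_def vec4_eq_iff algebra_simps flip: matrix_vector_mul_assoc)
    have diff: "\<beta> - y / \<epsilon> - teich x / \<epsilon> \<in> I 0"
    proof -
      have "\<epsilon> * \<beta> - y - teich x \<in> I 1"
        using y(2) teich_integral by (subst res_eq_iff[symmetric]) (simp_all add: x_def res_teich)
      moreover have "\<epsilon> * \<beta> - y - teich x = \<epsilon> * (\<beta> - y / \<epsilon> - teich x / \<epsilon>)" by (simp add: algebra_simps)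
      ultimately show ?thesis by (simp add: I_eps_mult_iff)
    qed
    have "lat (j ** lam_mat x) \<subseteq> lat g" unfolding j1
    proof (rule lat_cols_subset[OF M])
      have "G + (teich x / \<epsilon>) *s \<Phi> E = w - vector [0, \<beta> - y / \<epsilon> - teich x / \<epsilon>, 0, 0]"
        by (simp add: vec4_eq_iff w_nth G_def E_def axis_def)
      then show "G + (teich x / \<epsilon>) *s \<Phi> E \<in> lat g" using w e diff by (auto intro: submod_diff[OF M])
      have "\<Phi> G = \<Phi> w - vector [\<sigma> (\<epsilon> * \<beta> - y), 0, 0, 0]"
        by (simp add: vec4_eq_iff w_nth G_def \<sigma>_mult \<sigma>_diff \<sigma>_divide)
      moreover have "vector [\<sigma> (\<epsilon> * \<beta> - y), 0, 0, 0] \<in> lat g" unfolding e using y(2) by simp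
      ultimately show "\<Phi> G \<in> lat g" using \<Phi>M[OF w] by (auto intro: submod_diff[OF M])
      have "E = vector [1, 0, 0, 0]" by (simp add: E_def vec4_eq_iff axis_def)
      then show "E \<in> lat g" using e by simp
      then show "\<Phi> E \<in> lat g" by (rule \<Phi>M)
    qed
    moreover have "simil (j ** lam_mat x) (- 1 * 1)" using \<open>simil j (- 1)\<close> simil_lam_mat by (rule simil_mult)
    ultimately have "lat (j ** lam_mat x) = lat g"
      using c by (intro lat_eqI[of _ _ "- 1 * 1" c]) (simp_all add: v_minus v_one)
    then show ?thesis by (simp add: lat_mult lat_lam_mat)
  qed
  ultimately show ?thesis by metis
qed

text \<open>It remains to normalize the two chain members. As n and m have equal parity, an element
  of J_b(F) can shift both chains to level 0 at once: a diagonal one in the even case, one that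
  interchanges odd and even indices in the odd case.\<close>

lemma classification:
  assumes g: "g \<in> GSp4" and D: "dieudonne (lat g)"
  shows "\<exists>j \<in> J_b \<epsilon> \<sigma>. \<exists>x. lat g = translate j (lam x)"
proof -
  obtain c where c: "simil g c" using g by (rule GSp4_similE)
  obtain n m where nm: "n + m = 2 * v c"
    "\<And>x y. vector [x, y, 0, 0] \<in> lat g \<longleftrightarrow> (x, y) \<in> fil n"
    "\<And>x y. (\<exists>z\<in>lat g. z $ 3 = x \<and> z $ 4 = y) \<longleftrightarrow> (x, y) \<in> fil m"
    using iwasawa[OF c D] by metis
  have reduce: ?thesis
    if j: "j \<in> J_b \<epsilon> \<sigma>" "simil j s" "v s = v c"
      and e: "\<And>x y. j *v vector [x, y, 0, 0] \<in> lat g \<longleftrightarrow> x \<in> I 0 \<and> y \<in> I 0"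
      and z: "j *v z \<in> lat g" "z $ 3 = 1" "z $ 4 = 0" for j s z
  proof -
    note jG = J_GSp4[OF j(1)]
    define h where "h = matrix_inv j ** g"
    have mem: "x \<in> lat h \<longleftrightarrow> j *v x \<in> lat g" for x
    proof -
      have "x \<in> lat h \<longleftrightarrow> x \<in> translate (matrix_inv j) (lat g)" by (simp add: h_def lat_mult)
      also have "\<dots> \<longleftrightarrow> j *v x \<in> lat g"
        using mem_translate_iff[OF jG, of "j *v x" "translate (matrix_inv j) (lat g)"]
        by (simp add: translate_inv[OF jG] matrix_inv_apply[OF GSp4_invertible[OF jG]])
      finally show ?thesis .
    qed
    have "simil h (inverse s * c)" unfolding h_def by (rule simil_mult[OF simil_inv[OF j(2)] c])
    moreover have "v (inverse s * c) = 0"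
      using j(3) simil_nonzero[OF j(2)] simil_nonzero[OF c] by (simp add: v_mult v_inverse)
    moreover have "dieudonne (lat h)"
      unfolding h_def lat_mult by (rule dieudonne_translate[OF J_inv[OF j(1)] D])
    ultimately obtain i x where "i \<in> J_b \<epsilon> \<sigma>" "lat h = translate i (lam x)"
      using classification_normalized[of h "inverse s * c" z] mem e z by blast
    moreover have "lat g = translate j (lat h)" by (simp add: h_def lat_mult translate_inv[OF jG])
    ultimately have "j ** i \<in> J_b \<epsilon> \<sigma>" "lat g = translate (j ** i) (lam x)"
      using J_mult[OF j(1)] by (simp_all add: translate_mult)
    then show ?thesis by blast
  qed
  obtain i where "n = 2 * i \<or> n = 2 * i + 1" by (metis evenE oddE)
  then show ?thesis
  proof
    assume n: "n = 2 * i"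
    define k where "k = v c - i"
    have m: "m = 2 * k" using nm(1) n by (simp add: k_def)
    define a :: "'l ^ 4" where "a = axis 1 (\<epsilon> powi i)"
    define d :: "'l ^ 4" where "d = axis 3 (\<epsilon> powi k)"
    define j where "j = cols a (\<Phi> a) d (\<Phi> d)"
    have jz: "j *v z = vector [\<epsilon> powi i * z $ 1, \<epsilon> powi i * z $ 2, \<epsilon> powi k * z $ 3, \<epsilon> powi k * z $ 4]" for z
      by (simp add: j_def cols_mult vec4_eq_iff a_def d_def axis_def)
    have fixed: "\<sigma> (\<sigma> (a $ i)) = a $ i" "\<sigma> (\<sigma> (d $ i)) = d $ i" for i
      by (simp_all add: a_def d_def axis_def)
    have ik: "\<epsilon> powi i * \<epsilon> powi k = \<epsilon> powi (v c)" by (simp add: k_def flip: power_int_add)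
    have "j \<in> J_b \<epsilon> \<sigma>" "simil j (\<epsilon> powi (v c))" unfolding j_def
      by (rule J_cols[OF fixed]; simp add: a_def d_def sympl_form_def axis_def ik)+
    moreover have "j *v vector [x, y, 0, 0] \<in> lat g \<longleftrightarrow> x \<in> I 0 \<and> y \<in> I 0" for x y
      by (simp add: jz nm(2) n fil_even I_powi_mult_iff)
    moreover have "\<exists>z. j *v z \<in> lat g \<and> z $ 3 = 1 \<and> z $ 4 = 0"
    proof -
      have "(\<epsilon> powi k, 0) \<in> fil m" by (simp add: m fil_even eps_powi_I)
      then obtain w where w: "w \<in> lat g" "w $ 3 = \<epsilon> powi k" "w $ 4 = 0" using nm(3) by metis
      then have "j *v vector [\<epsilon> powi (- i) * w $ 1, \<epsilon> powi (- i) * w $ 2, 1, 0] = w"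
        by (simp add: jz vec4_eq_iff power_int_minus)
      then show ?thesis using w(1) by (intro exI[of _ "vector [\<epsilon> powi (- i) * w $ 1, \<epsilon> powi (- i) * w $ 2, 1, 0]"]) simp
    qed
    ultimately show ?thesis using reduce v_eps_powi by metis
  next
    assume n: "n = 2 * i + 1"
    \<comment> \<open>In the odd case \<Phi> contributes one factor \<epsilon> to the pairing of the
      columns, whence the extra -1.\<close>
    define k where "k = v c - i - 1"
    have m: "m = 2 * k + 1" using nm(1) n by (simp add: k_def)
    define a :: "'l ^ 4" where "a = axis 2 (\<epsilon> powi i)"
    define d :: "'l ^ 4" where "d = axis 4 (\<epsilon> powi k)"
    define j where "j = cols a (\<Phi> a) d (\<Phi> d)"
    have jz: "j *v z = vector [\<epsilon> * (\<epsilon> powi i * z $ 2), \<epsilon> powi i * z $ 1, \<epsilon> * (\<epsilon> powi k * z $ 4), \<epsilon> powi k * z $ 3]" for z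
      by (simp add: j_def cols_mult vec4_eq_iff a_def d_def axis_def)
    have fixed: "\<sigma> (\<sigma> (a $ i)) = a $ i" "\<sigma> (\<sigma> (d $ i)) = d $ i" for i
      by (simp_all add: a_def d_def axis_def)
    have "\<epsilon> powi i * \<epsilon> powi (k + 1) = \<epsilon> powi (v c)" by (simp add: k_def flip: power_int_add)
    then have ik: "\<epsilon> * (\<epsilon> powi i * \<epsilon> powi k) = \<epsilon> powi (v c)" by (simp add: power_int_add mult_ac)
    have "j \<in> J_b \<epsilon> \<sigma>" "simil j (\<epsilon> powi (v c))" unfolding j_def
      by (rule J_cols[OF fixed]; simp add: a_def d_def sympl_form_def axis_def mult_ac flip: ik)+
    moreover have "j *v vector [x, y, 0, 0] \<in> lat g \<longleftrightarrow> x \<in> I 0 \<and> y \<in> I 0" for x y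
      by (auto simp: jz nm(2) n fil_odd I_powi_mult_iff I_eps_mult_iff)
    moreover have "\<exists>z. j *v z \<in> lat g \<and> z $ 3 = 1 \<and> z $ 4 = 0"
    proof -
      have "(0, \<epsilon> powi k) \<in> fil m" by (simp add: m fil_odd eps_powi_I)
      then obtain w where w: "w \<in> lat g" "w $ 3 = 0" "w $ 4 = \<epsilon> powi k" using nm(3) by metis
      then have "j *v vector [\<epsilon> powi (- i) * w $ 2, \<epsilon> powi (- i) * (w $ 1 / \<epsilon>), 1, 0] = w"
        by (simp add: jz vec4_eq_iff power_int_minus)
      then show ?thesis using w(1)
        by (intro exI[of _ "vector [\<epsilon> powi (- i) * w $ 2, \<epsilon> powi (- i) * (w $ 1 / \<epsilon>), 1, 0]"]) simp
    qed
    ultimately show ?thesis using reduce v_eps_powi by metis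
  qed
qed

end

subsection \<open>Relative positions within a stratum\<close>

definition transvection :: "'l::field \<Rightarrow> 'l ^ 4 \<Rightarrow> 'l ^ 4 ^ 4" where
  "transvection c u = cols
     (axis 1 1 + (c * u $ 4) *s u) (axis 2 1 + (c * u $ 3) *s u)
     (axis 3 1 - (c * u $ 2) *s u) (axis 4 1 - (c * u $ 1) *s u)"

lemma transvection_apply: "transvection c u *v z = z + (c * sympl_form z u) *s u"
  by (simp add: transvection_def cols_mult vec4_eq_iff axis_def sympl_form_def algebra_simps)

lemma simil_transvection:
  fixes u :: "'l::field ^ 4"
  shows "simil (transvection c u) 1"
proof -
  have "sympl_form u x = - sympl_form x u" for x :: "'l ^ 4" by (rule sympl_form_commute)
  then have "sympl_form (transvection c u *v x) (transvection c u *v y) = sympl_form x y" for x y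
    by (simp add: transvection_apply sympl_form_linear algebra_simps)
  then show ?thesis by (simp add: simil_def)
qed

context completed_unramified_extension
begin

lemma dieudonne_lat_J: "i \<in> J_b \<epsilon> \<sigma> \<Longrightarrow> dieudonne (lat i)"
  by (rule dieudonne_translate[OF _ dieudonne_cube])

text \<open>For \<open>n = - ((v c + 1) div 2)\<close> the lattice \<open>\<epsilon>\<^sup>n i\<Lambda>\<^sub>0\<close> lies between its dual and \<open>\<epsilon>\<^sup>-\<^sup>1\<close> times
  its dual, so a transvection along one of its vectors with a coefficient divisible by \<open>\<epsilon>\<close>
  fixes it.\<close>
lemma ex_transvection_vector:
  assumes i: "i \<in> J_b \<epsilon> \<sigma>" and c: "simil i c"
  shows "\<exists>u. \<epsilon> powi ((v c + 1) div 2) *s u \<in> lat i \<and>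
    u $ 1 \<in> I 0 \<and> u $ 2 \<in> I 0 \<and> u $ 3 \<in> I 0 \<and> \<epsilon> * u $ 4 \<in> I 0 \<and> (u $ 1 \<notin> I 1 \<or> \<epsilon> * u $ 4 \<notin> I 1)"
proof -
  \<comment> \<open>Half of \<open>v c\<close>, rounded up: the scale at which \<epsilon><z,u>u
    stays in the lattice for all of its vectors z.\<close>
  define N where "N = (v c + 1) div 2"
  define D where "D = {z. \<epsilon> powi N *s z \<in> lat i}"
  have D: "z \<in> D \<longleftrightarrow> \<epsilon> powi N *s z \<in> lat i" for z by (simp add: D_def)
  have D_scale: "a *s z \<in> D" if "a \<in> I 0" "z \<in> D" for a z
    using submod_scale[OF submod_lat that(1), of "\<epsilon> powi N *s z" i] that(2) by (simp add: D mult.commute)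
  have D_\<Phi>: "\<Phi> z \<in> D" if "z \<in> D" for z
    using that dieudonne_lat_J[OF i] \<Phi>_scale[of "\<epsilon> powi N" z] by (auto simp: D dieudonne_def)
  obtain n m where nm: "n + m = 2 * v c"
    "\<And>x y. vector [x, y, 0, 0] \<in> lat i \<longleftrightarrow> (x, y) \<in> fil n"
    "\<And>x y. (\<exists>z\<in>lat i. z $ 3 = x \<and> z $ 4 = y) \<longleftrightarrow> (x, y) \<in> fil m"
    using iwasawa[OF c dieudonne_lat_J[OF i]] by metis
  have one: "1 \<notin> I 1" by (simp add: I_nonzero v_one)
  have "\<exists>u\<in>D. u $ 1 \<in> I 0 \<and> u $ 2 \<in> I 0 \<and> u $ 3 \<in> I 0 \<and> \<epsilon> * u $ 4 \<in> I 0 \<and>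
    (u $ 1 \<notin> I 1 \<or> \<epsilon> * u $ 4 \<notin> I 1)"
  proof (cases "n \<le> 2 * N")
    case True
    then have "(n + 1) div 2 \<le> N" by presburger
    then have "vector [\<epsilon> powi N, 0, 0, 0] \<in> lat i" by (simp add: nm(2) fil_iff eps_powi_I)
    moreover have "vector [\<epsilon> powi N, 0, 0, 0] = \<epsilon> powi N *s (vector [1, 0, 0, 0] :: 'l ^ 4)"
      by (simp add: vec4_eq_iff)
    ultimately have "vector [1, 0, 0, 0] \<in> D" by (simp add: D)
    then show ?thesis using one by (intro bexI[of _ "vector [1, 0, 0, 0]"]) simp_all
  next
    case False
    then have "m div 2 \<le> N - 1" using nm(1) unfolding N_def by presburger
    then have "(0, \<epsilon> powi (N - 1)) \<in> fil m" by (simp add: fil_iff eps_powi_I)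
    then obtain w where w: "w \<in> lat i" "w $ 3 = 0" "w $ 4 = \<epsilon> powi (N - 1)" using nm(3) by metis
    define z where "z = \<epsilon> powi (- N) *s w"
    have "\<epsilon> powi N *s z = w" unfolding z_def by (rule scale_powi_cancel)
    then have z: "z \<in> D" using w(1) by (simp add: D)
    have "\<epsilon> powi N * z $ 4 = \<epsilon> powi N / \<epsilon>"
      using w(3) \<open>\<epsilon> powi N *s z = w\<close> by (metis eps_nonzero power_int_diff power_int_1_right vector_smult_component)
    then have z34: "z $ 3 = 0" "z $ 4 = 1 / \<epsilon>" by (simp_all add: z_def w(2) divide_inverse)
    \<comment> \<open>Large coordinates of z along e_1, e_2 are scaled away. If the first one
      dominates, scaling makes it a unit; if the second one strictly dominates, \<Phi> first moves
      it to the first place; if neither is large, f_0 itself supplies the unit.\<close>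
    consider "z $ 1 \<in> I 0" "z $ 2 \<in> I 0"
      | a where "z $ 1 \<noteq> 0" "v (z $ 1) = - a" "0 \<le> a" "z $ 2 \<in> I (- a)"
      | b where "z $ 2 \<noteq> 0" "v (z $ 2) = - b" "1 \<le> b" "z $ 1 \<in> I (1 - b)"
    proof (cases "z $ 1 \<in> I 0 \<and> z $ 2 \<in> I 0")
      case notint: False
      show ?thesis
      proof (cases "z $ 1 \<noteq> 0 \<and> z $ 2 \<in> I (v (z $ 1))")
        case True
        then show ?thesis using notint that(1) that(2)[of "- v (z $ 1)"] I_mono[of "z $ 2" "v (z $ 1)" 0]
          by (auto simp: I_nonzero)
      next
        case False
        then have "z $ 2 \<noteq> 0" using notint by (auto simp: frac_ideal_def)
        moreover have "z $ 1 \<in> I (v (z $ 2) + 1)" using False by (auto simp: frac_ideal_def)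
        moreover have "v (z $ 2) < 0"
          using notint calculation I_mono[of "z $ 1" "v (z $ 2) + 1" 0]
          by (cases "0 \<le> v (z $ 2) + 1") (auto simp: I_nonzero)
        ultimately show ?thesis using that(3)[of "- v (z $ 2)"] by (simp add: add.commute)
      qed
    qed (use that in blast)
    then show ?thesis
    proof cases
      case 1
      then show ?thesis using z z34 one by (intro bexI[of _ z]) auto
    next
      case 2
      have "\<epsilon> powi a *s z \<in> D" using z 2(3) by (intro D_scale) (simp_all add: eps_powi_I)
      then show ?thesis using 2 z34
        by (intro bexI[of _ "\<epsilon> powi a *s z"]) (auto simp: I_powi_mult_iff I_nonzero eps_powi_I)
    next
      case 3
      have "\<epsilon> powi (b - 1) *s \<Phi> z \<in> D" using z 3(3) by (intro D_scale D_\<Phi>) (simp_all only: eps_powi_I)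
      moreover have "\<epsilon> * \<sigma> (z $ 2) \<in> I n \<longleftrightarrow> n \<le> 1 - b" for n
        using 3(1,2) by (auto simp: I_eps_mult_iff I_nonzero)
      ultimately show ?thesis using 3 z34
        by (intro bexI[of _ "\<epsilon> powi (b - 1) *s \<Phi> z"]) (auto simp: I_powi_mult_iff \<sigma>_divide eps_powi_I)
    qed
  qed
  then show ?thesis by (auto simp: D N_def)
qed

text \<open>The line spanned by the image of \<open>u\<close> in \<open>P\<^sup>\<or>/P\<close> can be chosen rational over
  the quadratic extension of the residue field of \<open>F\<close>, where \<open>P\<close> is the intersection of the \<open>\<Lambda>\<^sub>x\<close>
  and of \<open>\<Lambda>\<^sub>0\<close>.\<close>
lemma ex_rational_transvection_vector:
  assumes i: "i \<in> J_b \<epsilon> \<sigma>" and c: "simil i c"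
  shows "\<exists>u. \<epsilon> powi ((v c + 1) div 2) *s u \<in> lat i \<and>
    u $ 1 \<in> I 0 \<and> u $ 2 \<in> I 0 \<and> u $ 3 \<in> I 0 \<and> \<epsilon> * u $ 4 \<in> I 0 \<and>
    (res (u $ 1) \<noteq> 0 \<or> res (\<epsilon> * u $ 4) \<noteq> 0) \<and>
    res (u $ 1) ^ CARD('k) ^ 2 * res (\<epsilon> * u $ 4) = res (u $ 1) * res (\<epsilon> * u $ 4) ^ CARD('k) ^ 2"
proof -
  let ?N = "(v c + 1) div 2"
  obtain u where u: "\<epsilon> powi ?N *s u \<in> lat i" "u $ 1 \<in> I 0" "u $ 2 \<in> I 0" "u $ 3 \<in> I 0" "\<epsilon> * u $ 4 \<in> I 0"
    "u $ 1 \<notin> I 1 \<or> \<epsilon> * u $ 4 \<notin> I 1"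
    using ex_transvection_vector[OF assms] by blast
  let ?\<alpha> = "res (u $ 1)" and ?\<beta> = "res (\<epsilon> * u $ 4)"
  have ne: "?\<alpha> \<noteq> 0 \<or> ?\<beta> \<noteq> 0" using u res_0_iff by blast
  show ?thesis
  proof (cases "?\<alpha> ^ CARD('k) ^ 2 * ?\<beta> = ?\<alpha> * ?\<beta> ^ CARD('k) ^ 2")
    case True
    then show ?thesis using u ne by blast
  next
    case False
    \<comment> \<open>This combination has first coordinate 0, so its line in P^\<or>/P is the
      rational point at infinity. Its other residue is nonzero precisely because the line of u fails
      to be rational.\<close>
    define w where "w = u $ 1 *s (\<chi> i. \<sigma> (\<sigma> (u $ i))) - \<sigma> (\<sigma> (u $ 1)) *s u"
    have "(\<chi> k. \<sigma> (\<sigma> ((\<epsilon> powi ?N *s u) $ k))) \<in> lat i" by (rule J_lat_\<sigma>_\<sigma>[OF i u(1)])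
    moreover have "(\<chi> k. \<sigma> (\<sigma> ((\<epsilon> powi ?N *s u) $ k))) = \<epsilon> powi ?N *s (\<chi> k. \<sigma> (\<sigma> (u $ k)))"
      by (simp add: vec_eq_iff \<sigma>_mult)
    ultimately have "\<epsilon> powi ?N *s (\<chi> k. \<sigma> (\<sigma> (u $ k))) \<in> lat i" by simp
    from submod_scale[OF submod_lat u(2) this] submod_scale[OF submod_lat _ u(1), of "\<sigma> (\<sigma> (u $ 1))"] u(2)
    have "u $ 1 *s (\<epsilon> powi ?N *s (\<chi> k. \<sigma> (\<sigma> (u $ k)))) - \<sigma> (\<sigma> (u $ 1)) *s (\<epsilon> powi ?N *s u) \<in> lat i"
      by (intro submod_diff[OF submod_lat]) simp_all
    moreover have "u $ 1 *s (\<epsilon> powi ?N *s (\<chi> k. \<sigma> (\<sigma> (u $ k)))) - \<sigma> (\<sigma> (u $ 1)) *s (\<epsilon> powi ?N *s u) = \<epsilon> powi ?N *s w"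
      by (simp add: w_def vec_eq_iff algebra_simps)
    ultimately have w: "\<epsilon> powi ?N *s w \<in> lat i" by simp
    have w1: "w $ 1 = 0" and w23: "w $ 2 \<in> I 0" "w $ 3 \<in> I 0"
      using u(2-4) by (simp_all add: w_def I_diff I_mult_left)
    have w4: "\<epsilon> * w $ 4 = u $ 1 * \<sigma> (\<sigma> (\<epsilon> * u $ 4)) - \<sigma> (\<sigma> (u $ 1)) * (\<epsilon> * u $ 4)"
      by (simp add: w_def \<sigma>_mult algebra_simps)
    have "\<epsilon> * w $ 4 \<in> I 0" 
      unfolding w4 by (rule I_diff[OF I_mult_left[OF u(2)] I_mult_left[OF _ u(5)]]) (use u in simp_all)
    moreover have "res (\<epsilon> * w $ 4) = ?\<alpha> * ?\<beta> ^ CARD('k) ^ 2 - ?\<alpha> ^ CARD('k) ^ 2 * ?\<beta>"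
      unfolding w4 using u(2,5) res_\<sigma>_\<sigma>[OF u(2)] res_\<sigma>_\<sigma>[OF u(5)]
      by (subst res_diff) (simp_all add: I_mult_left res_mult)
    ultimately show ?thesis using w w1 w23 False by (intro exI[of _ w]) auto
  qed
qed

text \<open>The transvection along u with coefficient \<epsilon>[\<gamma>] induces on P^\<or>/P a
  transvection along the residue of u, and it preserves i Lambda_0 by the choice of scale.\<close>

lemma transitive_on_stratum:
  assumes i: "i \<in> J_b \<epsilon> \<sigma>" and x: "x ^ CARD('k) ^ 2 \<noteq> x" and y: "y ^ CARD('k) ^ 2 \<noteq> y"
  shows "\<exists>T \<in> GSp4. lat (T ** i) = lat i \<and> translate T (lam x) = lam y"
proof -
  obtain c where c: "simil i c" using J_GSp4[OF i] by (rule GSp4_similE)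
  define N where "N = (v c + 1) div 2"
  obtain u where u: "\<epsilon> powi N *s u \<in> lat i"
    and uI: "u $ 1 \<in> I 0" "u $ 2 \<in> I 0" "u $ 3 \<in> I 0" "\<epsilon> * u $ 4 \<in> I 0"
    and u_ne: "res (u $ 1) \<noteq> 0 \<or> res (\<epsilon> * u $ 4) \<noteq> 0"
    and u_rat: "res (u $ 1) ^ CARD('k) ^ 2 * res (\<epsilon> * u $ 4) = res (u $ 1) * res (\<epsilon> * u $ 4) ^ CARD('k) ^ 2"
    using ex_rational_transvection_vector[OF i c] unfolding N_def by blast
  define \<alpha> where "\<alpha> = res (u $ 1)"
  define \<beta> where "\<beta> = res (\<epsilon> * u $ 4)"
  \<comment> \<open>Vanishing would make t the slope of the rational line of u.\<close>
  have slope: "\<beta> - t * \<alpha> \<noteq> 0" if t: "t ^ CARD('k) ^ 2 \<noteq> t" for t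
  proof
    assume "\<beta> - t * \<alpha> = 0"
    then have "\<beta> = t * \<alpha>" by simp
    moreover from this have "\<alpha> \<noteq> 0" using u_ne by (auto simp: \<alpha>_def \<beta>_def)
    ultimately have "t ^ CARD('k) ^ 2 = t" using u_rat
      by (simp flip: \<alpha>_def \<beta>_def add: power_mult_distrib)
    with t show False by simp
  qed
  \<comment> \<open>The line spanned by (1, x) is sent to the one spanned by (1, x) +
    \<gamma>(\<beta> - x\<alpha>)(\<alpha>, \<beta>); this is the value for which the slope becomes
    y.\<close>
  define \<gamma> where "\<gamma> = (y - x) / ((\<beta> - x * \<alpha>) * (\<beta> - y * \<alpha>))"
  define T where "T = transvection (\<epsilon> * teich \<gamma>) u"
  have T1: "simil T 1" by (simp add: T_def simil_transvection)
  have "lat (T ** i) \<subseteq> lat i"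
  proof -
    have "T *v z \<in> lat i" if z: "z \<in> lat i" for z
    proof -
      have f: "sympl_form z (\<epsilon> powi N *s u) \<in> I (v c)" by (rule lat_form[OF c z u])
      \<comment> \<open>The coefficient rewritten for the lattice vector \<epsilon>^N u. Its
        valuation is at least 1 + v c - 2N, which is nonnegative because of the rounding in
        N.\<close>
      define s where "s = \<epsilon> * teich \<gamma> * (\<epsilon> powi (- (2 * N)) * sympl_form z (\<epsilon> powi N *s u))"
      have "\<epsilon> * teich \<gamma> \<in> I 1" using teich_integral by (simp add: I_eps_mult_iff)
      moreover have "\<epsilon> powi (- (2 * N)) * sympl_form z (\<epsilon> powi N *s u) \<in> I (v c - 2 * N)"
        using f by (simp add: I_powi_mult_iff del: power_int_minus)
      ultimately have "s \<in> I (1 + (v c - 2 * N))" unfolding s_def by (rule I_mult) simp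
      then have "s \<in> I 0" by (rule I_mono) (unfold N_def, presburger)
      then have "z + s *s (\<epsilon> powi N *s u) \<in> lat i"
        by (rule submod_add[OF submod_lat z submod_scale[OF submod_lat _ u]])
      moreover have "s *s (\<epsilon> powi N *s u) = (\<epsilon> * teich \<gamma> * sympl_form z u) *s u"
      proof -
        have "\<epsilon> powi (- (2 * N)) * (\<epsilon> powi N * \<epsilon> powi N) = 1"
          by (simp add: power_int_minus flip: power_int_add)
        then have "s * \<epsilon> powi N = \<epsilon> * teich \<gamma> * sympl_form z u"
          by (simp add: s_def sympl_form_scale_right mult_ac del: power_int_minus)
        then show ?thesis by simp
      qed
      ultimately show ?thesis by (simp only: T_def transvection_apply)
    qed
    then show ?thesis unfolding lat_mult by (auto simp: translate_def[of T])
  qed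
  then have Ti: "lat (T ** i) = lat i" using simil_mult[OF T1 c] c by (rule lat_eqI) simp
  have "lat (T ** lam_mat x) \<subseteq> lam y"
  proof -
    have "T *v z \<in> lam y" if z: "z \<in> lam x" for z
    proof -
      define \<zeta> where "\<zeta> = res (z $ 1)"
      have zI: "z $ 1 \<in> I 0" "z $ 2 \<in> I 0" "z $ 3 \<in> I 0" "\<epsilon> * z $ 4 \<in> I 0" "res (\<epsilon> * z $ 4) = x * \<zeta>"
        using z by (simp_all add: lam_def \<zeta>_def)
      have e: "\<epsilon> * (z $ 2 * u $ 3 - z $ 3 * u $ 2) \<in> I 1"
        using zI uI by (simp add: I_eps_mult_iff I_diff I_mult_left)
      have eq: "\<epsilon> * sympl_form z u = z $ 1 * (\<epsilon> * u $ 4) - \<epsilon> * z $ 4 * u $ 1 + \<epsilon> * (z $ 2 * u $ 3 - z $ 3 * u $ 2)"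
        by (simp add: sympl_form_def algebra_simps)
      have main: "z $ 1 * (\<epsilon> * u $ 4) \<in> I 0" "\<epsilon> * z $ 4 * u $ 1 \<in> I 0" using zI uI by (simp_all add: I_mult_left)
      have form: "\<epsilon> * sympl_form z u \<in> I 0"
        unfolding eq using main I_mono[OF e] by (simp add: I_add I_diff)
      have res_form: "res (\<epsilon> * sympl_form z u) = \<zeta> * (\<beta> - x * \<alpha>)"
      proof -
        have "\<epsilon> * (z $ 2 * u $ 3 - z $ 3 * u $ 2) \<in> I 0" using I_mono[OF e] by simp
        moreover have "res (\<epsilon> * (z $ 2 * u $ 3 - z $ 3 * u $ 2)) = 0" using res_0_iff calculation e by blast
        ultimately have "res (\<epsilon> * sympl_form z u) = res (z $ 1 * (\<epsilon> * u $ 4)) - res (\<epsilon> * z $ 4 * u $ 1)"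
          unfolding eq using main by (simp only: res_add res_diff I_diff add_0_right)
        also have "res (z $ 1 * (\<epsilon> * u $ 4)) = \<zeta> * \<beta>"
          unfolding \<zeta>_def \<beta>_def by (rule res_mult[OF zI(1) uI(4)])
        also have "res (\<epsilon> * z $ 4 * u $ 1) = x * \<zeta> * \<alpha>"
          unfolding \<alpha>_def zI(5)[symmetric] by (rule res_mult[OF zI(4) uI(1)])
        finally show ?thesis by (simp add: algebra_simps)
      qed
      define \<kappa> where "\<kappa> = teich \<gamma> * (\<epsilon> * sympl_form z u)"
      have \<kappa>: "\<kappa> \<in> I 0" unfolding \<kappa>_def using teich_integral form by (rule I_mult_left)
      have res_\<kappa>: "res \<kappa> = \<gamma> * (\<zeta> * (\<beta> - x * \<alpha>))"
        unfolding \<kappa>_def using teich_integral form by (simp add: res_mult res_teich res_form)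
      have Tz: "T *v z = z + \<kappa> *s u" by (simp add: T_def transvection_apply \<kappa>_def mult_ac)
      have "\<gamma> * (\<beta> - x * \<alpha>) * (\<beta> - y * \<alpha>) = y - x"
        using slope[OF x] slope[OF y] by (simp add: \<gamma>_def)
      then have "res \<kappa> * (\<beta> - y * \<alpha>) = \<zeta> * (y - x)" unfolding res_\<kappa> by (metis mult.assoc mult.commute)
      then have "x * \<zeta> + res \<kappa> * \<beta> = y * (\<zeta> + res \<kappa> * \<alpha>)" by (simp add: algebra_simps)
      moreover have "\<epsilon> * (z + \<kappa> *s u) $ 4 = \<epsilon> * z $ 4 + \<kappa> * (\<epsilon> * u $ 4)" by (simp add: algebra_simps)
      ultimately show ?thesis unfolding Tz lam_def using zI uI \<kappa>
        by (simp add: I_add I_mult_left res_add res_mult flip: \<alpha>_def \<beta>_def \<zeta>_def)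
    qed
    then show ?thesis unfolding lat_mult lat_lam_mat by (auto simp: translate_def)
  qed
  then have "lat (T ** lam_mat x) = lam y"
    using lat_eqI[of "T ** lam_mat x" "lam_mat y" "1 * 1" 1] simil_mult[OF T1 simil_lam_mat] simil_lam_mat
    by (simp add: lat_lam_mat)
  then show ?thesis using Ti simil_GSp4[OF T1] by (auto simp: lat_mult lat_lam_mat)
qed

section \<open>Relative positions along a stratum\<close>

lemma double_coset_translate:
  assumes "\<xi> \<in> dominant_cochars" "t \<in> K_stab v \<epsilon>" "g' \<in> GSp4" "lat g' = translate t (lat g)"
    and "g \<in> double_coset v \<epsilon> \<xi>"
  shows "g' \<in> double_coset v \<epsilon> \<xi>"
proof -
  obtain k where "k \<in> K_stab v \<epsilon>" "lat g = lat (k ** cochar_at \<xi> \<epsilon>)"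
    using assms(1,5) double_coset_iff by blast
  then have "t ** k \<in> K_stab v \<epsilon>" "lat g' = lat (t ** k ** cochar_at \<xi> \<epsilon>)"
    using K_mult[OF assms(2)] by (simp_all add: assms(4) translate_mult)
  then show ?thesis using assms(1,3) double_coset_iff by blast
qed

lemma rel_inv_eqI:
  assumes "j \<in> GSp4" "g \<in> GSp4" "g' \<in> GSp4" "t \<in> K_stab v \<epsilon>"
    and "lat (matrix_inv j ** g') = translate t (lat (matrix_inv j ** g))"
  shows "rel_inv v \<epsilon> j g' = rel_inv v \<epsilon> j g"
proof -
  have "rel_inv v \<epsilon> j g \<in> dominant_cochars" "matrix_inv j ** g \<in> double_coset v \<epsilon> (rel_inv v \<epsilon> j g)"
    using rel_inv_eq_iff[OF assms(1,2)] by blast+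
  then show ?thesis
    using double_coset_translate[OF _ assms(4) _ assms(5)] rel_inv_eq_iff[OF assms(1,3)]
      GSp4_mult[OF GSp4_inv[OF assms(1)] assms(3)] by blast
qed

lemma rel_inv_cong:
  assumes "j \<in> GSp4" "g \<in> GSp4" "g' \<in> GSp4" "lat g = lat g'"
  shows "rel_inv v \<epsilon> j g = rel_inv v \<epsilon> j g'"
  using assms by (intro rel_inv_eqI[of _ _ _ "mat 1"]) (simp_all add: K_stab_iff GSp4_mat_1 lat_mult)

text \<open>Translation by the inverse of j reduces to i Lambda_0 against Lambda_x and Lambda_y. The
  similitude T fixes the former, so its conjugate by i lies in K.\<close>

lemma rel_inv_constant_on_stratum:
  assumes j: "j \<in> J_b \<epsilon> \<sigma>" and j': "j' \<in> J_b \<epsilon> \<sigma>" and g: "g \<in> GSp4" "g' \<in> GSp4"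
    and x: "x ^ CARD('k) ^ 2 \<noteq> x" "lat g = translate j (lam x)"
    and y: "y ^ CARD('k) ^ 2 \<noteq> y" "lat g' = translate j (lam y)"
  shows "rel_inv v \<epsilon> j' g' = rel_inv v \<epsilon> j' g"
proof -
  define i where "i = matrix_inv j ** j'"
  have i: "i \<in> J_b \<epsilon> \<sigma>" unfolding i_def by (rule J_mult[OF J_inv[OF j] j'])
  obtain T where T: "T \<in> GSp4" "lat (T ** i) = lat i" "translate T (lam x) = lam y"
    using transitive_on_stratum[OF i x(1) y(1)] by blast
  define t where "t = matrix_inv i ** T ** i"
  have tr_i: "translate (matrix_inv j') (translate j M) = translate (matrix_inv i) M" for M
  proof -
    have "translate i (translate (matrix_inv j') (translate j M)) = M"
      by (simp add: i_def translate_mult translate_inv J_GSp4 j j')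
    then show ?thesis using translate_inv(1)[OF J_GSp4[OF i]] by metis
  qed
  show ?thesis
  proof (rule rel_inv_eqI[OF J_GSp4[OF j'] g])
    have "lat t = translate (matrix_inv i) (lat (T ** i))" by (simp add: t_def translate_mult)
    also have "\<dots> = cube 0" unfolding T(2) by (rule translate_inv(1)[OF J_GSp4[OF i]])
    finally show "t \<in> K_stab v \<epsilon>"
      using J_GSp4[OF i] T(1) by (simp add: K_stab_iff t_def GSp4_mult GSp4_inv)
    have "translate t (lat (matrix_inv j' ** g)) = translate (matrix_inv i) (lam y)"
      by (simp add: t_def lat_mult x(2) tr_i translate_mult translate_inv(2)[OF J_GSp4[OF i]] T(3))
    then show "lat (matrix_inv j' ** g') = translate t (lat (matrix_inv j' ** g))"
      by (simp add: lat_mult y(2) tr_i)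
  qed
qed

end

subsection \<open>Recovering the stratum from the relative positions\<close>

context completed_unramified_extension
begin

lemma double_coset_cong:
  assumes "\<xi> \<in> dominant_cochars" "g' \<in> GSp4" "lat g' = lat g" "g \<in> double_coset v \<epsilon> \<xi>"
  shows "g' \<in> double_coset v \<epsilon> \<xi>"
  by (rule double_coset_translate[of \<xi> "mat 1" g' g]) (simp_all add: assms K_stab_iff GSp4_mat_1)

text \<open>This separates the one-point strata: f_g takes the value 0 exactly at those j with j
  Lambda_0 equal to g Lambda_0.\<close>

lemma rel_inv_0_iff:
  assumes "j \<in> GSp4" "g \<in> GSp4"
  shows "rel_inv v \<epsilon> j g = 0 \<longleftrightarrow> lat g = lat j"
proof -
  have dom: "0 \<in> dominant_cochars" by (simp add: dominant_cochars_def)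
  have "cochar_at 0 \<epsilon> = mat 1" by (simp add: cochar_at_def mat_def vec_eq_iff)
  then have "matrix_inv j ** g \<in> double_coset v \<epsilon> 0 \<longleftrightarrow>
      (\<exists>k\<in>K_stab v \<epsilon>. lat (matrix_inv j ** g) = lat k)"
    using GSp4_mult[OF GSp4_inv[OF assms(1)] assms(2)] by (simp add: double_coset_iff[OF dom])
  also have "\<dots> \<longleftrightarrow> lat (matrix_inv j ** g) = cube 0"
    using GSp4_mat_1 by (auto simp: K_stab_iff intro!: bexI[of _ "mat 1"])
  also have "\<dots> \<longleftrightarrow> lat g = lat j"
    using translate_inv[OF assms(1)] by (metis lat_mult)
  finally show ?thesis using rel_inv_eq_iff[OF assms] dom by simp
qed

section \<open>The relative position (1, 0, 0, -1) and the lattice P\<close>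

definition \<xi>\<^sub>1 :: "int ^ 4" where "\<xi>\<^sub>1 = vector [1, 0, 0, -1]"

lemma \<xi>\<^sub>1_dominant: "\<xi>\<^sub>1 \<in> dominant_cochars"
  by (simp add: \<xi>\<^sub>1_def dominant_cochars_def)

lemma mem_lat_\<xi>\<^sub>1:
  "z \<in> lat (cochar_at \<xi>\<^sub>1 \<epsilon>) \<longleftrightarrow> z $ 1 \<in> I 1 \<and> z $ 2 \<in> I 0 \<and> z $ 3 \<in> I 0 \<and> z $ 4 \<in> I (-1)"
  by (simp add: mem_lat_cochar forall_4 \<xi>\<^sub>1_def)

lemma lam_mat_position:
  assumes "x \<noteq> 0"
  shows "lam_mat x \<in> double_coset v \<epsilon> \<xi>\<^sub>1"
proof -
  define t where "t = teich x"
  have tI: "t \<in> I 0" "res t = x" by (simp_all add: t_def teich_integral res_teich)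
  then have t: "t \<noteq> 0" "v t = 0" using res_nonzero_inverse[of t] assms by auto
  \<comment> \<open>The last column is \<epsilon>(e_1 + [x] f_0), a primitive vector as [x] is a
    unit; the first column is the multiple of e_1 that pairs to 1 with it.\<close>
  define k where "k = cols (axis 1 (1 / t)) (axis 2 1) (axis 3 1) (vector [\<epsilon>, 0, 0, t])"
  have k1: "simil k 1" unfolding k_def
    by (rule simil_cols) (simp_all add: sympl_form_def axis_def t(1))
  have "k \<in> K_stab v \<epsilon>"
  proof (rule K_I[OF k1 v_one])
    show "lat k \<subseteq> cube 0" unfolding k_def
      by (rule lat_cols_subset[OF submod_cube])
        (use t tI I_mono[OF eps_I] in \<open>simp_all add: cube_iff axis_def I_nonzero v_inverse divide_inverse\<close>)
  qed
  moreover have "lat (k ** cochar_at \<xi>\<^sub>1 \<epsilon>) = lam x"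
  proof -
    have eq: "k ** cochar_at \<xi>\<^sub>1 \<epsilon> = cols (axis 1 (\<epsilon> / t)) (axis 2 1) (axis 3 1) (vector [1, 0, 0, t / \<epsilon>])"
      by (rule matrix_eq_on_vectors)
        (simp add: k_def cols_mult cochar_at_apply \<xi>\<^sub>1_def axis_def vec4_eq_iff power_int_minus divide_inverse
          flip: matrix_vector_mul_assoc)
    have "\<epsilon> / t \<in> I 1" using t by (simp add: I_divide_iff)
    then have e: "\<epsilon> / t \<in> I 0" "res (\<epsilon> / t) = 0" using I_mono res_0_iff by auto
    have e': "\<epsilon> \<in> I 0" "res \<epsilon> = 0" using I_mono[OF eps_I] res_0_iff[of \<epsilon>] by simp_all
    have "lat (k ** cochar_at \<xi>\<^sub>1 \<epsilon>) \<subseteq> lam x" unfolding eq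
      by (rule lat_cols_subset[OF submod_lam])
        (use e e' tI in \<open>simp_all add: lam_def axis_def res_one\<close>)
    moreover have "simil (k ** cochar_at \<xi>\<^sub>1 \<epsilon>) (1 * \<epsilon> powi 0)"
      using simil_mult[OF k1 simil_cochar[OF \<xi>\<^sub>1_dominant]] by (simp add: \<xi>\<^sub>1_def)
    ultimately show ?thesis using lat_eqI[of _ "lam_mat x" _ 1] simil_lam_mat by (simp add: lat_lam_mat)
  qed
  ultimately show ?thesis
    using double_coset_iff[OF \<xi>\<^sub>1_dominant] simil_GSp4[OF simil_lam_mat] by (metis lat_lam_mat)
qed

lemma rel_inv_\<xi>\<^sub>1:
  assumes "j \<in> J_b \<epsilon> \<sigma>" "g \<in> GSp4" "lat g = translate j (lam x)" "x \<noteq> 0"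
  shows "rel_inv v \<epsilon> j g = \<xi>\<^sub>1"
proof -
  note jG = J_GSp4[OF assms(1)]
  have "lat (matrix_inv j ** g) = lat (lam_mat x)"
    by (simp add: lat_mult assms(3) translate_inv[OF jG] lat_lam_mat)
  then have "matrix_inv j ** g \<in> double_coset v \<epsilon> \<xi>\<^sub>1"
    using double_coset_cong[OF \<xi>\<^sub>1_dominant GSp4_mult[OF GSp4_inv[OF jG] assms(2)]]
      lam_mat_position[OF assms(4)] by blast
  then show ?thesis using rel_inv_eq_iff[OF jG assms(2)] \<xi>\<^sub>1_dominant by simp
qed

text \<open>The involution \<open>e\<^sub>i \<mapsto> f\<^sub>i\<^sub>-\<^sub>1\<close>, \<open>f\<^sub>i \<mapsto> - e\<^sub>i\<^sub>+\<^sub>1\<close> moves \<open>\<Lambda>\<^sub>0\<close>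
  to the point at infinity of the projective line of the \<open>\<Lambda>\<^sub>x\<close>.\<close>
definition swap :: "'l ^ 4 ^ 4" where
  "swap = cols (axis 4 (1 / \<epsilon>)) (\<Phi> (axis 4 (1 / \<epsilon>))) (axis 2 (- 1)) (\<Phi> (axis 2 (- 1)))"

lemma swap_J: "swap \<in> J_b \<epsilon> \<sigma>" and simil_swap: "simil swap 1"
  unfolding swap_def
  by (rule J_cols; simp add: axis_def \<sigma>_divide sympl_form_def)+

lemma swap_apply: "swap *v z = vector [- \<epsilon> * z $ 4, - z $ 3, z $ 2, z $ 1 / \<epsilon>]"
  by (simp add: swap_def cols_mult vec4_eq_iff axis_def \<sigma>_divide)

lemma mem_lat_swap: "z \<in> lat swap \<longleftrightarrow> z $ 1 \<in> I 1 \<and> z $ 2 \<in> I 0 \<and> z $ 3 \<in> I 0 \<and> \<epsilon> * z $ 4 \<in> I 0"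
proof
  assume "z \<in> lat swap"
  then show "z $ 1 \<in> I 1 \<and> z $ 2 \<in> I 0 \<and> z $ 3 \<in> I 0 \<and> \<epsilon> * z $ 4 \<in> I 0"
    by (auto simp: translate_def swap_apply cube_iff I_eps_mult_iff I_divide_iff v_eps)
next
  assume *: "z $ 1 \<in> I 1 \<and> z $ 2 \<in> I 0 \<and> z $ 3 \<in> I 0 \<and> \<epsilon> * z $ 4 \<in> I 0"
  define w :: "'l ^ 4" where "w = vector [\<epsilon> * z $ 4, z $ 3, - z $ 2, - (z $ 1 / \<epsilon>)]"
  have "w \<in> cube 0" using * by (simp add: w_def cube_iff I_divide_iff v_eps)
  moreover have "z = swap *v w" by (simp add: w_def swap_apply vec4_eq_iff)
  ultimately show "z \<in> lat swap" by (auto simp: translate_def)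
qed

text \<open>On slopes \<open>swap\<close> acts by x \<mapsto> -1/x. Hence the translate of Lambda_0
  by \<open>swap\<close> is also in position (1, 0, 0, -1) to every Lambda_x with x nonzero.\<close>

lemma swap_lam:
  assumes "x \<noteq> 0"
  shows "translate swap (lam (- 1 / x)) = lam x"
proof -
  have "swap *v z \<in> lam x" if "z \<in> lam (- 1 / x)" for z
  proof -
    have z: "z $ 1 \<in> I 0" "z $ 2 \<in> I 0" "z $ 3 \<in> I 0" "\<epsilon> * z $ 4 \<in> I 0" "res (\<epsilon> * z $ 4) = - 1 / x * res (z $ 1)"
      using that by (simp_all add: lam_def)
    moreover have "res (- (\<epsilon> * z $ 4)) = - res (\<epsilon> * z $ 4)" using z(4) by (rule res_minus)
    ultimately show ?thesis unfolding lam_def swap_apply using assms by simp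
  qed
  then have "lat (swap ** lam_mat (- 1 / x)) \<subseteq> lat (lam_mat x)"
    unfolding lat_mult lat_lam_mat by (auto simp: translate_def)
  then have "lat (swap ** lam_mat (- 1 / x)) = lat (lam_mat x)"
    by (rule lat_eqI[OF _ simil_mult[OF simil_swap simil_lam_mat] simil_lam_mat]) simp
  then show ?thesis by (simp add: lat_mult lat_lam_mat)
qed

text \<open>The lattice i Lambda_0 is stable under \<sigma>^2, whereas \<sigma>^2 takes a generator
  of slope x to one of slope x^(q^2).\<close>

lemma lam_not_superspecial:
  assumes "x ^ CARD('k) ^ 2 \<noteq> x" "i \<in> J_b \<epsilon> \<sigma>"
  shows "lam x \<noteq> lat i"
proof
  assume eq: "lam x = lat i"
  let ?a = "vector [1, 0, 0, teich x / \<epsilon>] :: 'l ^ 4"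
  have "?a \<in> lat i" unfolding eq[symmetric] by (simp add: lam_def teich_integral res_teich res_one)
  then have "(\<chi> k. \<sigma> (\<sigma> (?a $ k))) \<in> lam x" unfolding eq by (rule J_lat_\<sigma>_\<sigma>[OF assms(2)])
  then have "res (\<sigma> (\<sigma> (teich x))) = x" by (simp add: lam_def \<sigma>_divide res_one)
  then show False using assms(1) res_\<sigma>_\<sigma>[OF teich_integral] by (simp add: res_teich)
qed

text \<open>The lattice P of the overview, written as an intersection of two translates of Lambda_0
  by J_b(F), because such translates are what f_g can see.\<close>

definition base :: "('l ^ 4) set" where
  "base = cube 0 \<inter> lat swap"

lemma mem_base: "z \<in> base \<longleftrightarrow> z $ 1 \<in> I 1 \<and> z $ 2 \<in> I 0 \<and> z $ 3 \<in> I 0 \<and> z $ 4 \<in> I 0"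
  using I_mono[of _ 1 0] I_mono[of _ 0 "-1"] by (auto simp: base_def mem_lat_swap cube_iff I_eps_mult_iff)

lemma submod_base: "submod base"
  unfolding base_def by (intro submod_inter submod_cube submod_lat)

text \<open>M/Q is a line over the residue field, where f acts as w \<mapsto> bw followed
  semilinearly; if b were a unit, no iterate of f could kill w. The twist \<tau> is left general so
  that both \<Phi> and V are covered.\<close>

lemma nilpotent_on_quotient:
  fixes f :: "'l ^ 4 \<Rightarrow> 'l ^ 4"
  assumes Q: "submod Q" and M: "\<And>z. z \<in> M \<Longrightarrow> \<exists>a \<in> I 0. z - a *s w \<in> Q"
    and w: "w \<in> M" "\<And>a. a \<in> I 0 \<Longrightarrow> a *s w \<in> Q \<longleftrightarrow> a \<in> I 1"
    and f_diff: "\<And>x y. f (x - y) = f x - f y" and f_scale: "\<And>a x. f (a *s x) = \<tau> a *s f x"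
    and \<tau>: "\<And>a n. \<tau> a \<in> I n \<longleftrightarrow> a \<in> I n"
    and fM: "\<And>z. z \<in> M \<Longrightarrow> f z \<in> M" and fQ: "\<And>z. z \<in> Q \<Longrightarrow> f z \<in> Q"
    and nil: "f (f (f (f w))) \<in> Q" and z: "z \<in> M"
  shows "f z \<in> Q"
proof -
  obtain b where b: "b \<in> I 0" "f w - b *s w \<in> Q" using M fM w(1) by blast
  have step: "\<exists>a \<in> I 0. z - a *s w \<in> Q \<and> f z - (\<tau> a * b) *s w \<in> Q" if z: "z \<in> M" for z
  proof -
    obtain a where a: "a \<in> I 0" "z - a *s w \<in> Q" using M z by blast
    have "f z - \<tau> a *s f w \<in> Q" using fQ[OF a(2)] by (simp add: f_diff f_scale)
    moreover have "\<tau> a *s (f w - b *s w) \<in> Q" using submod_scale[OF Q _ b(2)] a(1) \<tau> by simp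
    ultimately have "(f z - \<tau> a *s f w) + \<tau> a *s (f w - b *s w) \<in> Q" by (rule submod_add[OF Q])
    moreover have "(f z - \<tau> a *s f w) + \<tau> a *s (f w - b *s w) = f z - (\<tau> a * b) *s w"
      by (simp add: vec_eq_iff algebra_simps)
    ultimately have "f z - (\<tau> a * b) *s w \<in> Q" by (simp only:)
    then show ?thesis using a by blast
  qed
  have mem: "z \<in> Q \<longleftrightarrow> a \<in> I 1" if a: "a \<in> I 0" "z - a *s w \<in> Q" for z a
  proof -
    have "z \<in> Q \<longleftrightarrow> a *s w \<in> Q"
      using submod_add[OF Q a(2), of "a *s w"] submod_diff[OF Q, of z "z - a *s w"] a(2) by auto
    then show ?thesis using w(2)[OF a(1)] by simp
  qed
  have prod: "\<tau> a * b \<in> I 0" if "a \<in> I 0" for a using that b(1) \<tau> by (simp add: I_mult_left)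
  have "b \<in> I 1"
  proof (rule ccontr)
    assume nb: "b \<notin> I 1"
    have b0: "b \<noteq> 0" "v b = 0" using unit_v[of b 0] b(1) nb by auto
    have pres: "f z \<notin> Q" if z: "z \<in> M" "z \<notin> Q" for z
    proof -
      obtain a where a: "a \<in> I 0" "z - a *s w \<in> Q" "f z - (\<tau> a * b) *s w \<in> Q" using step z by blast
      have "a \<notin> I 1" using mem[OF a(1,2)] z(2) by simp
      then have "\<tau> a * b \<notin> I 1" using I_mult_iff[OF b0(1), of "\<tau> a" 1] b0(2) \<tau> by (simp add: mult.commute)
      then show ?thesis using mem[OF prod[OF a(1)] a(3)] by simp
    qed
    have "w \<notin> Q" using w(2)[of 1] by (simp add: I_nonzero v_one)
    then show False using nil pres fM w(1) by blast
  qed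
  obtain a where a: "a \<in> I 0" "f z - (\<tau> a * b) *s w \<in> Q" using step[OF z] by blast
  have "\<tau> a * b \<in> I 1" using a(1) \<tau> \<open>b \<in> I 1\<close> by (simp add: I_mult_left)
  then show ?thesis using mem[OF prod[OF a(1)] a(2)] by simp
qed

abbreviation \<sigma>' :: "'l \<Rightarrow> 'l" where "\<sigma>' \<equiv> inv_into UNIV \<sigma>"

text \<open>The operator V = \<epsilon>\<Phi>^(-1), made explicit so that its semilinearity can be
  used.\<close>

definition Ver :: "'l ^ 4 \<Rightarrow> 'l ^ 4" where
  "Ver z = vector [\<epsilon> * \<sigma>' (z $ 2), \<sigma>' (z $ 1), \<epsilon> * \<sigma>' (z $ 4), \<sigma>' (z $ 3)]"

lemma \<sigma>_\<sigma>' [simp]: "\<sigma> (\<sigma>' x) = x"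
  using \<sigma>_bij by (simp add: bij_is_surj surj_f_inv_f)

lemma \<sigma>'_I [simp]: "\<sigma>' x \<in> I n \<longleftrightarrow> x \<in> I n"
  using \<sigma>_I_iff[of "\<sigma>' x"] by simp

lemma Ver_nth [simp]:
  "Ver z $ 1 = \<epsilon> * \<sigma>' (z $ 2)" "Ver z $ 2 = \<sigma>' (z $ 1)"
  "Ver z $ 3 = \<epsilon> * \<sigma>' (z $ 4)" "Ver z $ 4 = \<sigma>' (z $ 3)"
  by (simp_all add: Ver_def)

lemma \<Phi>_Ver: "\<Phi> (Ver z) = \<epsilon> *s z"
  by (simp add: vec4_eq_iff \<sigma>_mult)

lemma dieudonne_Ver: "dieudonne M \<Longrightarrow> z \<in> M \<Longrightarrow> Ver z \<in> M"
  unfolding dieudonne_def by (metis \<Phi>_Ver \<Phi>_eq_iff)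

lemma Ver_diff: "Ver (x - y) = Ver x - Ver y"
proof -
  have "\<Phi> (Ver (x - y)) = \<Phi> (Ver x - Ver y)" by (simp add: \<Phi>_diff \<Phi>_Ver vec_eq_iff algebra_simps)
  then show ?thesis by simp
qed

lemma Ver_scale: "Ver (a *s x) = \<sigma>' a *s Ver x"
proof -
  have "\<Phi> (Ver (a *s x)) = \<Phi> (\<sigma>' a *s Ver x)" by (simp add: \<Phi>_scale \<Phi>_Ver mult.commute)
  then show ?thesis by simp
qed

lemma dieudonne_inter: "dieudonne M \<Longrightarrow> dieudonne M' \<Longrightarrow> dieudonne (M \<inter> M')"
  unfolding dieudonne_def by (metis \<Phi>_eq_iff Int_iff)

text \<open>\<open>\<Phi>\<close> and \<open>V\<close> vanish on the one-dimensional \<open>\<Lambda>\<^sub>x/(\<Lambda>\<^sub>x \<inter> i\<Lambda>\<^sub>0)\<close>, and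
  \<open>\<Phi>\<Lambda>\<^sub>x + V\<Lambda>\<^sub>x\<close> is the lattice \<open>base\<close>.\<close>
lemma base_subset:
  assumes i: "i \<in> J_b \<epsilon> \<sigma>" and x: "x ^ CARD('k) ^ 2 \<noteq> x"
    and pos: "matrix_inv i ** lam_mat x \<in> double_coset v \<epsilon> \<xi>\<^sub>1"
    and D: "dieudonne (lam x)"
  shows "base \<subseteq> lat i"
proof -
  note iG = J_GSp4[OF i]
  obtain k where k: "k \<in> K_stab v \<epsilon>" "lat (matrix_inv i ** lam_mat x) = lat (k ** cochar_at \<xi>\<^sub>1 \<epsilon>)"
    using pos double_coset_iff[OF \<xi>\<^sub>1_dominant] by blast
  define h where "h = i ** k"
  have hG: "h \<in> GSp4" unfolding h_def by (rule GSp4_mult[OF iG K_GSp4[OF k(1)]])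
  have lat_i: "lat i = lat h" using k(1) by (simp add: h_def lat_mult K_stab_iff)
  have lam_h: "lam x = translate h (lat (cochar_at \<xi>\<^sub>1 \<epsilon>))"
  proof -
    have "lam x = translate i (lat (matrix_inv i ** lam_mat x))"
      by (simp add: lat_mult lat_lam_mat translate_inv(2)[OF iG])
    then show ?thesis unfolding k(2) h_def by (simp add: translate_mult)
  qed
  define Q where "Q = lam x \<inter> lat i"
  have Q: "Q = translate h base"
  proof -
    have "base = lat (cochar_at \<xi>\<^sub>1 \<epsilon>) \<inter> cube 0"
      using I_mono[of _ 1 0] I_mono[of _ 0 "-1"] by (auto simp: mem_base mem_lat_\<xi>\<^sub>1 cube_iff)
    then show ?thesis by (simp add: Q_def lat_i lam_h translate_inter[OF hG])
  qed
  have subQ: "submod Q" unfolding Q by (rule submod_translate[OF submod_base])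
  have DQ: "dieudonne Q" unfolding Q_def by (rule dieudonne_inter[OF D dieudonne_lat_J[OF i]])
  define w where "w = h *v axis 4 (1 / \<epsilon>)"
  have "axis 4 (1 / \<epsilon>) \<in> lat (cochar_at \<xi>\<^sub>1 \<epsilon>)"
    by (simp add: mem_lat_\<xi>\<^sub>1 axis_def I_divide_iff v_eps)
  then have wM: "w \<in> lam x" unfolding lam_h w_def translate_def by (rule imageI)
  have inv_h: "matrix_inv h *v (h *v z) = z" for z by (rule matrix_inv_apply(1)[OF GSp4_invertible[OF hG]])
  have wQ: "a *s w \<in> Q \<longleftrightarrow> a \<in> I 1" for a
  proof -
    have "a *s w \<in> Q \<longleftrightarrow> axis 4 (a / \<epsilon>) \<in> base"
    proof -
      have "a *s w = h *v axis 4 (a / \<epsilon>)"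
        unfolding w_def vector_scalar_commute[symmetric] by (rule arg_cong[of _ _ "(*v) h"]) (simp add: vec4_eq_iff axis_def)
      then show ?thesis unfolding Q mem_translate_iff[OF hG] by (simp add: inv_h)
    qed
    then show ?thesis by (simp add: mem_base axis_def I_divide_iff v_eps)
  qed
  have quot: "\<exists>a\<in>I 0. z - a *s w \<in> Q" if z: "z \<in> lam x" for z
  proof -
    obtain y where y: "y \<in> lat (cochar_at \<xi>\<^sub>1 \<epsilon>)" "z = h *v y" using z unfolding lam_h translate_def by blast
    have "z - (\<epsilon> * y $ 4) *s w = h *v (y - axis 4 (y $ 4))"
    proof -
      have "(\<epsilon> * y $ 4) *s w = h *v axis 4 (y $ 4)"
        unfolding w_def vector_scalar_commute[symmetric] by (rule arg_cong[of _ _ "(*v) h"]) (simp add: vec4_eq_iff axis_def)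
      then show ?thesis by (simp add: y(2) matrix_vector_mult_diff_distrib)
    qed
    moreover have "y - axis 4 (y $ 4) \<in> base" using y(1) by (simp add: mem_base mem_lat_\<xi>\<^sub>1 axis_def)
    ultimately have "z - (\<epsilon> * y $ 4) *s w \<in> Q" by (simp add: Q mem_translate_iff[OF hG] inv_h)
    moreover have "\<epsilon> * y $ 4 \<in> I 0" using y(1) by (simp add: mem_lat_\<xi>\<^sub>1 I_eps_mult_iff)
    ultimately show ?thesis by blast
  qed
  have eQ: "\<epsilon> *s z \<in> Q" if z: "z \<in> lam x" for z
  proof -
    obtain a where a: "a \<in> I 0" "z - a *s w \<in> Q" using quot z by blast
    have "\<epsilon> *s (z - a *s w) \<in> Q" using submod_scale[OF subQ I_mono[OF eps_I] a(2)] by simp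
    moreover have "(\<epsilon> * a) *s w \<in> Q" using wQ a(1) by (simp add: I_eps_mult_iff)
    ultimately have "\<epsilon> *s (z - a *s w) + (\<epsilon> * a) *s w \<in> Q" by (rule submod_add[OF subQ])
    moreover have "\<epsilon> *s (z - a *s w) + (\<epsilon> * a) *s w = \<epsilon> *s z" by (simp add: vec_eq_iff algebra_simps)
    ultimately show ?thesis by (simp only:)
  qed
  \<comment> \<open>\<epsilon>P^\<or> lies in Lambda_x, and \<epsilon>Lambda_x in Q. Since
    \<sigma>^2 need not preserve Lambda_x but preserves P^\<or>, nilpotency is read off from the
    fourth power, which brings in \<epsilon>^2.\<close>
  have small: "(\<epsilon> * \<epsilon>) *s z \<in> Q"
    if "z $ 1 \<in> I 0" "z $ 2 \<in> I 0" "z $ 3 \<in> I 0" "\<epsilon> * z $ 4 \<in> I 0" for z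
  proof -
    have "\<epsilon> * z $ 1 \<in> I 1" "\<epsilon> * z $ 2 \<in> I 0" "\<epsilon> * z $ 3 \<in> I 0" "\<epsilon> * (\<epsilon> * z $ 4) \<in> I 1"
      using that I_mono[of _ 0 "-1"] by (simp_all add: I_eps_mult_iff)
    then have "\<epsilon> *s z \<in> lam x"
      using that res_0_iff[of "\<epsilon> * z $ 1"] res_0_iff[of "\<epsilon> * (\<epsilon> * z $ 4)"] I_mono[of _ 1 0]
      by (simp add: lam_def)
    from eQ[OF this] show ?thesis by simp
  qed
  have wI: "w $ 1 \<in> I 0" "w $ 2 \<in> I 0" "w $ 3 \<in> I 0" "\<epsilon> * w $ 4 \<in> I 0" using wM by (simp_all add: lam_def)
  have \<Phi>Q: "\<Phi> z \<in> Q" if "z \<in> lam x" for z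
  proof (rule nilpotent_on_quotient[of Q "lam x" w \<Phi> \<sigma>])
    have "\<Phi> (\<Phi> (\<Phi> (\<Phi> w))) = (\<epsilon> * \<epsilon>) *s (\<chi> i. \<sigma> (\<sigma> (\<sigma> (\<sigma> (w $ i)))))"
      by (simp add: vec4_eq_iff \<sigma>_mult)
    moreover have "(\<epsilon> * \<epsilon>) *s (\<chi> i. \<sigma> (\<sigma> (\<sigma> (\<sigma> (w $ i))))) \<in> Q"
      by (rule small) (use wI in \<open>simp_all add: I_eps_mult_iff\<close>)
    ultimately show "\<Phi> (\<Phi> (\<Phi> (\<Phi> w))) \<in> Q" by simp
  qed (use subQ quot wM wQ D DQ that in \<open>simp_all add: \<Phi>_diff \<Phi>_scale dieudonne_def\<close>)
  have VQ: "Ver z \<in> Q" if "z \<in> lam x" for z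
  proof (rule nilpotent_on_quotient[of Q "lam x" w Ver "\<sigma>'"])
    have [simp]: "\<sigma>' (\<epsilon> * y) = \<epsilon> * \<sigma>' y" for y
    proof -
      have "\<sigma> (\<sigma>' (\<epsilon> * y)) = \<sigma> (\<epsilon> * \<sigma>' y)" by (simp add: \<sigma>_mult)
      then show ?thesis by (simp only: \<sigma>_eq_iff)
    qed
    have "Ver (Ver (Ver (Ver w))) = (\<epsilon> * \<epsilon>) *s (\<chi> i. \<sigma>' (\<sigma>' (\<sigma>' (\<sigma>' (w $ i)))))"
      by (simp add: vec4_eq_iff)
    moreover have "(\<epsilon> * \<epsilon>) *s (\<chi> i. \<sigma>' (\<sigma>' (\<sigma>' (\<sigma>' (w $ i))))) \<in> Q"
      by (rule small) (use wI in \<open>simp_all add: I_eps_mult_iff\<close>)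
    ultimately show "Ver (Ver (Ver (Ver w))) \<in> Q" by simp
  qed (use subQ quot wM wQ D DQ that in \<open>simp_all add: Ver_diff Ver_scale dieudonne_Ver\<close>)
  let ?a = "vector [1, 0, 0, teich x / \<epsilon>] :: 'l ^ 4"
  have a: "?a \<in> lam x" by (simp add: lam_def teich_integral res_teich res_one)
  define u where "u = \<epsilon> * \<sigma>' (teich x / \<epsilon>)"
  have \<sigma>u: "\<sigma> u = teich x" by (simp add: u_def \<sigma>_mult)
  then have uI: "u \<in> I 0" using \<sigma>_I_iff[of u 0] teich_integral by simp
  \<comment> \<open>The f_1-coefficient of \<Phi>a - Va for the generator a = e_1 + [x] f_0. It is a
    unit exactly because x is irrational, so f_1 lies in Q; the remaining generators of P follow by
    \<Phi>.\<close>
  define \<delta> where "\<delta> = \<sigma> (teich x) - u"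
  have \<delta>I: "\<delta> \<in> I 0" unfolding \<delta>_def using uI teich_integral by (intro I_diff) simp_all
  have "\<sigma> \<delta> = \<sigma> (\<sigma> (teich x)) - teich x" by (simp add: \<delta>_def \<sigma>_diff \<sigma>u)
  then have "res (\<sigma> \<delta>) = x ^ CARD('k) ^ 2 - x"
    using teich_integral by (simp add: res_diff res_\<sigma>_\<sigma> res_teich)
  then have "\<sigma> \<delta> \<notin> I 1" using x \<delta>I res_0_iff[of "\<sigma> \<delta>"] by simp
  then have \<delta>: "\<delta> \<noteq> 0" "v \<delta> = 0" using unit_v[of \<delta> 0] \<delta>I by auto
  have "\<Phi> ?a - Ver ?a \<in> Q" using \<Phi>Q[OF a] VQ[OF a] by (rule submod_diff[OF subQ])
  moreover have "\<Phi> ?a - Ver ?a = \<delta> *s axis 3 1"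
  proof -
    have "\<sigma>' 1 = 1" "\<sigma>' 0 = 0" using \<sigma>_eq_iff \<sigma>_\<sigma>' \<sigma>_1 \<sigma>_0 by metis+
    then show ?thesis by (simp add: vec4_eq_iff axis_def \<delta>_def \<sigma>_divide flip: u_def)
  qed
  ultimately have "\<delta> *s axis 3 1 \<in> Q" by (simp only:)
  then have "inverse \<delta> *s (\<delta> *s axis 3 1) \<in> Q"
    by (rule submod_scale[OF subQ, rotated]) (simp add: \<delta> I_nonzero v_inverse)
  then have f1: "axis 3 1 \<in> Q" using \<delta>(1) by simp
  have "\<Phi> ?a - \<sigma> (teich x) *s axis 3 1 \<in> Q"
    using \<Phi>Q[OF a] submod_scale[OF subQ _ f1] teich_integral by (intro submod_diff[OF subQ]) simp_all
  moreover have "\<Phi> ?a - \<sigma> (teich x) *s axis 3 1 = axis 2 1"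
    by (simp add: vec4_eq_iff axis_def \<sigma>_divide)
  ultimately have e2: "axis 2 1 \<in> Q" by simp
  have \<Phi>QQ: "\<Phi> z \<in> Q" if "z \<in> Q" for z using DQ that by (simp add: dieudonne_def)
  have "\<Phi> (axis 2 1) = axis 1 \<epsilon>" "\<Phi> (axis 3 1) = axis 4 1" by (simp_all add: vec4_eq_iff axis_def)
  then have "axis 1 \<epsilon> \<in> Q" "axis 4 1 \<in> Q" using \<Phi>QQ e2 f1 by metis+
  have "z \<in> Q" if z: "z \<in> base" for z
  proof -
    have "z = (z $ 1 / \<epsilon>) *s axis 1 \<epsilon> + z $ 2 *s axis 2 1 + z $ 3 *s axis 3 1 + z $ 4 *s axis 4 1"
      by (simp add: vec4_eq_iff axis_def)
    moreover have "\<dots> \<in> Q"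
      using z \<open>axis 1 \<epsilon> \<in> Q\<close> \<open>axis 4 1 \<in> Q\<close> e2 f1
      by (intro submod_add[OF subQ] submod_scale[OF subQ]) (simp_all add: mem_base I_divide_iff v_eps)
    ultimately show ?thesis by simp
  qed
  then show ?thesis by (auto simp: Q_def)
qed

text \<open>Both k and its inverse preserve integrality of the pairing, so the multiplier and its
  inverse are integral.\<close>

lemma K_simil_v:
  assumes "k \<in> K_stab v \<epsilon>" "simil k c"
  shows "v c = 0"
proof -
  have le: "0 \<le> v d" if k: "k \<in> K_stab v \<epsilon>" "simil k d" for k d
  proof -
    have "axis 1 1 \<in> cube 0" "axis 4 1 \<in> cube 0" by (simp_all add: cube_iff axis_def)
    then have "sympl_form (k *v axis 1 1) (k *v axis 4 1) \<in> I 0"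
      using K_preserves_cube[OF k(1)] by (intro sympl_form_cube[of _ 0 _ 0]) auto
    moreover have "sympl_form (axis 1 1) (axis 4 1) = (1 :: 'l)" by (simp add: sympl_form_def axis_def)
    ultimately have "d \<in> I 0" by (simp add: simil_form[OF k(2)])
    then show ?thesis using simil_nonzero[OF k(2)] by (simp add: I_nonzero)
  qed
  show ?thesis
    using le[OF assms] le[OF K_inv[OF assms(1)] simil_inv[OF assms(2)]] simil_nonzero[OF assms(2)]
    by (simp add: v_inverse)
qed

text \<open>Equal functions force jP = j'P. Then g'Lambda_0 is given by a line in jP^\<or>/jP, and
  neither the line at infinity nor a rational slope can occur, as Lambda_y is not a translate of
  Lambda_0 by J_b(F).\<close>

lemma same_stratum:
  assumes g: "g \<in> GSp4" "dieudonne (lat g)" and g': "g' \<in> GSp4" "dieudonne (lat g')"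
    and j: "j \<in> J_b \<epsilon> \<sigma>" and x: "x ^ CARD('k) ^ 2 \<noteq> x" "lat g = translate j (lam x)"
    and j': "j' \<in> J_b \<epsilon> \<sigma>" and y: "y ^ CARD('k) ^ 2 \<noteq> y" "lat g' = translate j' (lam y)"
    and eq: "\<And>j. j \<in> J_b \<epsilon> \<sigma> \<Longrightarrow> rel_inv v \<epsilon> j g = rel_inv v \<epsilon> j g'"
  shows "\<exists>z. z ^ CARD('k) ^ 2 \<noteq> z \<and> lat g' = translate j (lam z)"
proof -
  \<comment> \<open>Stated for arbitrary data because it is used in both directions to obtain
    equality.\<close>
  have sub: "base \<subseteq> translate (matrix_inv j' ** j) base"
    and pos: "rel_inv v \<epsilon> j g' = \<xi>\<^sub>1"
    if g: "g \<in> GSp4" and g': "g' \<in> GSp4" "dieudonne (lat g')"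
      and j: "j \<in> J_b \<epsilon> \<sigma>" and x: "x ^ CARD('k) ^ 2 \<noteq> x" "lat g = translate j (lam x)"
      and j': "j' \<in> J_b \<epsilon> \<sigma>" and y: "y ^ CARD('k) ^ 2 \<noteq> y" "lat g' = translate j' (lam y)"
      and eq: "\<And>j. j \<in> J_b \<epsilon> \<sigma> \<Longrightarrow> rel_inv v \<epsilon> j g = rel_inv v \<epsilon> j g'" for g g' j j' x y
  proof -
    have x0: "x \<noteq> 0" using x(1) by (auto simp: power_0_left)
    define i where "i = matrix_inv j' ** j"
    have i: "i \<in> J_b \<epsilon> \<sigma>" unfolding i_def by (rule J_mult[OF J_inv[OF j'] j])
    have D: "dieudonne (lam y)"
      using dieudonne_translate[OF J_inv[OF j'] g'(2)] by (simp add: y(2) translate_inv[OF J_GSp4[OF j']])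
    have base: "base \<subseteq> lat (i ** s)" if s: "s \<in> J_b \<epsilon> \<sigma>" "rel_inv v \<epsilon> (j ** s) g' = \<xi>\<^sub>1" for s
    proof (rule base_subset[OF J_mult[OF i s(1)] y(1) _ D])
      note js = J_GSp4[OF J_mult[OF j s(1)]]
      have isG: "i ** s \<in> GSp4" by (rule J_GSp4[OF J_mult[OF i s(1)]])
      have "matrix_inv (j ** s) ** g' \<in> double_coset v \<epsilon> \<xi>\<^sub>1"
        using rel_inv_eq_iff[OF js g'(1)] s(2) by blast
      moreover have "lat (matrix_inv (i ** s) ** lam_mat y) = lat (matrix_inv (j ** s) ** g')"
      proof -
        have "translate (i ** s) (lat (matrix_inv (j ** s) ** g'))
          = translate (matrix_inv j') (translate (j ** s) (lat (matrix_inv (j ** s) ** g')))"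
          by (simp add: i_def translate_mult)
        also have "\<dots> = lam y"
          by (simp add: lat_mult translate_inv[OF js] y(2) translate_inv[OF J_GSp4[OF j']])
        finally have "lat (matrix_inv (i ** s) ** lam_mat y)
          = translate (matrix_inv (i ** s)) (translate (i ** s) (lat (matrix_inv (j ** s) ** g')))"
          by (simp add: lat_mult lat_lam_mat)
        then show ?thesis by (simp add: translate_inv[OF isG])
      qed
      ultimately show "matrix_inv (i ** s) ** lam_mat y \<in> double_coset v \<epsilon> \<xi>\<^sub>1"
        using double_coset_cong[OF \<xi>\<^sub>1_dominant GSp4_mult[OF GSp4_inv[OF isG] simil_GSp4[OF simil_lam_mat]]]
        by blast
    qed
    show pos: "rel_inv v \<epsilon> j g' = \<xi>\<^sub>1"
      using rel_inv_\<xi>\<^sub>1[OF j g x(2) x0] eq[OF j] by simp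
    \<comment> \<open>The two lattices whose intersection is jP are both in position (1, 0, 0, -1)
      to g Lambda_0, hence also to g'Lambda_0.\<close>
    have "lat g = translate (j ** swap) (lam (- 1 / x))"
      by (simp only: translate_mult swap_lam[OF x0] x(2))
    then have "rel_inv v \<epsilon> (j ** swap) g = \<xi>\<^sub>1"
      by (rule rel_inv_\<xi>\<^sub>1[OF J_mult[OF j swap_J] g]) (use x0 in simp)
    then have "base \<subseteq> lat (i ** swap)" using base[OF swap_J] eq[OF J_mult[OF j swap_J]] by simp
    moreover have "base \<subseteq> lat i" using base[OF J_mat_1] pos by simp
    ultimately show "base \<subseteq> translate (matrix_inv j' ** j) base"
      unfolding base_def i_def[symmetric] translate_inter[OF J_GSp4[OF i]] lat_mult by blast
  qed
  define i where "i = matrix_inv j' ** j"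
  have i: "i \<in> J_b \<epsilon> \<sigma>" unfolding i_def by (rule J_mult[OF J_inv[OF j'] j])
  note iG = J_GSp4[OF i]
  have tr_i: "translate (matrix_inv i) M = translate (matrix_inv j) (translate j' M)" for M
  proof -
    have "translate i (translate (matrix_inv j) (translate j' M)) = M"
      by (simp add: i_def translate_mult translate_inv J_GSp4 j j')
    then show ?thesis using translate_inv(1)[OF iG] by metis
  qed
  have "base \<subseteq> translate (matrix_inv j ** j') base"
    using sub[OF g'(1) g j' y j x] eq by simp
  then have "base \<subseteq> translate (matrix_inv i) base" by (simp add: tr_i translate_mult)
  have i_base: "translate (matrix_inv i) base = base"
  proof
    show "translate (matrix_inv i) base \<subseteq> base"
      using translate_mono[OF sub[OF g(1) g' j x j' y eq], of "matrix_inv i"]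
      by (simp add: translate_inv[OF iG] flip: i_def)
  qed fact
  obtain k where k: "k \<in> K_stab v \<epsilon>" "lat (matrix_inv j ** g') = lat (k ** cochar_at \<xi>\<^sub>1 \<epsilon>)"
    using pos[OF g(1) g' j x j' y eq] rel_inv_eq_iff[OF J_GSp4[OF j] g'(1)] double_coset_iff[OF \<xi>\<^sub>1_dominant]
    by metis
  define h where "h = k ** cochar_at \<xi>\<^sub>1 \<epsilon>"
  obtain c where c: "simil k c" using K_GSp4[OF k(1)] by (rule GSp4_similE)
  have "simil h (c * \<epsilon> powi (\<xi>\<^sub>1 $ 1 + \<xi>\<^sub>1 $ 4))"
    unfolding h_def by (rule simil_mult[OF c simil_cochar[OF \<xi>\<^sub>1_dominant]])
  \<comment> \<open>The entries 1 and -1 cancel in the multiplier, so the multiplier of h is a unit,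
    as is that of the lattices Lambda_z with which it is compared.\<close>
  then have h: "simil h c" by (simp add: \<xi>\<^sub>1_def)
  have vc: "v c = 0" by (rule K_simil_v[OF k(1) c])
  have lat_h: "lat h = translate (matrix_inv i) (lam y)"
    using k(2) by (simp add: h_def tr_i lat_mult flip: y(2))
  let ?a = "vector [1, 0, 0, teich y / \<epsilon>] :: 'l ^ 4"
  define w where "w = matrix_inv i *v ?a"
  have a: "?a \<in> lam y" by (simp add: lam_def teich_integral res_teich res_one)
  then have "w \<in> translate (matrix_inv i) (lam y)" unfolding w_def translate_def by (rule imageI)
  then have w: "w \<in> lat h" by (simp only: lat_h)
  have base_lam: "base \<subseteq> lam t" for t
  proof
    fix z assume "z \<in> base"
    then have z: "z $ 1 \<in> I 1" "z $ 2 \<in> I 0" "z $ 3 \<in> I 0" "\<epsilon> * z $ 4 \<in> I 1"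
      by (simp_all add: mem_base I_eps_mult_iff)
    then show "z \<in> lam t"
      using I_mono[of _ 1 0] res_0_iff[of "z $ 1"] res_0_iff[of "\<epsilon> * z $ 4"] by (simp add: lam_def)
  qed
  have base_h: "base \<subseteq> lat h"
    using translate_mono[OF base_lam, of "matrix_inv i"] by (simp add: lat_h i_base)
  have quot: "\<exists>s\<in>I 0. z - s *s w \<in> base" if z: "z \<in> lat h" for z
  proof -
    obtain z' where z': "z' \<in> lam y" "z = matrix_inv i *v z'" using z unfolding lat_h unfolding translate_def by blast
    have z1: "z' $ 1 \<in> I 0" using z'(1) by (simp add: lam_def)
    have "z' $ 4 - z' $ 1 * (teich y / \<epsilon>) \<in> I 0"
    proof -
      have "\<epsilon> * z' $ 4 - z' $ 1 * teich y \<in> I 1"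
        using z'(1) teich_integral
        by (subst res_eq_iff[symmetric]) (auto simp: lam_def res_mult res_teich I_mult_left)
      moreover have "\<epsilon> * z' $ 4 - z' $ 1 * teich y = \<epsilon> * (z' $ 4 - z' $ 1 * (teich y / \<epsilon>))"
        by (simp add: algebra_simps)
      ultimately show ?thesis using I_eps_mult_iff[of "z' $ 4 - z' $ 1 * (teich y / \<epsilon>)" 1] by simp
    qed
    then have "z' - z' $ 1 *s ?a \<in> base" using z'(1) by (simp add: mem_base lam_def)
    then have "matrix_inv i *v (z' - z' $ 1 *s ?a) \<in> translate (matrix_inv i) base"
      unfolding translate_def by (rule imageI)
    then have "z - z' $ 1 *s w \<in> base"
      by (simp add: i_base z'(2) w_def matrix_vector_mult_diff_distrib vector_scalar_commute)
    then show ?thesis using z1 by blast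
  qed
  have generated: "lat h \<subseteq> M" if "submod M" "base \<subseteq> M" "w \<in> M" for M
  proof
    fix z assume "z \<in> lat h"
    then obtain s where "s \<in> I 0" "z - s *s w \<in> base" using quot by blast
    then have "(z - s *s w) + s *s w \<in> M" using that by (intro submod_add submod_scale) auto
    then show "z \<in> M" by simp
  qed
  \<comment> \<open>As base lies in the self-dual lattice of h, w lies in P^\<or>; its coordinates
    are read off from generators of P.\<close>
  have pairing: "sympl_form w b \<in> I 0" if "b \<in> base" for b
    using lat_form[OF h w] base_h that vc by auto
  have "axis 2 1 \<in> base" "axis 3 1 \<in> base" "axis 4 1 \<in> base" "axis 1 \<epsilon> \<in> base"
    by (simp_all add: mem_base axis_def)
  from this[THEN pairing] have wI: "w $ 1 \<in> I 0" "w $ 2 \<in> I 0" "w $ 3 \<in> I 0" "\<epsilon> * w $ 4 \<in> I 0"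
    by (simp_all add: sympl_form_def axis_def mult.commute)
  have tr_h: "translate i (lat h) = lam y" by (simp add: lat_h translate_inv[OF iG])
  \<comment> \<open>Vanishing would be the line at infinity, that is, the lattice of
    \<open>swap\<close>.\<close>
  have "res (w $ 1) \<noteq> 0"
  proof
    assume "res (w $ 1) = 0"
    then have "w \<in> lat swap" using wI res_0_iff by (simp add: mem_lat_swap)
    then have "lat h \<subseteq> lat swap"
      by (intro generated submod_lat) (auto simp: base_def)
    then have "lat h = lat swap" using h simil_swap by (rule lat_eqI) (simp add: vc v_one)
    then have "lam y = lat (i ** swap)" using tr_h by (simp add: lat_mult)
    then show False using lam_not_superspecial[OF y(1) J_mult[OF i swap_J]] by simp
  qed
  define z where "z = res (\<epsilon> * w $ 4) / res (w $ 1)"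
  have "w \<in> lam z" using wI \<open>res (w $ 1) \<noteq> 0\<close> by (simp add: lam_def z_def)
  then have "lat h \<subseteq> lam z" by (intro generated submod_lam base_lam)
  then have hz: "lat h = lam z"
    using lat_eqI[of h "lam_mat z" c 1] h simil_lam_mat by (simp add: lat_lam_mat vc v_one)
  have "z ^ CARD('k) ^ 2 \<noteq> z"
  proof
    assume "z ^ CARD('k) ^ 2 = z"
    then obtain s where s: "s \<in> J_b \<epsilon> \<sigma>" "lam z = lat s" using lam_superspecial by blast
    then have "lam y = lat (i ** s)" using tr_h hz by (simp add: lat_mult)
    then show False using lam_not_superspecial[OF y(1) J_mult[OF i s(1)]] by simp
  qed
  moreover have "lat g' = translate j (lam z)"
  proof -
    have "translate j (lam z) = translate j (translate (matrix_inv j) (translate j' (lam y)))"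
      by (simp add: lat_h tr_i flip: hz)
    then show ?thesis by (simp add: translate_inv[OF J_GSp4[OF j]] y(2))
  qed
  ultimately show ?thesis by blast
qed

theorem strata_iff_f_inv:
  assumes "g \<in> X_mu_b v \<epsilon> \<sigma>" and "g' \<in> X_mu_b v \<epsilon> \<sigma>"
  shows "(\<exists>S \<in> kaiser_strata v \<epsilon> \<sigma> teich. lat g \<in> S \<and> lat g' \<in> S)
    \<longleftrightarrow> f_inv v \<epsilon> \<sigma> g = f_inv v \<epsilon> \<sigma> g'"
proof -
  note g = X_mu_b_dieudonne[OF assms(1)] and g' = X_mu_b_dieudonne[OF assms(2)]
  have f_inv: "f_inv v \<epsilon> \<sigma> g = f_inv v \<epsilon> \<sigma> g' \<longleftrightarrow> (\<forall>j\<in>J_b \<epsilon> \<sigma>. rel_inv v \<epsilon> j g = rel_inv v \<epsilon> j g')"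
    by (auto simp: f_inv_def restrict_def fun_eq_iff)
  have strata: "(\<exists>S \<in> kaiser_strata v \<epsilon> \<sigma> teich. M \<in> S \<and> M' \<in> S) \<longleftrightarrow>
    (\<exists>j\<in>J_b \<epsilon> \<sigma>. M = lat j \<and> M' = lat j) \<or>
    (\<exists>j\<in>J_b \<epsilon> \<sigma>. (\<exists>x. x ^ CARD('k) ^ 2 \<noteq> x \<and> M = translate j (lam x)) \<and>
      (\<exists>x. x ^ CARD('k) ^ 2 \<noteq> x \<and> M' = translate j (lam x)))" for M M'
    unfolding kaiser_strata_def Lambda0_eq Lambda_eq by (simp add: bex_Un) blast
  show ?thesis unfolding strata f_inv
  proof
    assume "(\<exists>j\<in>J_b \<epsilon> \<sigma>. lat g = lat j \<and> lat g' = lat j) \<or>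
      (\<exists>j\<in>J_b \<epsilon> \<sigma>. (\<exists>x. x ^ CARD('k) ^ 2 \<noteq> x \<and> lat g = translate j (lam x)) \<and>
        (\<exists>x. x ^ CARD('k) ^ 2 \<noteq> x \<and> lat g' = translate j (lam x)))"
    then show "\<forall>j\<in>J_b \<epsilon> \<sigma>. rel_inv v \<epsilon> j g = rel_inv v \<epsilon> j g'"
    proof
      assume "\<exists>j\<in>J_b \<epsilon> \<sigma>. lat g = lat j \<and> lat g' = lat j"
      then have "lat g = lat g'" by auto
      then show ?thesis using rel_inv_cong[OF J_GSp4 g(1) g'(1)] by blast
    qed (use rel_inv_constant_on_stratum[OF _ _ g(1) g'(1)] in metis)
  next
    assume *: "\<forall>j\<in>J_b \<epsilon> \<sigma>. rel_inv v \<epsilon> j g = rel_inv v \<epsilon> j g'"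
    show "(\<exists>j\<in>J_b \<epsilon> \<sigma>. lat g = lat j \<and> lat g' = lat j) \<or>
      (\<exists>j\<in>J_b \<epsilon> \<sigma>. (\<exists>x. x ^ CARD('k) ^ 2 \<noteq> x \<and> lat g = translate j (lam x)) \<and>
        (\<exists>x. x ^ CARD('k) ^ 2 \<noteq> x \<and> lat g' = translate j (lam x)))"
    \<comment> \<open>If one of the two lattices is a translate of Lambda_0 by J_b(F), the value 0
      at that j forces the other to be the same lattice.\<close>
    proof (cases "\<exists>j\<in>J_b \<epsilon> \<sigma>. lat g = lat j \<or> lat g' = lat j")
      case True
      then obtain j where j: "j \<in> J_b \<epsilon> \<sigma>" "lat g = lat j \<or> lat g' = lat j" by blast
      then have "lat g = lat j \<and> lat g' = lat j"
        using * rel_inv_0_iff[OF J_GSp4[OF j(1)]] g(1) g'(1) by metis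
      then show ?thesis using j(1) by blast
    next
      case False
      have irrational: "x ^ CARD('k) ^ 2 \<noteq> x"
        if h: "j \<in> J_b \<epsilon> \<sigma>" "h = g \<or> h = g'" "lat h = translate j (lam x)" for h j x
      proof
        assume "x ^ CARD('k) ^ 2 = x"
        then obtain i where "i \<in> J_b \<epsilon> \<sigma>" "lam x = lat i" using lam_superspecial by blast
        then have "j ** i \<in> J_b \<epsilon> \<sigma>" "lat h = lat (j ** i)" using h J_mult by (simp_all add: lat_mult)
        then show False using False h(2) by blast
      qed
      obtain j x where j: "j \<in> J_b \<epsilon> \<sigma>" "lat g = translate j (lam x)" using classification[OF g] by blast
      obtain j' y where j': "j' \<in> J_b \<epsilon> \<sigma>" "lat g' = translate j' (lam y)" using classification[OF g'] by blast
      have "\<exists>z. z ^ CARD('k) ^ 2 \<noteq> z \<and> lat g' = translate j (lam z)"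
        using * by (intro same_stratum[OF g g' j(1) _ j(2) j'(1) _ j'(2)])
          (use irrational[OF j(1) _ j(2)] irrational[OF j'(1) _ j'(2)] in auto)
      then show ?thesis using j irrational[OF j(1) _ j(2)] by blast
    qed
  qed
qed

end

theorem proposition4p3:
  fixes v :: "'l::field \<Rightarrow> int"
    and res :: "'l \<Rightarrow> 'k::finite_field alg_closure"
    and F :: "'l set"
    and \<epsilon> :: 'l
    and \<sigma> :: "'l \<Rightarrow> 'l"
    and teich :: "'k alg_closure \<Rightarrow> 'l"
    and g g' :: "'l ^ 4 ^ 4"
  assumes "completed_unramified_extension v res F \<epsilon> \<sigma> teich"
    and "g \<in> X_mu_b v \<epsilon> \<sigma>" and "g' \<in> X_mu_b v \<epsilon> \<sigma>"
  shows "(\<exists>S \<in> kaiser_strata v \<epsilon> \<sigma> teich.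
            translate g (Lambda0 v \<epsilon>) \<in> S \<and> translate g' (Lambda0 v \<epsilon>) \<in> S)
         \<longleftrightarrow> f_inv v \<epsilon> \<sigma> g = f_inv v \<epsilon> \<sigma> g'"
proof -
  interpret completed_unramified_extension v res F \<epsilon> \<sigma> teich by fact
  show ?thesis unfolding Lambda0_eq by (rule strata_iff_f_inv[OF assms(2,3)])
qed

end
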